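(* Let $N\ge1$. (i) Let $u\in L^p(\mathbb{R}^N)$ for some $1<p<\infty$. Then $$u\in W^{2,p}(\mathbb{R}^N)\iff\liminf_{n\to\infty}\int_{\mathbb{R}^N}|\mathfrak{H}_nu(x)|^p\,dx<\infty.$$ (ii) Let $u\in L^1(\mathbb{R}^N)$. Then $$u\in\mathrm{BV}^2(\mathbb{R}^N)\iff\liminf_{n\to\infty}\int_{\mathbb{R}^N}|\mathfrak{H}_nu(x)|\,dx<\infty.$$
   Context: Standing assumptions: $(\rho_n)_{n\in\mathbb{N}}$ is a sequence of radial functions on $\mathbb{R}^N$ such that for all $n$: $\rho_n\ge 0$, $\int_{\mathbb{R}^N}\rho_n(x)\,dx=1$, and $\lim_{n\to\infty}\int_{|x|>\gamma}\rho_n(x)\,dx=0$ for every $\gamma>0$. For $\varphi\in C_c^2(\mathbb{R}^N)$ the non-local Hessian is $$H_n\varphi(x):=\frac{N(N+2)}{2}\int_{\mathbb{R}^N}\frac{\varphi(x+h)-2\varphi(x)+\varphi(x-h)}{|h|^2}\,\frac{h\otimes h-\frac{|h|^2}{N+2}I_N}{|h|^2}\,\rho_n(h)\,dh\in\mathbb{R}^{N\times N},$$ with entries $H_n^{ij}\varphi$, where $I_N$ is the $N\times N$ identity matrix and $h\otimes h=hh^{\top}$. For $u\in L^p(\mathbb{R}^N)$ the distributional non-local Hessian $\mathfrak{H}_nu$ is the matrix-valued distribution given componentwise by $\langle\mathfrak{H}_n^{ij}u,\varphi\rangle:=\int_{\mathbb{R}^N}u\,H_n^{ij}\varphi\,dx$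 for $\varphi\in C_c^\infty(\mathbb{R}^N)$. The integral $\int_{\mathbb{R}^N}|\mathfrak{H}_nu|^p\,dx$ is understood as $+\infty$ if $\mathfrak{H}_nu$ is not represented by a function in $L^p(\mathbb{R}^N,\mathbb{R}^{N\times N})$ ($1\le p<\infty$). $\mathrm{BV}^2(\mathbb{R}^N)$ is the space of functions $u\in W^{1,1}(\mathbb{R}^N)$ such that $\nabla u\in\mathrm{BV}(\mathbb{R}^N,\mathbb{R}^N)$. $|\cdot|$ denotes the Frobenius norm on matrices. *)

theory Defs
  imports "HOL-Analysis.Analysis"
begin

subsection \<open>Test functions\<close>

definition partial_deriv :: "'n \<Rightarrow> (real^'n::finite \<Rightarrow> real) \<Rightarrow> real^'n \<Rightarrow> real" where
  "partial_deriv i f x = frechet_derivative f (at x) (axis i 1)"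

primrec C_k :: "nat \<Rightarrow> (real^'n::finite \<Rightarrow> real) \<Rightarrow> bool" where
  "C_k 0 f \<longleftrightarrow> continuous_on UNIV f"
| "C_k (Suc k) f \<longleftrightarrow> (\<forall>x. f differentiable (at x)) \<and> (\<forall>i. C_k k (partial_deriv i f))"

definition compactly_supported :: "(real^'n::finite \<Rightarrow> real) \<Rightarrow> bool" where
  "compactly_supported f \<longleftrightarrow> compact (closure {x. f x \<noteq> 0})"

definition Cc_k :: "nat \<Rightarrow> (real^'n::finite \<Rightarrow> real) set" where
  "Cc_k k = {f. C_k k f \<and> compactly_supported f}"

definition Cc_inf :: "(real^'n::finite \<Rightarrow> real) set" where
  "Cc_inf = {f. (\<forall>k. C_k k f) \<and> compactly_supported f}"

text \<open>A multi-index is encoded as a list of directions; the order of the list is immaterial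
  for smooth functions, and the order of the multi-index is the length of the list.\<close>

definition multi_deriv :: "'n list \<Rightarrow> (real^'n::finite \<Rightarrow> real) \<Rightarrow> real^'n \<Rightarrow> real" where
  "multi_deriv \<alpha> f = foldr partial_deriv \<alpha> f"


subsection \<open>Function spaces\<close>

text \<open>Functions are Lebesgue measurable and are not identified when equal almost everywhere;
  all the predicates below are invariant under such a change.  The exponent \<open>p\<close> is meant to
  satisfy \<open>1 \<le> p\<close>.  On matrices, the library norm of \<open>real^'n^'m\<close> is the Frobenius norm.\<close>

definition Lp :: "real \<Rightarrow> (real^'n::finite \<Rightarrow> 'b::euclidean_space) set" where
  "Lp p = {f. f \<in> borel_measurable lebesgue \<and> integrable lebesgue (\<lambda>x. norm (f x) powr p)}"

definition weak_deriv :: "'n list \<Rightarrow> (real^'n::finite \<Rightarrow> real) \<Rightarrow> (real^'n \<Rightarrow> real) \<Rightarrow> bool" where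
  "weak_deriv \<alpha> u v \<longleftrightarrow>
     (\<forall>\<phi>\<in>Cc_inf. (LINT x|lebesgue. u x * multi_deriv \<alpha> \<phi> x)
        = (-1) ^ length \<alpha> * (LINT x|lebesgue. v x * \<phi> x))"

definition Sobolev :: "nat \<Rightarrow> real \<Rightarrow> (real^'n::finite \<Rightarrow> real) set" where
  "Sobolev k p = {u \<in> Lp p. \<forall>\<alpha>. length \<alpha> \<le> k \<longrightarrow> (\<exists>v \<in> Lp p. weak_deriv \<alpha> u v)}"

text \<open>The variation of a vector field \<open>v\<close> is the supremum of
  \<open>\<Sum>i. \<integral> v\<^sub>i div \<Phi>\<^sub>i\<close> over the matrix fields \<open>\<Phi>\<close> of class \<open>C\<^sub>c\<^sup>1\<close> with rows \<open>\<Phi>\<^sub>i\<close> and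
  Frobenius norm at most 1 everywhere.\<close>

definition variation :: "(real^'n::finite \<Rightarrow> real^'m::finite) \<Rightarrow> ereal" where
  "variation v =
     (SUP \<Phi> \<in> {\<Phi> :: real^'n \<Rightarrow> real^'n^'m.
                  (\<forall>i j. (\<lambda>x. \<Phi> x $ i $ j) \<in> Cc_k 1) \<and> (\<forall>x. norm (\<Phi> x) \<le> 1)}.
        ereal (\<Sum>i\<in>UNIV. LINT x|lebesgue.
          v x $ i * (\<Sum>j\<in>UNIV. partial_deriv j (\<lambda>y. \<Phi> y $ i $ j) x)))"

definition BV :: "(real^'n::finite \<Rightarrow> real^'m::finite) set" where
  "BV = {v \<in> Lp 1. variation v < \<infinity>}"

definition weak_gradient :: "(real^'n::finite \<Rightarrow> real) \<Rightarrow> (real^'n \<Rightarrow> real^'n) \<Rightarrow> bool" where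
  "weak_gradient u g \<longleftrightarrow> (\<forall>i. weak_deriv [i] u (\<lambda>x. g x $ i))"

definition BV2 :: "(real^'n::finite \<Rightarrow> real) set" where
  "BV2 = {u \<in> Sobolev 1 1. \<exists>g. weak_gradient u g \<and> g \<in> BV}"


subsection \<open>The non-local Hessian\<close>

definition outer :: "real^'n::finite \<Rightarrow> real^'n^'n" where
  "outer h = (\<chi> i j. h $ i * h $ j)"

text \<open>The integrand is \<open>0\<close> at \<open>h = 0\<close> (division by zero), which is a null set.\<close>

definition nonlocal_hessian ::
    "(real^'n::finite \<Rightarrow> real) \<Rightarrow> (real^'n \<Rightarrow> real) \<Rightarrow> real^'n \<Rightarrow> real^'n^'n" where
  "nonlocal_hessian \<rho> \<phi> x =
     (real CARD('n) * (real CARD('n) + 2) / 2) *\<^sub>R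
     (LINT h|lebesgue.
        ((\<phi> (x + h) - 2 * \<phi> x + \<phi> (x - h)) / (norm h)\<^sup>2 * \<rho> h) *\<^sub>R
        ((1 / (norm h)\<^sup>2) *\<^sub>R (outer h - ((norm h)\<^sup>2 / (real CARD('n) + 2)) *\<^sub>R mat 1)))"

definition dist_nonlocal_hessian ::
    "(real^'n::finite \<Rightarrow> real) \<Rightarrow> (real^'n \<Rightarrow> real) \<Rightarrow> 'n \<Rightarrow> 'n \<Rightarrow> (real^'n \<Rightarrow> real) \<Rightarrow> real" where
  "dist_nonlocal_hessian \<rho> u i j \<phi> =
     (LINT x|lebesgue. u x * nonlocal_hessian \<rho> \<phi> x $ i $ j)"

definition represents_dnh ::
    "(real^'n::finite \<Rightarrow> real) \<Rightarrow> (real^'n \<Rightarrow> real) \<Rightarrow> (real^'n \<Rightarrow> real^'n^'n) \<Rightarrow> bool" where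
  "represents_dnh \<rho> u V \<longleftrightarrow>
     (\<forall>i j. \<forall>\<phi>\<in>Cc_inf.
        dist_nonlocal_hessian \<rho> u i j \<phi> = (LINT x|lebesgue. V x $ i $ j * \<phi> x))"

text \<open>The \<open>p\<close>-th power integral of the distributional non-local Hessian.  A representative
  in \<open>L\<^sup>p\<close> is unique up to null sets, so the value does not depend on the one chosen.\<close>

definition dnh_integral ::
    "real \<Rightarrow> (real^'n::finite \<Rightarrow> real) \<Rightarrow> (real^'n \<Rightarrow> real) \<Rightarrow> ennreal" where
  "dnh_integral p \<rho> u =
     (if \<exists>V \<in> Lp p. represents_dnh \<rho> u V
      then (\<integral>\<^sup>+x. ennreal (norm ((SOME V. V \<in> Lp p \<and> represents_dnh \<rho> u V) x) powr p) \<partial>lebesgue)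
      else \<infinity>)"

end

theory Submission
  imports Defs "HOL-Real_Asymp.Real_Asymp"
begin

text \<open>
  Write \<open>\<Delta>\<^sub>h u (x) = u (x + h) - 2 u (x) + u (x - h)\<close>.  Both membership in the function space and
  finiteness of the lower limit are equivalent to a third condition, in which neither derivatives nor
  densities occur: the second difference quotients \<open>\<Delta>\<^sub>h u / \<bar>h\<bar>\<^sup>2\<close> are bounded in \<open>L\<^sup>p\<close>,
  uniformly in \<open>h\<close> (\<open>quadratic_diff_bounded\<close>).  Four facts yield the equivalences.

  First, suppose that the distributional second derivatives of \<open>u\<close>, as functionals on
  test functions, are bounded with respect to the norm of the dual space of \<open>L\<^sup>p\<close>.  Then the third condition holds
  (\<open>dual_bounded_hessian_imp_quadratic\<close>).  The second difference with step \<open>h\<close> is a sum of four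
  second differences with step \<open>h / 2\<close>, so by iterated halving its pairing with a test function is at
  most \<open>4 ^ m\<close> times the pairing of a single one with step \<open>h / 2 ^ m\<close> at a
  translated position.  For large \<open>m\<close> the latter is as good as a second derivative, and the hypothesis
  is invariant under translations.  The hypothesis holds for functions in the Sobolev space, and for those of
  \<open>BV\<^sup>2\<close> with \<open>p = 1\<close>.

  Second, the third condition implies membership in the space (\<open>Sobolev_iff_quadratic\<close>,
  \<open>BV2_iff_quadratic\<close>).  Consecutive dyadic difference quotients of \<open>u\<close> differ
  by a second difference, hence converge geometrically in \<open>L\<^sup>p\<close> to the first derivative.  The mixed
  second difference quotients are bounded by polarization; for \<open>p > 1\<close> they have a weak limit, and for
  \<open>p = 1\<close> the bound itself limits the variation of the gradient.

  Third, by Fubini's theorem the distributional non-local Hessian applied to \<open>\<phi>\<close> is an average over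
  \<open>h\<close>, with weight \<open>\<rho>\<^sub>n\<close> times a bounded kernel, of the pairings of \<open>u\<close> with
  \<open>\<Delta>\<^sub>h \<phi> / \<bar>h\<bar>\<^sup>2\<close> (\<open>dist_nonlocal_hessian_eq\<close>).  As \<open>\<rho>\<^sub>n\<close> concentrates
  at 0, only the quadratic form of the second derivatives of \<open>\<phi>\<close> matters, and the fourth
  moments of a radial density are such that the kernel extracts the entry of the Hessian exactly
  (\<open>quadratic_form_kernel\<close>).  The non-local Hessians therefore converge as functionals to the
  distributional one (\<open>dist_nonlocal_hessian_tendsto\<close>), and a finite lower limit gives the
  hypothesis of the first fact.

  Fourth, in the same average the difference may be moved onto \<open>u\<close>.  Under the third condition the
  non-local Hessian is then given by a function, bounded in \<open>L\<^sup>p\<close> independently of \<open>n\<close>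
  (\<open>quadratic_imp_dnh_integral_bounded\<close>).

  Duality is used only in the form of Young's inequality \<open>a b \<le> a\<^sup>p + b\<^sup>q\<close> and its elementary
  converse (\<open>dual_bounded_imp_nn_integral\<close>), which treats \<open>p = 1\<close> along with \<open>p > 1\<close>.
\<close>

section \<open>Smooth bump functions and density of test functions\<close>

lemma partial_deriv_eqI:
  "(f has_derivative D) (at x) \<Longrightarrow> partial_deriv i f x = D (axis i 1)"
  unfolding partial_deriv_def by (simp add: frechet_derivative_at[symmetric])

lemma C_k_differentiable: "C_k (Suc k) f \<Longrightarrow> f differentiable (at x)"
  by simp

lemma C_k_continuous: "C_k k f \<Longrightarrow> continuous_on UNIV f"
  by (cases k) (auto simp: differentiable_on_def intro!: differentiable_imp_continuous_on)

lemma C_k_Suc_D: "C_k (Suc k) f \<Longrightarrow> C_k k f"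
proof (induction k arbitrary: f)
  case 0
  then show ?case using C_k_continuous[of "Suc 0" f] by auto
next
  case (Suc k)
  from Suc.prems have "(\<forall>x. f differentiable (at x)) \<and> (\<forall>i. C_k (Suc k) (partial_deriv i f))"
    by (rule C_k.simps(2)[THEN iffD1])
  then show ?case using Suc.IH by (intro C_k.simps(2)[THEN iffD2]) blast
qed

lemma C_k_mono: "C_k k f \<Longrightarrow> j \<le> k \<Longrightarrow> C_k j f"
proof (induction k)
  case (Suc k) then show ?case using C_k_Suc_D le_Suc_eq by metis
qed simp

text \<open>Smoothness is only available order by order, by recursion on the order.  A class of
differentiable functions that contains the partial derivatives of its members gives all the orders
at once, without ever computing a higher derivative.\<close>

lemma C_k_coinduct:
  assumes "f \<in> S" and "\<And>g x. g \<in> S \<Longrightarrow> g differentiable (at x)"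
    and "\<And>g i. g \<in> S \<Longrightarrow> partial_deriv i g \<in> S"
  shows "C_k k f"
  using assms(1)
proof (induction k arbitrary: f)
  case 0
  then show ?case using assms(2)
    by (auto simp: differentiable_on_def intro!: differentiable_imp_continuous_on)
next
  case (Suc k) then show ?case using assms by auto
qed

text \<open>The smooth function \<open>exp (-1/t)\<close>, extended by zero, together with its quotients by
powers of \<open>t\<close>.  Keeping the exponent as a parameter makes the family closed under
differentiation, up to linear combinations.\<close>

definition flat :: "nat \<Rightarrow> real \<Rightarrow> real" where
  "flat m t = (if t > 0 then exp (- 1 / t) / t ^ m else 0)"

text \<open>The exponential beats every power, in the quantitative form \<open>(1 + x/n) ^ n \<le> exp x\<close> with
\<open>x = 1/t\<close> and \<open>n = m + 2\<close>.  A quadratic bound at the origin is what makes the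
derivative there vanish.\<close>

lemma flat_le_square: "\<bar>flat m t\<bar> \<le> real (m + 2) ^ (m + 2) * t\<^sup>2"
proof (cases "t > 0")
  case True
  let ?n = "m + 2"
  have "(1 + (1/t) / real ?n) ^ ?n \<le> exp (1/t)"
    by (rule exp_ge_one_plus_x_over_n_power_n) (use True in \<open>auto intro: order_trans[of _ 0]\<close>)
  moreover have "((1/t) / real ?n) ^ ?n \<le> (1 + (1/t) / real ?n) ^ ?n"
    by (rule power_mono) (use True in auto)
  ultimately have "((1/t) / real ?n) ^ ?n \<le> exp (1/t)" by linarith
  then have "1 \<le> exp (1/t) * (t * real ?n) ^ ?n"
    using True by (simp add: power_divide power_mult_distrib divide_simps)
  then have "exp (- (1/t)) \<le> (t * real ?n) ^ ?n"
    by (simp add: exp_minus field_simps)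
  then have "exp (- (1/t)) \<le> real ?n ^ ?n * t\<^sup>2 * t ^ m"
    by (simp only: power_mult_distrib power_add of_nat_power mult_ac)
  then have "exp (- (1/t)) / t ^ m \<le> real ?n ^ ?n * t\<^sup>2"
    using True by (simp add: pos_divide_le_eq)
  then show ?thesis using True by (simp add: flat_def)
next
  case False then show ?thesis by (simp add: flat_def)
qed

lemma DERIV_flat:
  "(flat m has_real_derivative (flat (m + 2) t - real m * flat (m + 1) t)) (at t)"
proof (cases "t = 0")
  case True
  let ?c = "real (m + 2) ^ (m + 2)"
  have "((\<lambda>h. (flat m (0 + h) - flat m 0) / h) \<longlongrightarrow> 0) (at 0)"
  proof (rule Lim_null_comparison)
    show "\<forall>\<^sub>F h in at 0. norm ((flat m (0 + h) - flat m 0) / h) \<le> ?c * \<bar>h\<bar>"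
    proof (rule eventually_at_ball'[of 1, THEN eventually_mono])
      fix h :: real assume "h \<in> ball 0 1 \<and> h \<noteq> 0 \<and> h \<in> UNIV"
      then have "h \<noteq> 0" by simp
      moreover have "\<bar>flat m h\<bar> \<le> ?c * \<bar>h\<bar> * \<bar>h\<bar>"
        using flat_le_square[of m h] by (simp add: power2_eq_square abs_mult)
      ultimately show "norm ((flat m (0 + h) - flat m 0) / h) \<le> ?c * \<bar>h\<bar>"
        by (simp add: flat_def[of m 0] pos_divide_le_eq)
    qed simp
    show "((\<lambda>h. ?c * \<bar>h\<bar>) \<longlongrightarrow> 0) (at 0)"
      by (auto intro!: tendsto_eq_intros)
  qed
  then show ?thesis using True by (simp add: DERIV_def flat_def[of _ 0])
next
  case False
  show ?thesis
  proof (cases "t > 0")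
    case True
    have 1: "((\<lambda>t. exp (- 1 / t) / t ^ m) has_real_derivative
        (flat (m + 2) t - real m * flat (m + 1) t)) (at t)"
    proof -
      have e: "((\<lambda>t. exp (- 1 / t)) has_real_derivative exp (- 1 / t) / t\<^sup>2) (at t)"
        using True by (auto intro!: derivative_eq_intros simp: power2_eq_square)
      have p: "((\<lambda>t. t ^ m) has_real_derivative real m * t ^ (m - 1)) (at t)"
        by (rule DERIV_pow[THEN DERIV_cong]) simp
      have "((\<lambda>t. exp (- 1 / t) / t ^ m) has_real_derivative
          (exp (- 1 / t) / t\<^sup>2 * t ^ m - exp (- 1 / t) * (real m * t ^ (m - 1))) / (t ^ m * t ^ m)) (at t)"
        using True by (intro DERIV_divide e p) simp
      moreover have "(y / t\<^sup>2 * t ^ m - y * (real m * t ^ (m - 1))) / (t ^ m * t ^ m)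
          = y / t ^ (m + 2) - real m * (y / t ^ (m + 1))" for y
      proof -
        have "y / t\<^sup>2 * t ^ m / (t ^ m * t ^ m) = y / t ^ (m + 2)"
          using True by (simp add: power_add power2_eq_square)
        moreover have "y * (real m * t ^ (m - 1)) / (t ^ m * t ^ m) = real m * (y / t ^ (m + 1))"
          using True by (cases m) (simp_all)
        ultimately show ?thesis by (simp only: diff_divide_distrib)
      qed
      ultimately show ?thesis using True by (simp add: flat_def)
    qed
    show ?thesis
      by (rule DERIV_cong_ev[THEN iffD1, OF refl _ refl 1])
         (use True in \<open>auto simp: flat_def intro!: eventually_mono[OF eventually_nhds_in_open[of "{0<..}"]]\<close>)
  next
    case nF: False
    then have t: "t < 0" using False by simp
    have 1: "((\<lambda>t. 0) has_real_derivative (flat (m + 2) t - real m * flat (m + 1) t)) (at t)"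
      using t by (simp add: flat_def)
    show ?thesis
      by (rule DERIV_cong_ev[THEN iffD1, OF refl _ refl 1])
         (use t in \<open>auto simp: flat_def intro!: eventually_mono[OF eventually_nhds_in_open[of "{..<0}"]]\<close>)
  qed
qed

text \<open>The smallest algebra that contains the affine functions and the functions \<open>flat m\<close> of
affine functions.  It is closed under partial derivatives, hence consists of smooth functions, and it
contains both the polynomials and the cut-off functions that are needed below.\<close>

inductive_set bump_algebra :: "(real^'n::finite \<Rightarrow> real) set" where
  linear: "bounded_linear l \<Longrightarrow> l \<in> bump_algebra"
| const: "(\<lambda>x. c) \<in> bump_algebra"
| flat: "bounded_linear l \<Longrightarrow> (\<lambda>x. flat m (c + l x)) \<in> bump_algebra"
| add: "f \<in> bump_algebra \<Longrightarrow> g \<in> bump_algebra \<Longrightarrow> (\<lambda>x. f x + g x) \<in> bump_algebra"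
| mult: "f \<in> bump_algebra \<Longrightarrow> g \<in> bump_algebra \<Longrightarrow> (\<lambda>x. f x * g x) \<in> bump_algebra"

lemma bump_algebra_deriv:
  fixes f :: "real^'n::finite \<Rightarrow> real"
  assumes "f \<in> bump_algebra"
  shows "(\<forall>x. f differentiable (at x)) \<and> (\<forall>i. partial_deriv i f \<in> bump_algebra)"
  using assms
proof induction
  case (linear l)
  have D: "(l has_derivative l) (at x)" for x by (rule bounded_linear_imp_has_derivative[OF linear])
  then have "l differentiable (at x)" "partial_deriv i l = (\<lambda>x. l (axis i 1))" for i x
    using differentiableI partial_deriv_eqI[OF D] by (auto simp: fun_eq_iff)
  then show ?case by (auto intro: bump_algebra.const)
next
  case (const c)
  have D: "((\<lambda>x. c) has_derivative (\<lambda>_. 0)) (at x)" for x :: "real^'n" by simp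
  have "partial_deriv i (\<lambda>x::real^'n. c) = (\<lambda>x. 0)" for i
    using partial_deriv_eqI[OF D] by (auto simp: fun_eq_iff)
  then show ?case by (auto intro: bump_algebra.const)
next
  case (flat l m c)
  have D: "((\<lambda>x. flat m (c + l x)) has_derivative
        (\<lambda>v. (flat (m+2) (c + l x) - real m * flat (m+1) (c + l x)) * l v)) (at x)" for x
  proof -
    have "((\<lambda>x. c + l x) has_derivative l) (at x)"
      using bounded_linear_imp_has_derivative[OF flat] by (auto intro!: derivative_eq_intros)
    moreover have "(flat m has_derivative (\<lambda>s. s * (flat (m+2) (c + l x) - real m * flat (m+1) (c + l x)))) (at (c + l x))"
      using DERIV_flat[of m "c + l x"] by (simp add: has_field_derivative_def mult.commute[of _ "_ - _"])
    ultimately show ?thesis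
      using has_derivative_compose by (fastforce simp: mult.commute)
  qed
  have "partial_deriv i (\<lambda>x. flat m (c + l x)) =
      (\<lambda>x. (flat (m+2) (c + l x) + (- real m) * flat (m+1) (c + l x)) * l (axis i 1))" for i
    using partial_deriv_eqI[OF D] by (auto simp: fun_eq_iff)
  moreover have "(\<lambda>x. (flat (m+2) (c + l x) + (- real m) * flat (m+1) (c + l x)) * l (axis i 1)) \<in> bump_algebra" for i
    by (rule bump_algebra.mult bump_algebra.add bump_algebra.const bump_algebra.flat flat)+
  ultimately show ?case using D unfolding differentiable_def by metis
next
  case (add f g)
  have "((\<lambda>x. f x + g x) has_derivative
     (\<lambda>v. frechet_derivative f (at x) v + frechet_derivative g (at x) v)) (at x)" for x
    using add frechet_derivative_works by (intro has_derivative_add) blast+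
  note D = this
  have "partial_deriv i (\<lambda>x. f x + g x) = (\<lambda>x. partial_deriv i f x + partial_deriv i g x)" for i
    using partial_deriv_eqI[OF D] by (auto simp: fun_eq_iff partial_deriv_def)
  then show ?case using D add by (auto intro: bump_algebra.add simp: differentiable_def)
next
  case (mult f g)
  have "((\<lambda>x. f x * g x) has_derivative
     (\<lambda>v. f x * frechet_derivative g (at x) v + frechet_derivative f (at x) v * g x)) (at x)" for x
    using mult frechet_derivative_works by (intro has_derivative_mult) blast+
  note D = this
  have "partial_deriv i (\<lambda>x. f x * g x) = (\<lambda>x. f x * partial_deriv i g x + partial_deriv i f x * g x)" for i
    using partial_deriv_eqI[OF D] by (auto simp: fun_eq_iff partial_deriv_def)
  then show ?case using D mult by (auto intro!: bump_algebra.add bump_algebra.mult simp: differentiable_def)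
qed

lemma bump_algebra_smooth: "f \<in> bump_algebra \<Longrightarrow> C_k k f"
  using C_k_coinduct[of f bump_algebra] bump_algebra_deriv by blast

lemma bump_algebra_prod:
  "finite I \<Longrightarrow> (\<And>i. i \<in> I \<Longrightarrow> f i \<in> bump_algebra) \<Longrightarrow> (\<lambda>x. \<Prod>i\<in>I. f i x) \<in> bump_algebra"
  by (induction I rule: finite_induct) (auto intro: bump_algebra.intros)

lemma bump_algebra_polynomial: "real_polynomial_function f \<Longrightarrow> f \<in> bump_algebra"
  by (induction rule: real_polynomial_function.induct) (auto intro: bump_algebra.intros)

text \<open>A smooth cut-off for the cube of half side \<open>r\<close>. The arguments are scaled as \<open>r (r
- x\<^sub>i)\<close> and \<open>r (r + x\<^sub>i)\<close>: one of them is negative as soon as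
\<open>x\<close> leaves the cube, and at a fixed \<open>x\<close> they tend to infinity with
\<open>r\<close>, so that the cut-off tends to 1 without any normalization.\<close>

definition bump :: "real \<Rightarrow> real^'n::finite \<Rightarrow> real" where
  "bump r x = (\<Prod>i\<in>UNIV. flat 0 (r * r + (- r) * (x $ i)) * flat 0 (r * r + r * (x $ i)))"

lemma bump_in_algebra: "bump r \<in> bump_algebra"
  unfolding bump_def[abs_def]
  by (intro bump_algebra_prod bump_algebra.mult bump_algebra.flat)
     (intro bounded_linear_const_mult bounded_linear_vec_nth | simp)+

lemma flat0_bounds: "0 \<le> flat 0 t" "flat 0 t \<le> 1"
  by (auto simp: flat_def)

lemma bump_bounds: "0 \<le> bump r x" "bump r x \<le> 1"
  unfolding bump_def
  by (auto intro!: prod_nonneg prod_le_1 mult_nonneg_nonneg mult_le_one flat0_bounds)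

lemma bump_outside:
  assumes "r > 0" "x \<notin> cbox (\<chi> i. - r) (\<chi> i. r)"
  shows "bump r x = 0"
proof -
  obtain i where "x $ i < - r \<or> r < x $ i"
    using assms(2) by (auto simp: mem_box_cart not_le)
  then have "flat 0 (r * r + (- r) * (x $ i)) * flat 0 (r * r + r * (x $ i)) = 0"
  proof
    assume "x $ i < - r"
    then have "r * r + r * x $ i \<le> 0" using assms(1) mult_left_mono[of "x $ i" "-r" r] by simp
    then show ?thesis by (simp add: flat_def)
  next
    assume "r < x $ i"
    then have "r * r + (- r) * x $ i \<le> 0" using assms(1) by simp
    then show ?thesis by (simp add: flat_def)
  qed
  then show ?thesis unfolding bump_def by (auto intro: prod_zero)
qed

lemma bump_tendsto_1: "(\<lambda>n. bump (real (Suc n)) x) \<longlonglongrightarrow> 1"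
proof -
  have flat1: "(flat 0 \<longlongrightarrow> 1) at_top"
  proof -
    have "((\<lambda>t::real. exp (- 1 / t)) \<longlongrightarrow> 1) at_top"
      by real_asymp
    then show ?thesis
      by (rule tendsto_cong[THEN iffD1, rotated])
         (auto simp: flat_def intro!: eventually_mono[OF eventually_gt_at_top[of 0]])
  qed
  have a: "filterlim (\<lambda>n. real (Suc n) * real (Suc n) + c * real (Suc n)) at_top sequentially" for c
    by real_asymp
  have "(\<lambda>n. \<Prod>i\<in>UNIV. flat 0 (real (Suc n) * real (Suc n) + (- real (Suc n)) * (x $ i)) *
      flat 0 (real (Suc n) * real (Suc n) + real (Suc n) * (x $ i))) \<longlonglongrightarrow> (\<Prod>i\<in>(UNIV::'a set). 1 * 1)"
    by (intro tendsto_prod tendsto_mult filterlim_compose[OF flat1])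
       (use a[of "x $ _"] a[of "- (x $ _)"] in \<open>auto simp: algebra_simps\<close>)
  then show ?thesis unfolding bump_def[abs_def] by simp
qed

lemma compactly_supportedI:
  fixes f :: "real^'n::finite \<Rightarrow> real"
  assumes "compact K" "\<And>x. x \<notin> K \<Longrightarrow> f x = 0"
  shows "compactly_supported f"
proof -
  have "{x. f x \<noteq> 0} \<subseteq> K" using assms(2) by auto
  then show ?thesis unfolding compactly_supported_def
    using assms(1) by (meson bounded_subset compact_closure compact_imp_bounded)
qed

lemma compactly_supportedE:
  fixes f :: "real^'n::finite \<Rightarrow> real"
  assumes "compactly_supported f"
  obtains R where "R > 0" "\<And>x. norm x > R \<Longrightarrow> f x = 0"
proof -
  have "bounded {x. f x \<noteq> 0}"
    using assms unfolding compactly_supported_def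
    by (meson bounded_subset closure_subset compact_imp_bounded)
  then obtain R where "R > 0" "\<forall>x\<in>{x. f x \<noteq> 0}. norm x \<le> R" by (auto simp: bounded_pos)
  then show ?thesis using that[of R] by force
qed

lemma bump_mult_Cc_inf:
  assumes "r > 0" "f \<in> bump_algebra"
  shows "(\<lambda>x. f x * bump r x) \<in> Cc_inf"
  unfolding Cc_inf_def
  using bump_algebra_smooth[OF bump_algebra.mult[OF assms(2) bump_in_algebra[of r]]]
  by (auto intro!: compactly_supportedI[OF compact_cbox, of "\<chi> i. - r" "\<chi> i. r"]
      simp: bump_outside[OF assms(1)])

text \<open>A bounded measurable function is almost everywhere a limit of continuous functions, and on a cube
those are uniformly close to polynomials.  Multiplied by \<open>bump r\<close>, polynomials become test
functions.  This replaces mollification.  The pointwise bound by \<open>bump r\<close> is kept, since for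
\<open>p = 1\<close> test functions must not exceed 1.\<close>

lemma Cc_inf_dense_AE:
  fixes s :: "real^'n::finite \<Rightarrow> real"
  assumes s: "s \<in> borel_measurable lebesgue" and s1: "\<And>x. \<bar>s x\<bar> \<le> 1" and r: "r > 0"
  obtains \<phi> where "\<And>n::nat. \<phi> n \<in> Cc_inf" "\<And>n x. \<bar>\<phi> n x\<bar> \<le> bump r x"
    "AE x in lebesgue. (\<lambda>n. \<phi> n x) \<longlonglongrightarrow> s x * bump r x"
proof -
  have "s measurable_on UNIV"
    using lebesgue_measurable_imp_measurable_on_real[of s UNIV] s by simp
  then obtain N g where N: "negligible N" and g: "\<And>n. continuous_on UNIV (g n)"
    and lim: "\<And>x. x \<notin> N \<Longrightarrow> (\<lambda>n. g n x) \<longlonglongrightarrow> s x"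
    unfolding measurable_on_def by auto
  define K :: "(real^'n) set" where "K = cbox (\<chi> i. - r) (\<chi> i. r)"
  (* Truncation does not disturb the limit, as \<open>\<bar>s x\<bar> \<le> 1\<close>. *)
  define t where "t n x = max (-1) (min 1 (g n x))" for n x
  have "\<exists>P. real_polynomial_function P \<and> (\<forall>x\<in>K. \<bar>t n x - P x\<bar> < 1 / Suc n)" for n
  proof -
    have "continuous_on K (t n)" unfolding t_def
      by (intro continuous_intros continuous_on_subset[OF g]) auto
    then show ?thesis
      using Stone_Weierstrass_real_polynomial_function[of K "t n" "1 / Suc n"]
      by (metis K_def compact_cbox of_nat_0_less_iff zero_less_Suc zero_less_divide_1_iff)
  qed
  then obtain P where P: "\<And>n. real_polynomial_function (P n)"
      and Pt: "\<And>n x. x \<in> K \<Longrightarrow> \<bar>t n x - P n x\<bar> < 1 / Suc n"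
    by metis
  (* The polynomials exceed 1 by at most \<open>1 / (n + 1)\<close>; this factor brings them back below 1. *)
  define c where "c n = 1 / (1 + 1 / real (Suc n))" for n
  have c: "c n > 0" for n by (simp add: c_def add_pos_pos)
  define \<phi> where "\<phi> n x = (c n * P n x) * bump r x" for n x
  show ?thesis
  proof
    show "\<phi> n \<in> Cc_inf" for n
      unfolding \<phi>_def[abs_def]
      by (intro bump_mult_Cc_inf r bump_algebra.mult bump_algebra.const bump_algebra_polynomial P)
    show "\<bar>\<phi> n x\<bar> \<le> bump r x" for n x
    proof (cases "x \<in> K")
      case True
      have "\<bar>t n x\<bar> \<le> 1" by (auto simp: t_def)
      then have "\<bar>P n x\<bar> \<le> 1 + 1 / real (Suc n)" using Pt[OF True, of n] by linarith
      then have "c n * \<bar>P n x\<bar> \<le> c n * (1 + 1 / real (Suc n))"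
        using c[of n] by (intro mult_left_mono) auto
      also have "\<dots> = 1" by (simp add: c_def divide_simps)
      finally have "\<bar>c n * P n x\<bar> \<le> 1" using c[of n] by (simp add: abs_mult)
      then show ?thesis using bump_bounds[of r x] mult_right_mono[of "\<bar>c n * P n x\<bar>" 1 "bump r x"]
        by (simp add: \<phi>_def abs_mult)
    next
      case False
      then have "bump r x = 0" using bump_outside[OF r] by (simp add: K_def)
      then show ?thesis by (simp add: \<phi>_def)
    qed
    have "(\<lambda>n. \<phi> n x) \<longlonglongrightarrow> s x * bump r x" if "x \<notin> N" for x
    proof (cases "x \<in> K")
      case True
      have "(\<lambda>n. t n x) \<longlonglongrightarrow> max (-1) (min 1 (s x))"
        unfolding t_def by (intro tendsto_intros lim that)
      then have t: "(\<lambda>n. t n x) \<longlonglongrightarrow> s x" using s1[of x] by (auto simp: max_def min_def abs_le_iff split: if_splits)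
      have "(\<lambda>n. t n x - P n x) \<longlonglongrightarrow> 0"
      proof (rule Lim_null_comparison)
        show "\<forall>\<^sub>F n in sequentially. norm (t n x - P n x) \<le> 1 / real (Suc n)"
          using Pt[OF True] by (auto intro!: always_eventually less_imp_le)
        show "(\<lambda>n. 1 / real (Suc n)) \<longlonglongrightarrow> 0" by real_asymp
      qed
      from tendsto_diff[OF t this] have Ps: "(\<lambda>n. P n x) \<longlonglongrightarrow> s x" by simp
      have "c \<longlonglongrightarrow> 1" unfolding c_def by real_asymp
      then have "(\<lambda>n. (c n * P n x) * bump r x) \<longlonglongrightarrow> (1 * s x) * bump r x"
        by (intro tendsto_intros Ps)
      then show ?thesis by (simp add: \<phi>_def)
    next
      case False
      then have "bump r x = 0" using bump_outside[OF r] by (simp add: K_def)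
      then show ?thesis by (simp add: \<phi>_def)
    qed
    moreover have "N \<in> null_sets lebesgue" using N by (simp add: negligible_iff_null_sets)
    ultimately show "AE x in lebesgue. (\<lambda>n. \<phi> n x) \<longlonglongrightarrow> s x * bump r x"
      by (intro AE_I'[of N]) auto
  qed
qed

section \<open>Elementary properties of test functions\<close>

lemma Cc_inf_Cc_k: "\<phi> \<in> Cc_inf \<Longrightarrow> \<phi> \<in> Cc_k k"
  by (simp add: Cc_inf_def Cc_k_def)

lemma Cc_k_continuous: "\<phi> \<in> Cc_k k \<Longrightarrow> continuous_on A \<phi>"
  using C_k_continuous[of k \<phi>] continuous_on_subset[of UNIV \<phi> A] by (simp add: Cc_k_def)

lemma Cc_k_support:
  assumes "\<phi> \<in> Cc_k k"
  obtains R where "R > 0" "\<And>x. norm x > R \<Longrightarrow> \<phi> x = 0"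
  using assms compactly_supportedE unfolding Cc_k_def by blast

lemma Cc_k_bounded:
  assumes "\<phi> \<in> Cc_k k"
  obtains B where "B \<ge> 0" "\<And>x. \<bar>\<phi> x\<bar> \<le> B"
proof -
  obtain R where R: "R > 0" "\<And>x. norm x > R \<Longrightarrow> \<phi> x = 0" using Cc_k_support[OF assms] by metis
  have "compact (\<phi> ` cball 0 R)"
    by (intro compact_continuous_image Cc_k_continuous[OF assms] compact_cball)
  then obtain B where B: "\<forall>y\<in>\<phi> ` cball 0 R. norm y \<le> B" "B > 0"
    using compact_imp_bounded bounded_pos by metis
  have "\<bar>\<phi> x\<bar> \<le> B" for x
    using B R(2)[of x] by (cases "norm x > R") (auto simp: not_less)
  then show ?thesis using that[of B] B by force
qed

lemma partial_deriv_outside: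
  fixes f :: "real^'n::finite \<Rightarrow> real"
  assumes "\<And>x. norm x > R \<Longrightarrow> f x = 0" "norm x > R"
  shows "partial_deriv i f x = 0"
proof -
  have "((\<lambda>_. 0) has_derivative (\<lambda>_. 0)) (at x)" by simp
  then have "(f has_derivative (\<lambda>_. 0)) (at x)"
    by (rule has_derivative_transform_within_open[of _ _ _ _ "- cball 0 R"]) (use assms in auto)
  then show ?thesis using partial_deriv_eqI by blast
qed

lemma compactly_supported_partial_deriv:
  assumes "compactly_supported f"
  shows "compactly_supported (partial_deriv i f)"
proof -
  obtain R where R: "R > 0" "\<And>x. norm x > R \<Longrightarrow> f x = 0" using compactly_supportedE[OF assms] by metis
  have "partial_deriv i f x = 0" if x: "x \<notin> cball 0 R" for x
    by (rule partial_deriv_outside[of R f x i]) (use x R in auto)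
  then show ?thesis using compactly_supportedI[OF compact_cball] by blast
qed

lemma partial_deriv_Cc_k: "\<phi> \<in> Cc_k (Suc k) \<Longrightarrow> partial_deriv i \<phi> \<in> Cc_k k"
  using compactly_supported_partial_deriv by (auto simp: Cc_k_def)

lemma partial_deriv_Cc_inf: "\<phi> \<in> Cc_inf \<Longrightarrow> partial_deriv i \<phi> \<in> Cc_inf"
proof -
  assume a: "\<phi> \<in> Cc_inf"
  then have "C_k (Suc k) \<phi>" for k by (auto simp only: Cc_inf_def)
  then have "C_k k (partial_deriv i \<phi>)" for k by simp
  then show ?thesis using a compactly_supported_partial_deriv by (auto simp: Cc_inf_def)
qed

lemma partial_deriv_scale_shift:
  fixes f :: "real^'n::finite \<Rightarrow> real"
  assumes "\<And>y. f differentiable (at y)"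
  shows "((\<lambda>x. c * f (x + a)) has_derivative (\<lambda>v. c * frechet_derivative f (at (x + a)) v)) (at x)"
    "partial_deriv i (\<lambda>x. c * f (x + a)) = (\<lambda>x. c * partial_deriv i f (x + a))"
proof -
  have "((\<lambda>x. c * f (x + a)) has_derivative (\<lambda>v. c * frechet_derivative f (at (x + a)) v)) (at x)" for x
  proof -
    have "((\<lambda>x. x + a) has_derivative (\<lambda>v. v)) (at x)"
      by (auto intro!: derivative_eq_intros)
    moreover have "(f has_derivative frechet_derivative f (at (x + a))) (at (x + a))"
      using assms frechet_derivative_works by blast
    ultimately have "((\<lambda>x. f (x + a)) has_derivative (\<lambda>v. frechet_derivative f (at (x + a)) v)) (at x)"
      using has_derivative_compose by fastforce
    then show ?thesis by (intro derivative_eq_intros) auto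
  qed
  note D = this
  show "((\<lambda>x. c * f (x + a)) has_derivative (\<lambda>v. c * frechet_derivative f (at (x + a)) v)) (at x)"
    by (rule D)
  show "partial_deriv i (\<lambda>x. c * f (x + a)) = (\<lambda>x. c * partial_deriv i f (x + a))"
    using partial_deriv_eqI[OF D] by (auto simp: fun_eq_iff partial_deriv_def)
qed

lemma C_k_scale_shift:
  fixes f :: "real^'n::finite \<Rightarrow> real"
  shows "C_k k f \<Longrightarrow> C_k k (\<lambda>x. c * f (x + a))"
proof (induction k arbitrary: f)
  case 0
  then show ?case by (auto intro!: continuous_intros continuous_on_compose2[of UNIV f])
next
  case (Suc k)
  then have "\<And>y. f differentiable (at y)" by simp
  then show ?case using Suc partial_deriv_scale_shift[of f] unfolding C_k.simps differentiable_def
    by metis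
qed

lemma Cc_inf_scale_shift:
  fixes \<phi> :: "real^'n::finite \<Rightarrow> real"
  assumes "\<phi> \<in> Cc_inf"
  shows "(\<lambda>x. c * \<phi> (x + a)) \<in> Cc_inf"
proof -
  obtain R where R: "R > 0" "\<And>x. norm x > R \<Longrightarrow> \<phi> x = 0"
    using Cc_k_support[OF Cc_inf_Cc_k[OF assms, of 0]] by metis
  have "c * \<phi> (x + a) = 0" if "x \<notin> cball (- a) R" for x
    using R(2)[of "x + a"] that by (auto simp: dist_norm norm_minus_commute add.commute)
  then have "compactly_supported (\<lambda>x. c * \<phi> (x + a))"
    by (intro compactly_supportedI[OF compact_cball[of "- a" R]])
  then show ?thesis using assms by (simp add: Cc_inf_def C_k_scale_shift)
qed

lemma Cc_inf_shift: "\<phi> \<in> Cc_inf \<Longrightarrow> (\<lambda>x. \<phi> (x + a)) \<in> Cc_inf"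
  using Cc_inf_scale_shift[of \<phi> 1 a] by simp

lemma Cc_inf_scale: "\<phi> \<in> Cc_inf \<Longrightarrow> (\<lambda>x. c * \<phi> x) \<in> Cc_inf"
  using Cc_inf_scale_shift[of \<phi> c 0] by simp

lemma partial_deriv_scale:
  "\<phi> \<in> Cc_inf \<Longrightarrow> partial_deriv i (\<lambda>x. c * \<phi> x) = (\<lambda>x. c * partial_deriv i \<phi> x)"
  using partial_deriv_scale_shift(2)[of \<phi> i c 0] C_k_differentiable[of 0 \<phi>] by (simp add: Cc_inf_def)

lemma partial_deriv_shift:
  "\<phi> \<in> Cc_inf \<Longrightarrow> partial_deriv i (\<lambda>x. \<phi> (x + a)) = (\<lambda>x. partial_deriv i \<phi> (x + a))"
  using partial_deriv_scale_shift(2)[of \<phi> i 1 a] C_k_differentiable[of 0 \<phi>] by (simp add: Cc_inf_def)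

lemma Cc_k_uniformly_continuous:
  assumes "\<phi> \<in> Cc_k k" "e > 0"
  obtains d where "d > 0" "\<And>x y. norm (x - y) \<le> d \<Longrightarrow> \<bar>\<phi> x - \<phi> y\<bar> \<le> e"
proof -
  obtain R where R: "R > 0" "\<And>x. norm x > R \<Longrightarrow> \<phi> x = 0" using Cc_k_support[OF assms(1)] by metis
  have "uniformly_continuous_on (cball 0 (R + 1)) \<phi>"
    by (intro compact_uniformly_continuous Cc_k_continuous[OF assms(1)] compact_cball)
  then obtain d where d: "d > 0" and ud: "\<And>x y. x \<in> cball 0 (R+1) \<Longrightarrow> y \<in> cball 0 (R+1) \<Longrightarrow>
      dist x y < d \<Longrightarrow> dist (\<phi> x) (\<phi> y) < e"
    unfolding uniformly_continuous_on_def using \<open>e > 0\<close> by metis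
  define d' where "d' = min 1 (d / 2)"
  have "\<bar>\<phi> x - \<phi> y\<bar> \<le> e" if xy: "norm (x - y) \<le> d'" for x y
  proof (cases "norm x \<le> R + 1 \<and> norm y \<le> R + 1")
    case True
    then show ?thesis using ud[of x y] xy d by (auto simp: d'_def dist_norm)
  next
    case False
    have "\<bar>norm x - norm y\<bar> \<le> 1" using xy norm_triangle_ineq3[of x y] by (simp add: d'_def)
    with False have "norm x > R" "norm y > R" by linarith+
    then show ?thesis using R(2) \<open>e > 0\<close> by simp
  qed
  moreover have "d' > 0" using d by (simp add: d'_def)
  ultimately show ?thesis using that by blast
qed

section \<open>Finite differences of twice differentiable functions\<close>

lemma C_1_has_derivative:
  assumes "C_k 1 f"
  shows "(f has_derivative (\<lambda>v. \<Sum>i\<in>UNIV. v $ i * partial_deriv i f x)) (at x)"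
proof -
  have D: "(f has_derivative frechet_derivative f (at x)) (at x)"
    using assms frechet_derivative_works by auto
  then have l: "linear (frechet_derivative f (at x))" using has_derivative_linear by blast
  have "frechet_derivative f (at x) v = (\<Sum>i\<in>UNIV. v $ i * partial_deriv i f x)" for v
  proof -
    have "v = (\<Sum>i\<in>UNIV. v $ i *\<^sub>R axis i 1)"
      using basis_expansion[of v] by (simp add: scalar_mult_eq_scaleR)
    then have "frechet_derivative f (at x) v = frechet_derivative f (at x) (\<Sum>i\<in>UNIV. v $ i *\<^sub>R axis i 1)" by simp
    then show ?thesis by (simp add: linear_sum[OF l] linear_cmul[OF l] partial_deriv_def)
  qed
  then have "frechet_derivative f (at x) = (\<lambda>v. \<Sum>i\<in>UNIV. v $ i * partial_deriv i f x)" by auto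
  then show ?thesis using D by simp
qed

lemma C_1_DERIV_line:
  assumes "C_k 1 f"
  shows "((\<lambda>t. f (x + t *\<^sub>R h)) has_real_derivative
     (\<Sum>i\<in>UNIV. h $ i * partial_deriv i f (x + t *\<^sub>R h))) (at t)"
proof -
  have "((\<lambda>t. x + t *\<^sub>R h) has_derivative (\<lambda>s. s *\<^sub>R h)) (at t)"
    by (auto intro!: derivative_eq_intros)
  from has_derivative_compose[OF this C_1_has_derivative[OF assms]]
  moreover have "(\<lambda>s. \<Sum>i\<in>UNIV. (s *\<^sub>R h) $ i * partial_deriv i f (x + t *\<^sub>R h)) =
      (*) (\<Sum>i\<in>UNIV. h $ i * partial_deriv i f (x + t *\<^sub>R h))"
    by (auto simp: fun_eq_iff sum_distrib_left mult_ac)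
  ultimately show ?thesis
    by (simp add: has_field_derivative_def)
qed

definition second_diff :: "'a \<Rightarrow> ('a::real_normed_vector \<Rightarrow> real) \<Rightarrow> 'a \<Rightarrow> real" where
  "second_diff h u x = u (x + h) - 2 * u x + u (x - h)"

text \<open>The value at \<open>(h, h)\<close> of the Hessian of \<open>f\<close> at \<open>x\<close>.\<close>

definition hess_form :: "(real^'n::finite \<Rightarrow> real) \<Rightarrow> real^'n \<Rightarrow> real^'n \<Rightarrow> real" where
  "hess_form f h x = (\<Sum>k\<in>UNIV. \<Sum>l\<in>UNIV. h $ k * h $ l * partial_deriv k (partial_deriv l f) x)"

lemma hess_form_outside:
  fixes f :: "real^'n::finite \<Rightarrow> real"
  assumes "\<And>x. norm x > R \<Longrightarrow> f x = 0" "norm x > R"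
  shows "hess_form f h x = 0"
  unfolding hess_form_def by (simp add: partial_deriv_outside[of R] assms)

lemma quadratic_form_bound:
  fixes h :: "real^'n::finite"
  assumes "\<And>k l. \<bar>a k l\<bar> \<le> B"
  shows "\<bar>\<Sum>k\<in>UNIV. \<Sum>l\<in>UNIV. h $ k * h $ l * a k l\<bar> \<le> (real CARD('n))\<^sup>2 * (norm h)\<^sup>2 * B"
proof -
  have B: "B \<ge> 0" using assms[of undefined undefined] by linarith
  have "\<bar>\<Sum>k\<in>UNIV. \<Sum>l\<in>UNIV. h $ k * h $ l * a k l\<bar> \<le> (\<Sum>k\<in>(UNIV::'n set). \<Sum>l\<in>(UNIV::'n set). (norm h)\<^sup>2 * B)"
  proof (intro order_trans[OF sum_abs] sum_mono)
    fix k l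
    have "\<bar>h $ k\<bar> * \<bar>h $ l\<bar> * \<bar>a k l\<bar> \<le> norm h * norm h * B"
      using B assms component_le_norm_cart[of h] by (intro mult_mono) auto
    then show "\<bar>h $ k * h $ l * a k l\<bar> \<le> (norm h)\<^sup>2 * B" by (simp add: abs_mult power2_eq_square)
  qed
  then show ?thesis by (simp add: power2_eq_square mult.assoc)
qed

lemma member_le_double_sum:
  fixes a :: "'a::finite \<Rightarrow> 'b::finite \<Rightarrow> real"
  assumes "\<And>k l. a k l \<ge> 0"
  shows "a k l \<le> (\<Sum>k\<in>UNIV. \<Sum>l\<in>UNIV. a k l)"
proof -
  have "a k l \<le> (\<Sum>l\<in>UNIV. a k l)" by (rule member_le_sum) (auto simp: assms)
  also have "\<dots> \<le> (\<Sum>k\<in>UNIV. \<Sum>l\<in>UNIV. a k l)"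
    by (rule member_le_sum[of k UNIV "\<lambda>k. \<Sum>l\<in>UNIV. a k l"]) (auto simp: assms intro: sum_nonneg)
  finally show ?thesis .
qed

text \<open>Taylor's formula of order two at \<open>t = 1\<close> for the even function
\<open>t \<mapsto> f (x + t h) + f (x - t h)\<close>, whose first derivative vanishes at 0.\<close>

lemma second_diff_eq_hess_form:
  assumes "C_k 2 f"
  obtains t where "0 < t" "t < 1"
    "second_diff h f x = (hess_form f h (x + t *\<^sub>R h) + hess_form f h (x - t *\<^sub>R h)) / 2"
proof -
  have c1: "C_k 1 f" and c2: "C_k 1 (partial_deriv l f)" for l
    using assms C_k_mono[OF assms, of 1] by (simp_all add: numeral_2_eq_2)
  define d1 where "d1 t = (\<Sum>l\<in>UNIV. h $ l * partial_deriv l f (x + t *\<^sub>R h))" for t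
  have D1: "((\<lambda>t. f (x + t *\<^sub>R h)) has_real_derivative d1 t) (at t)" for t
    unfolding d1_def by (rule C_1_DERIV_line[OF c1])
  have D2: "(d1 has_real_derivative hess_form f h (x + t *\<^sub>R h)) (at t)" for t
  proof -
    have "(d1 has_real_derivative (\<Sum>l\<in>UNIV. h $ l * (\<Sum>k\<in>UNIV. h $ k * partial_deriv k (partial_deriv l f) (x + t *\<^sub>R h)))) (at t)"
      unfolding d1_def by (intro DERIV_sum DERIV_cmult C_1_DERIV_line[OF c2])
    moreover have "(\<Sum>l\<in>UNIV. h $ l * (\<Sum>k\<in>UNIV. h $ k * partial_deriv k (partial_deriv l f) (x + t *\<^sub>R h))) = hess_form f h (x + t *\<^sub>R h)"
      unfolding hess_form_def by (subst sum.swap) (simp add: sum_distrib_left mult_ac)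
    ultimately show ?thesis by simp
  qed
  (* The derivatives of orders 0, 1 and 2 of that even function, in the form that Maclaurin expects. *)
  define df where "df m t = (if m = 0 then f (x + t *\<^sub>R h) + f (x - t *\<^sub>R h)
      else if m = 1 then d1 t - d1 (- t)
      else hess_form f h (x + t *\<^sub>R h) + hess_form f h (x - t *\<^sub>R h))" for m :: nat and t
  have refl: "((\<lambda>t. g (- t)) has_real_derivative - D) (at t)" if "(g has_real_derivative D) (at (-t))" for g D and t::real
    using DERIV_chain2[of g D "\<lambda>t. - t" t "-1" UNIV, OF that] DERIV_minus[OF DERIV_ident, of t UNIV] by simp
  have "\<exists>t>0. t < 1 \<and> df 0 1 = (\<Sum>m<2. df m 0 / fact m * 1 ^ m) + df 2 t / fact 2 * 1 ^ 2"
  proof (rule Maclaurin)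
    show "\<forall>m t. m < 2 \<and> 0 \<le> t \<and> t \<le> 1 \<longrightarrow> (df m has_real_derivative df (Suc m) t) (at t)"
    proof (intro allI impI)
      fix m t assume m: "m < (2::nat) \<and> 0 \<le> t \<and> t \<le> (1::real)"
      then consider "m = 0" | "m = 1" by linarith
      then show "(df m has_real_derivative df (Suc m) t) (at t)"
      proof cases
        case 1
        have "((\<lambda>t. f (x + t *\<^sub>R h) + f (x + (- t) *\<^sub>R h)) has_real_derivative d1 t + - d1 (- t)) (at t)"
          by (intro DERIV_add D1 refl[of "\<lambda>t. f (x + t *\<^sub>R h)"])
        then show ?thesis using 1 by (simp add: df_def[abs_def])
      next
        case 2
        have "((\<lambda>t. d1 t - d1 (- t)) has_real_derivative
           hess_form f h (x + t *\<^sub>R h) - (- hess_form f h (x + (- t) *\<^sub>R h))) (at t)"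
          by (intro DERIV_diff D2 refl)
        then show ?thesis using 2 by (simp add: df_def[abs_def])
      qed
    qed
  qed auto
  then obtain t where t: "0 < t" "t < 1" and
    "df 0 1 = (\<Sum>m<2. df m 0 / fact m * 1 ^ m) + df 2 t / fact 2 * 1 ^ 2" by blast
  then have "f (x + h) + f (x - h) = 2 * f x + (hess_form f h (x + t *\<^sub>R h) + hess_form f h (x - t *\<^sub>R h)) / 2"
    by (simp add: df_def numeral_2_eq_2)
  then have "second_diff h f x = (hess_form f h (x + t *\<^sub>R h) + hess_form f h (x - t *\<^sub>R h)) / 2"
    unfolding second_diff_def by linarith
  then show ?thesis using that t by blast
qed

lemma Cc_2_common_bound:
  fixes \<phi> :: "real^'n::finite \<Rightarrow> real"
  assumes "\<phi> \<in> Cc_k 2"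
  obtains B where "B \<ge> 0" "\<And>k l x. \<bar>partial_deriv k (partial_deriv l \<phi>) x\<bar> \<le> B"
proof -
  have c: "partial_deriv k (partial_deriv l \<phi>) \<in> Cc_k 0" for k l
    using assms by (intro partial_deriv_Cc_k) (simp add: numeral_2_eq_2)
  have "\<exists>B\<ge>0. \<forall>x. \<bar>partial_deriv k (partial_deriv l \<phi>) x\<bar> \<le> B" for k l
    using Cc_k_bounded[OF c] by metis
  then obtain b where b: "\<And>k l. b k l \<ge> 0" "\<And>k l x. \<bar>partial_deriv k (partial_deriv l \<phi>) x\<bar> \<le> b k l"
    by metis
  define B where "B = (\<Sum>k\<in>UNIV. \<Sum>l\<in>UNIV. b k l)"
  have "b k l \<le> B" for k l unfolding B_def by (rule member_le_double_sum) (rule b)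
  then show ?thesis using that[of B] b(2) order_trans[OF b(1)] order_trans[OF b(2)] by (meson)
qed

lemma second_diff_bound:
  fixes \<phi> :: "real^'n::finite \<Rightarrow> real"
  assumes "\<phi> \<in> Cc_k 2"
  obtains B where "B \<ge> 0" "\<And>h x. \<bar>second_diff h \<phi> x\<bar> \<le> B * (norm h)\<^sup>2"
proof -
  obtain B where B: "B \<ge> 0" "\<And>k l x. \<bar>partial_deriv k (partial_deriv l \<phi>) x\<bar> \<le> B"
    using Cc_2_common_bound[OF assms] by blast
  have "\<bar>second_diff h \<phi> x\<bar> \<le> (real CARD('n))\<^sup>2 * B * (norm h)\<^sup>2" for h x
  proof -
    obtain t where t: "second_diff h \<phi> x = (hess_form \<phi> h (x + t *\<^sub>R h) + hess_form \<phi> h (x - t *\<^sub>R h)) / 2"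
      using second_diff_eq_hess_form[of \<phi>] assms unfolding Cc_k_def by blast
    have "\<bar>hess_form \<phi> h y\<bar> \<le> (real CARD('n))\<^sup>2 * (norm h)\<^sup>2 * B" for y
      unfolding hess_form_def by (rule quadratic_form_bound) (rule B)
    from this[of "x + t *\<^sub>R h"] this[of "x - t *\<^sub>R h"] show ?thesis unfolding t
      by (simp add: mult_ac)
  qed
  then show ?thesis using that[of "(real CARD('n))\<^sup>2 * B"] B by simp
qed

text \<open>The Hessian of a test function is uniformly continuous, so the error in
\<open>second_diff_eq_hess_form\<close> is small uniformly in \<open>x\<close> and in the direction of
\<open>h\<close>.\<close>

lemma second_diff_consistent:
  fixes \<phi> :: "real^'n::finite \<Rightarrow> real"
  assumes "\<phi> \<in> Cc_k 2" "e > 0"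
  obtains d where "d > 0" "\<And>h x. norm h \<le> d \<Longrightarrow> \<bar>second_diff h \<phi> x - hess_form \<phi> h x\<bar> \<le> e * (norm h)\<^sup>2"
proof -
  define N where "N = (real CARD('n))\<^sup>2"
  have N: "N > 0" by (simp add: N_def)
  have c: "partial_deriv k (partial_deriv l \<phi>) \<in> Cc_k 0" for k l
    using assms by (intro partial_deriv_Cc_k) (simp add: numeral_2_eq_2)
  have "\<exists>d>0. \<forall>x y. norm (x - y) \<le> d \<longrightarrow> \<bar>partial_deriv k (partial_deriv l \<phi>) x - partial_deriv k (partial_deriv l \<phi>) y\<bar> \<le> e / N" for k l
    using Cc_k_uniformly_continuous[OF c, of "e / N" k l] N assms(2) by (metis divide_pos_pos)
  then obtain f where f: "\<And>k l. f k l > 0" "\<And>k l x y. norm (x - y) \<le> f k l \<Longrightarrow>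
       \<bar>partial_deriv k (partial_deriv l \<phi>) x - partial_deriv k (partial_deriv l \<phi>) y\<bar> \<le> e / N"
    by metis
  define d where "d = Min ((\<lambda>(k,l). f k l) ` UNIV)"
  have d: "d > 0" unfolding d_def by (subst Min_gr_iff) (auto simp: f)
  have df: "d \<le> f k l" for k l unfolding d_def by (rule Min_le) (auto intro: image_eqI[of _ _ "(k,l)"])
  have "\<bar>second_diff h \<phi> x - hess_form \<phi> h x\<bar> \<le> e * (norm h)\<^sup>2" if h: "norm h \<le> d" for h x
  proof -
    obtain t where t: "0 < t" "t < 1" "second_diff h \<phi> x = (hess_form \<phi> h (x + t *\<^sub>R h) + hess_form \<phi> h (x - t *\<^sub>R h)) / 2"
      using second_diff_eq_hess_form[of \<phi>] assms unfolding Cc_k_def by blast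
    have *: "\<bar>hess_form \<phi> h y - hess_form \<phi> h x\<bar> \<le> e * (norm h)\<^sup>2" if "norm (y - x) \<le> norm h" for y
    proof -
      have "hess_form \<phi> h y - hess_form \<phi> h x = (\<Sum>k\<in>UNIV. \<Sum>l\<in>UNIV. h $ k * h $ l *
          (partial_deriv k (partial_deriv l \<phi>) y - partial_deriv k (partial_deriv l \<phi>) x))"
        unfolding hess_form_def by (simp add: sum_subtractf[symmetric] right_diff_distrib)
      also have "\<bar>\<dots>\<bar> \<le> (real CARD('n))\<^sup>2 * (norm h)\<^sup>2 * (e / N)"
        using that h df by (intro quadratic_form_bound f(2)) (meson order_trans)
      also have "\<dots> = e * (norm h)\<^sup>2" using N by (simp add: N_def)
      finally show ?thesis .
    qed
    have "norm (t *\<^sub>R h) \<le> norm h" using t(1,2) by (simp add: mult_left_le_one_le)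
    then show ?thesis using *[of "x + t *\<^sub>R h"] *[of "x - t *\<^sub>R h"] unfolding t(3)
      by (simp add: abs_le_iff field_simps)
  qed
  then show ?thesis using that d by blast
qed

lemma norm_axis [simp]: "norm (axis i (s::real) :: real^'n::finite) = \<bar>s\<bar>"
  by (simp add: norm_eq_sqrt_inner inner_axis_axis)

lemma first_diff_mvt:
  assumes "C_k 1 f"
  obtains y where "norm (y - x) \<le> \<bar>s\<bar>" "f (x + axis i s) - f x = s * partial_deriv i f y"
proof -
  have *: "x + t *\<^sub>R axis i 1 = x + axis i t" for t :: real
    by (simp add: scaleR_vec_def axis_def vec_eq_iff)
  have "((\<lambda>t. f (x + t *\<^sub>R axis i s)) has_real_derivative s * partial_deriv i f (x + t *\<^sub>R axis i s)) (at t)" for t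
    using C_1_DERIV_line[OF assms, of x "axis i s" t]
    by (simp add: axis_def if_distrib[of "\<lambda>c. c * _"] cong: if_cong)
  from MVT2[of 0 1 "\<lambda>t. f (x + t *\<^sub>R axis i s)", OF _ this]
  obtain z where z: "0 < z" "z < 1" and e: "f (x + axis i s) - f x = s * partial_deriv i f (x + z *\<^sub>R axis i s)" by auto
  have "norm (z *\<^sub>R axis i s) \<le> \<bar>s\<bar>" using z by (simp add: norm_axis mult_left_le_one_le)
  then show ?thesis using that[OF _ e] by simp
qed

definition mixed_diff :: "'a \<Rightarrow> 'a \<Rightarrow> ('a::real_normed_vector \<Rightarrow> real) \<Rightarrow> 'a \<Rightarrow> real" where
  "mixed_diff a b u x = u (x + a + b) - u (x + a) - u (x + b) + u x"

lemma mixed_diff_mvt: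
  assumes "C_k 2 f"
  obtains y where "norm (y - x) \<le> 2 * \<bar>s\<bar>"
    "mixed_diff (axis i s) (axis j s) f x = s\<^sup>2 * partial_deriv j (partial_deriv i f) y"
proof -
  have c1: "C_k 1 f" and c2: "C_k 1 (partial_deriv l f)" for l
    using assms C_k_mono[OF assms, of 1] by (simp_all add: numeral_2_eq_2)
  define g where "g t = f ((x + axis j s) + t *\<^sub>R axis i s) - f (x + t *\<^sub>R axis i s)" for t
  have "(g has_real_derivative s * partial_deriv i f ((x + axis j s) + t *\<^sub>R axis i s) - s * partial_deriv i f (x + t *\<^sub>R axis i s)) (at t)" for t
    unfolding g_def
    using C_1_DERIV_line[OF c1, of "x" "axis i s" t] C_1_DERIV_line[OF c1, of "x + axis j s" "axis i s" t]
    by (intro DERIV_diff) (simp_all add: axis_def if_distrib[of "\<lambda>c. c * _"] cong: if_cong)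
  from MVT2[of 0 1 g, OF _ this]
  obtain z where z: "0 < z" "z < 1" and e: "g 1 - g 0 = s * partial_deriv i f ((x + axis j s) + z *\<^sub>R axis i s) - s * partial_deriv i f (x + z *\<^sub>R axis i s)" by auto
  obtain y where y: "norm (y - (x + z *\<^sub>R axis i s)) \<le> \<bar>s\<bar>"
    "partial_deriv i f ((x + z *\<^sub>R axis i s) + axis j s) - partial_deriv i f (x + z *\<^sub>R axis i s) = s * partial_deriv j (partial_deriv i f) y"
    using first_diff_mvt[OF c2] by metis
  have "norm (z *\<^sub>R axis i s) \<le> \<bar>s\<bar>" using z by (simp add: norm_axis mult_left_le_one_le)
  moreover have "norm (y - x) \<le> norm (y - (x + z *\<^sub>R axis i s)) + norm (z *\<^sub>R axis i s)"
    using norm_triangle_ineq[of "y - (x + z *\<^sub>R axis i s)" "z *\<^sub>R axis i s"] by simp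
  ultimately have 1: "norm (y - x) \<le> 2 * \<bar>s\<bar>" using y(1) by linarith
  have "mixed_diff (axis i s) (axis j s) f x = g 1 - g 0"
    by (simp add: mixed_diff_def g_def add_ac)
  also have "\<dots> = s * (partial_deriv i f ((x + z *\<^sub>R axis i s) + axis j s) - partial_deriv i f (x + z *\<^sub>R axis i s))"
    unfolding e by (simp add: algebra_simps)
  also have "\<dots> = s\<^sup>2 * partial_deriv j (partial_deriv i f) y" unfolding y(2) by (simp add: power2_eq_square)
  finally show ?thesis using that[OF 1] by blast
qed

text \<open>Schwarz's theorem: the mixed difference does not change when its two directions are exchanged,
and by the mean value theorem its quotient by \<open>s\<^sup>2\<close> is a value of either mixed
derivative at a point close to \<open>x\<close>.\<close>

lemma partial_deriv_symmetric:
  assumes "C_k 2 f"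
  shows "partial_deriv i (partial_deriv j f) x = partial_deriv j (partial_deriv i f) x"
proof -
  have c: "isCont (partial_deriv k (partial_deriv l f)) x" for k l
    using assms by (simp add: numeral_2_eq_2 continuous_on_eq_continuous_at)
  define s where "s n = 1 / real (Suc n)" for n
  have lim: "\<exists>y. y \<longlonglongrightarrow> x \<and> (\<forall>n. mixed_diff (axis i (s n)) (axis j (s n)) f x = (s n)\<^sup>2 * partial_deriv j (partial_deriv i f) (y n))" for i j
  proof -
    have "\<exists>y. norm (y - x) \<le> 2 * \<bar>s n\<bar> \<and> mixed_diff (axis i (s n)) (axis j (s n)) f x = (s n)\<^sup>2 * partial_deriv j (partial_deriv i f) y" for n
      by (rule mixed_diff_mvt[OF assms, of x "s n" i j]) blast
    then obtain y where y: "\<And>n. norm (y n - x) \<le> 2 * \<bar>s n\<bar>"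
      "\<And>n. mixed_diff (axis i (s n)) (axis j (s n)) f x = (s n)\<^sup>2 * partial_deriv j (partial_deriv i f) (y n)" by metis
    have "(\<lambda>n. 2 * \<bar>s n\<bar>) \<longlonglongrightarrow> 0" unfolding s_def by real_asymp
    then have "(\<lambda>n. y n - x) \<longlonglongrightarrow> 0"
      by (rule Lim_null_comparison[rotated]) (use y in auto)
    then show ?thesis using y(2) LIM_zero_iff by blast
  qed
  obtain y where y: "y \<longlonglongrightarrow> x" "\<And>n. mixed_diff (axis i (s n)) (axis j (s n)) f x = (s n)\<^sup>2 * partial_deriv j (partial_deriv i f) (y n)"
    using lim by blast
  obtain z where z: "z \<longlonglongrightarrow> x" "\<And>n. mixed_diff (axis j (s n)) (axis i (s n)) f x = (s n)\<^sup>2 * partial_deriv i (partial_deriv j f) (z n)"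
    using lim by blast
  have "mixed_diff (axis j (s n)) (axis i (s n)) f x = mixed_diff (axis i (s n)) (axis j (s n)) f x" for n
    by (simp add: mixed_diff_def add_ac)
  then have "(s n)\<^sup>2 * partial_deriv j (partial_deriv i f) (y n) = (s n)\<^sup>2 * partial_deriv i (partial_deriv j f) (z n)" for n
    using y(2) z(2) by metis
  then have eq: "partial_deriv j (partial_deriv i f) (y n) = partial_deriv i (partial_deriv j f) (z n)" for n
    by (simp add: s_def)
  have "(\<lambda>n. partial_deriv j (partial_deriv i f) (y n)) \<longlonglongrightarrow> partial_deriv j (partial_deriv i f) x"
    by (rule isCont_tendsto_compose[OF c y(1)])
  moreover have "(\<lambda>n. partial_deriv i (partial_deriv j f) (z n)) \<longlonglongrightarrow> partial_deriv i (partial_deriv j f) x"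
    by (rule isCont_tendsto_compose[OF c z(1)])
  ultimately show ?thesis unfolding eq using LIMSEQ_unique by metis
qed

section \<open>Translation and integrability\<close>

lemma distr_lebesgue_shift: "distr lebesgue lebesgue (\<lambda>x::'a::euclidean_space. x + a) = lebesgue"
  and measurable_lebesgue_shift [measurable]: "(\<lambda>x::'a::euclidean_space. x + a) \<in> lebesgue \<rightarrow>\<^sub>M lebesgue"
proof -
  have e: "(\<lambda>x::'a. a + (\<Sum>j\<in>Basis. (1 * (x \<bullet> j)) *\<^sub>R j)) = (\<lambda>x. x + a)"
    by (auto simp: euclidean_representation add.commute)
  show "(\<lambda>x::'a. x + a) \<in> lebesgue \<rightarrow>\<^sub>M lebesgue"
    using lebesgue_affine_measurable[of "\<lambda>_. 1" a] by (simp only: e)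
  show "distr lebesgue lebesgue (\<lambda>x::'a. x + a) = lebesgue"
    using lebesgue_affine_euclidean[of "\<lambda>_. 1" a] by (simp only: e) (simp add: density_1)
qed

lemma measurable_shift:
  "f \<in> borel_measurable lebesgue \<Longrightarrow> (\<lambda>x::'a::euclidean_space. f (x + a)) \<in> borel_measurable lebesgue"
  by (rule measurable_compose[OF measurable_lebesgue_shift])

lemma integrable_shift:
  fixes f :: "'a::euclidean_space \<Rightarrow> real"
  assumes "integrable lebesgue f"
  shows "integrable lebesgue (\<lambda>x. f (x + a))"
  using integrable_distr[OF measurable_lebesgue_shift, of a f] assms by (simp add: distr_lebesgue_shift)

lemma integral_shift:
  fixes f :: "'a::euclidean_space \<Rightarrow> real"
  assumes "f \<in> borel_measurable lebesgue"
  shows "(LINT x|lebesgue. f (x + a)) = (LINT x|lebesgue. f x)"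
  using integral_distr[OF measurable_lebesgue_shift, of f a] assms by (simp add: distr_lebesgue_shift)

lemma borel_measurable_lebesgueI: "f \<in> borel_measurable borel \<Longrightarrow> f \<in> borel_measurable lebesgue"
  by (rule measurable_completion) simp

lemma Cc_k_measurable: "\<phi> \<in> Cc_k k \<Longrightarrow> \<phi> \<in> borel_measurable lebesgue"
  by (intro borel_measurable_lebesgueI borel_measurable_continuous_onI Cc_k_continuous)

lemma integrable_indicator_cball: "integrable lebesgue (indicator (cball (0::'a::euclidean_space) R) :: 'a \<Rightarrow> real)"
  using lmeasurable_cball[of "0::'a" R] by (intro integrable_real_indicator) (auto simp: fmeasurable_def)

lemma integrable_bounded_support:
  fixes g :: "'a::euclidean_space \<Rightarrow> real"
  assumes "g \<in> borel_measurable lebesgue" "\<And>x. \<bar>g x\<bar> \<le> B" "\<And>x. norm x > R \<Longrightarrow> g x = 0"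
  shows "integrable lebesgue g"
proof (rule Bochner_Integration.integrable_bound)
  show "integrable lebesgue (\<lambda>x::'a. B * indicator (cball 0 R) x)"
    by (rule integrable_mult_right[OF integrable_indicator_cball])
  show "AE x in lebesgue. norm (g x) \<le> norm (B * indicator (cball 0 R) x)"
  proof (rule AE_I2)
    fix x
    show "norm (g x) \<le> norm (B * indicator (cball 0 R) x)"
      using assms(2)[of x] assms(3)[of x] by (cases "norm x > R") auto
  qed
qed (use assms in auto)

lemma Cc_k_integrable:
  assumes "\<phi> \<in> Cc_k k"
  shows "integrable lebesgue \<phi>"
proof -
  obtain R where R: "R > 0" "\<And>x. norm x > R \<Longrightarrow> \<phi> x = 0" using Cc_k_support[OF assms] by metis
  obtain B where B: "B \<ge> 0" "\<And>x. \<bar>\<phi> x\<bar> \<le> B" using Cc_k_bounded[OF assms] by metis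
  show ?thesis by (rule integrable_bounded_support[OF Cc_k_measurable[OF assms] B(2) R(2)])
qed

section \<open>Elementary \<open>L\<^sup>p\<close> estimates\<close>

abbreviation pairing :: "('a::euclidean_space \<Rightarrow> real) \<Rightarrow> ('a \<Rightarrow> real) \<Rightarrow> real"  (\<open>\<langle>_, _\<rangle>\<close>) where
  "\<langle>u, \<phi>\<rangle> \<equiv> LINT x|lebesgue. u x * \<phi> x"

abbreviation Lp_mass :: "real \<Rightarrow> ('a::euclidean_space \<Rightarrow> real) \<Rightarrow> real" where
  "Lp_mass p f \<equiv> LINT x|lebesgue. \<bar>f x\<bar> powr p"

lemma Lp_real: "f \<in> Lp p \<longleftrightarrow> f \<in> borel_measurable lebesgue \<and> integrable lebesgue (\<lambda>x. \<bar>f x\<bar> powr p)"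
  for f :: "real^'n::finite \<Rightarrow> real"
  by (simp add: Lp_def)

lemma le_one_plus_powr: "\<bar>a::real\<bar> \<le> 1 + \<bar>a\<bar> powr p" if "p \<ge> 1"
proof (cases "\<bar>a\<bar> \<le> 1")
  case True
  then show ?thesis by (meson add_increasing2 powr_ge_zero order_trans)
next
  case False
  then have "\<bar>a\<bar> powr 1 \<le> \<bar>a\<bar> powr p" using that by (intro powr_mono) auto
  then show ?thesis using False by simp
qed

text \<open>The bound \<open>\<bar>a\<bar> \<le> 1 + \<bar>a\<bar> powr p\<close> makes products with bounded
integrable functions integrable for every \<open>p \<ge> 1\<close> at once. It takes the place of
Hoelder's inequality throughout; where the right side has to be small, the function is rescaled
first.\<close>

lemma Lp_mult_integrable:
  fixes f g :: "real^'n::finite \<Rightarrow> real"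
  assumes "p \<ge> 1" "f \<in> Lp p" "integrable lebesgue g" "\<And>x. \<bar>g x\<bar> \<le> B"
  shows "integrable lebesgue (\<lambda>x. f x * g x)"
    "(LINT x|lebesgue. \<bar>f x * g x\<bar>) \<le> (LINT x|lebesgue. \<bar>g x\<bar>) + B * Lp_mass p f"
proof -
  have [measurable]: "f \<in> borel_measurable lebesgue" "g \<in> borel_measurable lebesgue"
    and i: "integrable lebesgue (\<lambda>x. \<bar>f x\<bar> powr p)"
    using assms by (auto simp: Lp_real)
  have i2: "integrable lebesgue (\<lambda>x. \<bar>g x\<bar> + B * \<bar>f x\<bar> powr p)"
    using assms(3) i by auto
  have le: "\<bar>f x * g x\<bar> \<le> \<bar>g x\<bar> + B * \<bar>f x\<bar> powr p" for x
  proof -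
    have "\<bar>f x * g x\<bar> \<le> (1 + \<bar>f x\<bar> powr p) * \<bar>g x\<bar>"
      unfolding abs_mult by (intro mult_right_mono le_one_plus_powr assms) auto
    also have "\<dots> \<le> \<bar>g x\<bar> + B * \<bar>f x\<bar> powr p"
      using mult_right_mono[OF assms(4)[of x], of "\<bar>f x\<bar> powr p"] by (simp add: algebra_simps)
    finally show ?thesis .
  qed
  show I: "integrable lebesgue (\<lambda>x. f x * g x)"
    by (rule Bochner_Integration.integrable_bound[OF i2]) (auto intro!: AE_I2 order_trans[OF le abs_ge_self])
  have "(LINT x|lebesgue. \<bar>f x * g x\<bar>) \<le> (LINT x|lebesgue. \<bar>g x\<bar> + B * \<bar>f x\<bar> powr p)"
    using I i2 le by (intro integral_mono) auto
  then show "(LINT x|lebesgue. \<bar>f x * g x\<bar>) \<le> (LINT x|lebesgue. \<bar>g x\<bar>) + B * Lp_mass p f"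
    using assms(3) i by simp
qed

lemma Lp_Cc_k_integrable:
  fixes f :: "real^'n::finite \<Rightarrow> real"
  assumes "p \<ge> 1" "f \<in> Lp p" "\<phi> \<in> Cc_k k"
  shows "integrable lebesgue (\<lambda>x. f x * \<phi> x)"
  using Cc_k_bounded[OF assms(3)] Lp_mult_integrable(1)[OF assms(1,2) Cc_k_integrable[OF assms(3)]] by metis

lemma Lp_locally_integrable:
  fixes f :: "real^'n::finite \<Rightarrow> real"
  assumes "p \<ge> 1" "f \<in> Lp p"
  shows "integrable lebesgue (\<lambda>x. f x * indicator (cball 0 R) x)"
  by (rule Lp_mult_integrable(1)[where B = 1, OF assms integrable_indicator_cball]) (auto simp: indicator_def)

lemma powr_add_le:
  fixes a b :: real assumes "p \<ge> 1"
  shows "\<bar>a + b\<bar> powr p \<le> 2 powr p * (\<bar>a\<bar> powr p + \<bar>b\<bar> powr p)"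
proof -
  have "\<bar>a + b\<bar> powr p \<le> (2 * max \<bar>a\<bar> \<bar>b\<bar>) powr p"
    using assms by (intro powr_mono2) (auto simp: max_def)
  also have "\<dots> = 2 powr p * (max \<bar>a\<bar> \<bar>b\<bar>) powr p" by (simp add: powr_mult)
  also have "\<dots> \<le> 2 powr p * (\<bar>a\<bar> powr p + \<bar>b\<bar> powr p)"
    by (intro mult_left_mono) (auto simp: max_def)
  finally show ?thesis .
qed

lemma Lp_add:
  fixes f g :: "real^'n::finite \<Rightarrow> real"
  assumes "p \<ge> 1" "f \<in> Lp p" "g \<in> Lp p"
  shows "(\<lambda>x. f x + g x) \<in> Lp p"
proof -
  have m: "f \<in> borel_measurable lebesgue" "g \<in> borel_measurable lebesgue"
    and i: "integrable lebesgue (\<lambda>x. 2 powr p * (\<bar>f x\<bar> powr p + \<bar>g x\<bar> powr p))"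
    using assms by (auto simp: Lp_real)
  have "integrable lebesgue (\<lambda>x. \<bar>f x + g x\<bar> powr p)"
    by (rule Bochner_Integration.integrable_bound[OF i]) (use m powr_add_le[OF assms(1)] in auto)
  then show ?thesis using m by (auto simp: Lp_real)
qed

lemma Lp_cmult:
  fixes f :: "real^'n::finite \<Rightarrow> real"
  assumes "f \<in> Lp p"
  shows "(\<lambda>x. c * f x) \<in> Lp p"
  using assms by (auto simp: Lp_real abs_mult powr_mult)

lemma Lp_diff:
  fixes f g :: "real^'n::finite \<Rightarrow> real"
  assumes "p \<ge> 1" "f \<in> Lp p" "g \<in> Lp p"
  shows "(\<lambda>x. f x - g x) \<in> Lp p"
  using Lp_add[OF assms(1,2) Lp_cmult[OF assms(3), of "-1"]] by simp

lemma Lp_shift: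
  fixes f :: "real^'n::finite \<Rightarrow> real"
  assumes "f \<in> Lp p"
  shows "(\<lambda>x. f (x + a)) \<in> Lp p"
  using assms integrable_shift[of "\<lambda>x. \<bar>f x\<bar> powr p" a] by (auto simp: Lp_real measurable_shift)

lemma Lp_second_diff:
  fixes u :: "real^'n::finite \<Rightarrow> real"
  assumes "p \<ge> 1" "u \<in> Lp p"
  shows "second_diff h u \<in> Lp p"
  unfolding second_diff_def[abs_def]
  using Lp_add[OF assms(1) Lp_diff[OF assms(1) Lp_shift[OF assms(2), of h] Lp_cmult[OF assms(2), of 2]] Lp_shift[OF assms(2), of "- h"]]
  by simp

text \<open>Fatou's lemma.\<close>

lemma nn_integral_le_of_tendsto:
  assumes "\<And>n. (\<lambda>x. f n x) \<in> borel_measurable M" "AE x in M. (\<lambda>n. f n x) \<longlonglongrightarrow> g x"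
    "\<And>n::nat. (\<integral>\<^sup>+x. ennreal (f n x) \<partial>M) \<le> B"
  shows "(\<integral>\<^sup>+x. ennreal (g x) \<partial>M) \<le> B"
proof -
  have "(\<integral>\<^sup>+x. ennreal (g x) \<partial>M) \<le> (\<integral>\<^sup>+x. liminf (\<lambda>n. ennreal (f n x)) \<partial>M)"
  proof (rule nn_integral_mono_AE)
    show "AE x in M. ennreal (g x) \<le> liminf (\<lambda>n. ennreal (f n x))"
      using assms(2)
    proof eventually_elim
      case (elim x)
      then have "(\<lambda>n. ennreal (f n x)) \<longlonglongrightarrow> ennreal (g x)" by (rule tendsto_ennrealI)
      then show ?case using lim_imp_Liminf[of sequentially "\<lambda>n. ennreal (f n x)"] by simp
    qed
  qed
  also have "\<dots> \<le> liminf (\<lambda>n. \<integral>\<^sup>+x. ennreal (f n x) \<partial>M)"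
    by (rule nn_integral_liminf) (use assms(1) in measurable)
  also have "\<dots> \<le> B"
    using assms(3) by (intro Liminf_le) auto
  finally show ?thesis .
qed

section \<open>Duality by Young's inequality\<close>

text \<open>The test functions against which a bound in \<open>L\<^sup>p\<close> is measured. For \<open>p =
1\<close> the dual norm is the supremum norm, and the test functions are those of its unit ball. For
\<open>p > 1\<close> all test functions are allowed, and their size enters through
\<open>dual_gauge\<close>.\<close>

definition admissible :: "real \<Rightarrow> (real^'n::finite \<Rightarrow> real) \<Rightarrow> bool" where
  "admissible p \<phi> \<longleftrightarrow> (p = 1 \<longrightarrow> (\<forall>x. \<bar>\<phi> x\<bar> \<le> 1))"

text \<open>The integral of the power with the conjugate exponent \<open>p / (p - 1)\<close>, and 0 for
\<open>p = 1\<close>, where the size of the test functions is already limited by \<open>admissible\<close>.\<close>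

definition dual_gauge :: "real \<Rightarrow> (real^'n::finite \<Rightarrow> real) \<Rightarrow> real" where
  "dual_gauge p \<phi> = (if p = 1 then 0 else LINT x|lebesgue. \<bar>\<phi> x\<bar> powr (p / (p - 1)))"

text \<open>The inhomogeneous form, by Young's inequality, of \<open>\<bar>T \<phi>\<bar> \<le> K
\<parallel>\<phi>\<parallel>\<close> for the norm of the dual space. It covers \<open>p = 1\<close>
and \<open>p > 1\<close> uniformly and, like the gauge itself, is invariant under translations of
the test functions. It is stable under pointwise limits of functionals, which is how bounds pass
from the non-local to the local Hessian.\<close>

definition dual_bounded :: "real \<Rightarrow> real \<Rightarrow> ((real^'n::finite \<Rightarrow> real) \<Rightarrow> real) \<Rightarrow> bool" where
  "dual_bounded p M T \<longleftrightarrow> (\<forall>\<phi>\<in>Cc_inf. admissible p \<phi> \<longrightarrow> T \<phi> \<le> M + dual_gauge p \<phi>)"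

lemma dual_boundedI:
  "(\<And>\<phi>. \<phi> \<in> Cc_inf \<Longrightarrow> admissible p \<phi> \<Longrightarrow> T \<phi> \<le> M + dual_gauge p \<phi>) \<Longrightarrow> dual_bounded p M T"
  by (simp add: dual_bounded_def)

lemma dual_boundedD:
  "dual_bounded p M T \<Longrightarrow> \<phi> \<in> Cc_inf \<Longrightarrow> admissible p \<phi> \<Longrightarrow> T \<phi> \<le> M + dual_gauge p \<phi>"
  by (simp add: dual_bounded_def)

lemma dual_gauge_nonneg: "0 \<le> dual_gauge p \<phi>"
  by (simp add: dual_gauge_def)

lemma admissible_shift: "admissible p \<phi> \<Longrightarrow> admissible p (\<lambda>x. \<phi> (x + a))"
  by (auto simp: admissible_def)

lemma dual_gauge_shift: "\<phi> \<in> Cc_k k \<Longrightarrow> dual_gauge p (\<lambda>x. \<phi> (x + a)) = dual_gauge p \<phi>"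
  using integral_shift[of "\<lambda>x. \<bar>\<phi> x\<bar> powr (p / (p - 1))" a] Cc_k_measurable[of \<phi> k]
  by (simp add: dual_gauge_def)

lemma admissible_uminus: "admissible p \<phi> \<Longrightarrow> admissible p (\<lambda>x. - 1 * \<phi> x)"
  and dual_gauge_uminus: "dual_gauge p (\<lambda>x. - 1 * \<phi> x) = dual_gauge p \<phi>"
  by (auto simp: admissible_def dual_gauge_def)

lemma dual_bounded_abs:
  assumes "dual_bounded p M T" "\<phi> \<in> Cc_inf" "admissible p \<phi>" "T (\<lambda>x. - 1 * \<phi> x) = - T \<phi>"
  shows "\<bar>T \<phi>\<bar> \<le> M + dual_gauge p \<phi>"
proof -
  have "- T \<phi> \<le> M + dual_gauge p \<phi>"
    using dual_boundedD[OF assms(1) Cc_inf_scale[OF assms(2), of "-1"] admissible_uminus[OF assms(3)]]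
    unfolding assms(4) dual_gauge_uminus .
  then show ?thesis using dual_boundedD[OF assms(1-3)] by simp
qed

text \<open>Young's inequality without its constants: whichever of \<open>b\<close> and \<open>a powr (p -
1)\<close> is larger, one of the two terms suffices.\<close>

lemma young_crude:
  fixes a b p :: real
  assumes "p > 1" "a \<ge> 0" "b \<ge> 0"
  shows "a * b \<le> a powr p + b powr (p / (p - 1))"
proof (cases "b \<le> a powr (p - 1)")
  case True
  have "a * b \<le> a * a powr (p - 1)" using True assms by (intro mult_left_mono)
  also have "\<dots> = a powr p" using assms by (cases "a = 0") (auto simp: powr_mult_base)
  finally show ?thesis by (simp add: add_increasing2)
next
  case False
  then have b: "b > 0" using powr_ge_zero[of a "p - 1"] by linarith
  have "a = (a powr (p - 1)) powr (1 / (p - 1))" using assms by (simp add: powr_powr)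
  also have "\<dots> \<le> b powr (1 / (p - 1))" using False assms by (intro powr_mono2) auto
  finally have "a * b \<le> b powr (1 / (p - 1)) * b powr 1" using b by simp
  also have "\<dots> = b powr (1 / (p - 1) + 1)" by (simp only: powr_add)
  also have "1 / (p - 1) + 1 = p / (p - 1)" using assms by (simp add: field_simps)
  finally show ?thesis by (simp add: add_increasing)
qed

lemma Cc_k_powr_integrable:
  assumes "\<phi> \<in> Cc_k k" "q \<ge> 0"
  shows "integrable lebesgue (\<lambda>x. \<bar>\<phi> x\<bar> powr q)"
proof -
  obtain R where R: "R > 0" "\<And>x. norm x > R \<Longrightarrow> \<phi> x = 0" using Cc_k_support[OF assms(1)] by metis
  obtain B where B: "B \<ge> 0" "\<And>x. \<bar>\<phi> x\<bar> \<le> B" using Cc_k_bounded[OF assms(1)] by metis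
  show ?thesis
  proof (rule integrable_bounded_support[of _ "B powr q" R])
    show "\<bar>\<bar>\<phi> x\<bar> powr q\<bar> \<le> B powr q" for x using B(2) assms(2) by (auto intro: powr_mono2)
  qed (use Cc_k_measurable[OF assms(1)] R in auto)
qed

lemma Lp_dual_bounded:
  fixes f :: "real^'n::finite \<Rightarrow> real"
  assumes "p \<ge> 1" "f \<in> Lp p" "Lp_mass p f \<le> M"
  shows "dual_bounded p M (\<lambda>\<phi>. \<langle>f, \<phi>\<rangle>)"
proof (rule dual_boundedI)
  fix \<phi> :: "real^'n \<Rightarrow> real" assume \<phi>: "\<phi> \<in> Cc_inf" "admissible p \<phi>"
  have i: "integrable lebesgue (\<lambda>x. \<bar>f x\<bar> powr p)" using assms by (simp add: Lp_real)
  have i2: "integrable lebesgue (\<lambda>x. f x * \<phi> x)" by (rule Lp_Cc_k_integrable[OF assms(1,2) Cc_inf_Cc_k[OF \<phi>(1)]])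
  show "\<langle>f, \<phi>\<rangle> \<le> M + dual_gauge p \<phi>"
  proof (cases "p = 1")
    case True
    have "f x * \<phi> x \<le> \<bar>f x\<bar> powr p" for x
    proof -
      have "f x * \<phi> x \<le> \<bar>f x\<bar> * \<bar>\<phi> x\<bar>" by (metis abs_ge_self abs_mult)
      also have "\<dots> \<le> \<bar>f x\<bar> * 1" using \<phi>(2) True by (intro mult_left_mono) (auto simp: admissible_def)
      finally show ?thesis using True by simp
    qed
    then have "\<langle>f, \<phi>\<rangle> \<le> Lp_mass p f"
      using i i2 by (intro integral_mono)
    then show ?thesis using assms(3) True by (simp add: dual_gauge_def)
  next
    case False
    then have p: "p > 1" using assms by simp
    have iq: "integrable lebesgue (\<lambda>x. \<bar>\<phi> x\<bar> powr (p / (p - 1)))"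
      by (rule Cc_k_powr_integrable[OF Cc_inf_Cc_k[OF \<phi>(1), of 0]]) (use p in auto)
    have "f x * \<phi> x \<le> \<bar>f x\<bar> powr p + \<bar>\<phi> x\<bar> powr (p / (p - 1))" for x
      using young_crude[OF p, of "\<bar>f x\<bar>" "\<bar>\<phi> x\<bar>"] abs_ge_self[of "f x * \<phi> x"] by (simp add: abs_mult)
    then have "\<langle>f, \<phi>\<rangle> \<le> (LINT x|lebesgue. \<bar>f x\<bar> powr p + \<bar>\<phi> x\<bar> powr (p / (p - 1)))"
      using i i2 iq by (intro integral_mono) auto
    then show ?thesis using assms(3) False i iq by (simp add: dual_gauge_def)
  qed
qed

lemma bump_Cc_inf: "r > 0 \<Longrightarrow> bump r \<in> Cc_inf"
  using bump_mult_Cc_inf[of r "\<lambda>x. 1"] bump_algebra.const[of 1] by simp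

text \<open>The converse of \<open>Lp_dual_bounded\<close>, up to the factor \<open>2 powr p\<close>, and with
no prior integrability of \<open>\<bar>f\<bar> powr p\<close>. With \<open>m = min \<bar>f\<bar>
L\<close>, the functional is tested with approximations of \<open>(m/2) powr (p - 1) sgn f\<close>,
cut off by a bump \<open>b\<close>. The left side is then at least \<open>2 powr (1 - p) I\<close>,
where \<open>I\<close> is the integral of \<open>b m powr p\<close>, whereas the gauge is at most
\<open>2 powr (-p) I\<close>, that is half of it, and can be absorbed because the truncation and the
cut-off make \<open>I\<close> finite. Finally \<open>L\<close> and the size of the bump tend to
infinity together.\<close>

lemma dual_bounded_imp_nn_integral:
  fixes f :: "real^'n::finite \<Rightarrow> real"
  assumes p: "p \<ge> 1" and f[measurable]: "f \<in> borel_measurable lebesgue"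
    and loc: "\<And>\<phi>. \<phi> \<in> Cc_inf \<Longrightarrow> integrable lebesgue (\<lambda>x. f x * \<phi> x)"
    and M: "M \<ge> 0" and dual: "dual_bounded p M (\<lambda>\<phi>. \<langle>f, \<phi>\<rangle>)"
  shows "(\<integral>\<^sup>+x. ennreal (\<bar>f x\<bar> powr p) \<partial>lebesgue) \<le> ennreal (2 powr p * M)"
proof -
  define w where "w n x = min \<bar>f x\<bar> (real (Suc n)) powr p * bump (real (Suc n)) x" for n x
  have bm[measurable]: "bump r \<in> borel_measurable lebesgue" if "r > 0" for r
    using Cc_k_measurable[OF Cc_inf_Cc_k[OF bump_Cc_inf[OF that]]] .
  have wm: "w n \<in> borel_measurable lebesgue" for n
    unfolding w_def[abs_def] by measurable
  have main: "(\<integral>\<^sup>+x. ennreal (w n x) \<partial>lebesgue) \<le> ennreal (2 powr p * M)" for n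
  proof -
    define L where "L = real (Suc n)"
    have L: "L > 0" "L \<ge> 1" by (simp_all add: L_def)
    define b :: "real^'n \<Rightarrow> real" where "b = bump L"
    define m where "m x = min \<bar>f x\<bar> L" for x
    have b: "b \<in> Cc_inf" "0 \<le> b x" "b x \<le> 1" for x
      using bump_Cc_inf[OF L(1)] bump_bounds by (auto simp: b_def)
    have ib: "integrable lebesgue b" by (rule Cc_k_integrable[OF Cc_inf_Cc_k[OF b(1)]])
    have [measurable]: "b \<in> borel_measurable lebesgue" using ib by auto
    have m: "0 \<le> m x" "m x \<le> \<bar>f x\<bar>" "m x \<le> L" for x using L by (auto simp: m_def)
    have [measurable]: "m \<in> borel_measurable lebesgue" unfolding m_def by measurable
    (* The test function is split into \<open>s\<close>, bounded by 1 as the density lemma demands,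
       and the constant \<open>c\<close>, so that \<open>c \<bar>s\<bar> \<le> (m / 2) powr (p - 1)\<close>. *)
    define s where "s x = sgn (f x) * (m x / L) powr (p - 1)" for x
    have sm[measurable]: "s \<in> borel_measurable lebesgue" unfolding s_def by measurable
    have s1: "\<bar>s x\<bar> \<le> 1" for x
    proof -
      have "(m x / L) powr (p - 1) \<le> 1" using m L p by (intro powr_le1) auto
      then show ?thesis by (auto simp: s_def abs_mult sgn_if)
    qed
    obtain \<phi> where \<phi>: "\<And>k::nat. \<phi> k \<in> Cc_inf" "\<And>k x. \<bar>\<phi> k x\<bar> \<le> b x"
      and lim: "AE x in lebesgue. (\<lambda>k. \<phi> k x) \<longlonglongrightarrow> s x * b x"
      unfolding b_def by (rule Cc_inf_dense_AE[OF sm s1 L(1)]) blast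
    define c where "c = (L / 2) powr (p - 1)"
    have c: "c > 0" using L by (simp add: c_def)
    have c1: "c = 1" if "p = 1" using that L by (simp add: c_def)
    have [measurable]: "\<phi> k \<in> borel_measurable lebesgue" for k using Cc_k_measurable[OF Cc_inf_Cc_k[OF \<phi>(1)]] .
    have ifb: "integrable lebesgue (\<lambda>x. f x * b x)" by (rule loc[OF b(1)])
    have l1: "(\<lambda>k. LINT x|lebesgue. f x * (c * \<phi> k x)) \<longlonglongrightarrow> (LINT x|lebesgue. f x * (c * (s x * b x)))"
    proof (rule integral_dominated_convergence[where w="\<lambda>x. c * \<bar>f x * b x\<bar>"])
      show "integrable lebesgue (\<lambda>x. c * \<bar>f x * b x\<bar>)" using ifb by auto
      show "AE x in lebesgue. (\<lambda>k. f x * (c * \<phi> k x)) \<longlonglongrightarrow> f x * (c * (s x * b x))"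
        using lim by eventually_elim (intro tendsto_intros)
      show "AE x in lebesgue. norm (f x * (c * \<phi> k x)) \<le> c * \<bar>f x * b x\<bar>" for k
      proof (rule AE_I2)
        fix x
        have "c * (\<bar>f x\<bar> * \<bar>\<phi> k x\<bar>) \<le> c * (\<bar>f x\<bar> * b x)"
          using c \<phi>(2) by (intro mult_left_mono) auto
        then show "norm (f x * (c * \<phi> k x)) \<le> c * \<bar>f x * b x\<bar>"
          using c b(2)[of x] by (simp add: abs_mult mult_ac)
      qed
    qed measurable
    define I where "I = (LINT x|lebesgue. w n x)"
    have iw: "integrable lebesgue (w n)"
    proof (rule Bochner_Integration.integrable_bound)
      show "integrable lebesgue (\<lambda>x. L powr p * b x)" using ib by auto
      show "AE x in lebesgue. norm (w n x) \<le> norm (L powr p * b x)"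
        using b(2) m p L by (auto simp: w_def b_def m_def L_def intro!: mult_right_mono powr_mono2)
    qed (rule wm)
    have w: "w n x = m x powr p * b x" for x by (simp add: w_def m_def b_def L_def)
    have lower: "2 powr (1 - p) * I \<le> (LINT x|lebesgue. f x * (c * (s x * b x)))"
    proof -
      have eq: "f x * (c * (s x * b x)) = 2 powr (1 - p) * (\<bar>f x\<bar> * m x powr (p - 1) * b x)" for x
      proof -
        have "c * (m x / L) powr (p - 1) = 2 powr (1 - p) * m x powr (p - 1)"
          using L m by (simp add: c_def powr_divide powr_minus_divide[of 2 "p - 1", simplified] field_simps)
        then have 1: "f x * (c * (s x * b x)) = (f x * sgn (f x)) * (2 powr (1 - p) * m x powr (p - 1)) * b x"
          by (simp add: s_def mult_ac)
        have "f x * sgn (f x) = \<bar>f x\<bar>" by (simp add: abs_sgn)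
        then show ?thesis unfolding 1 by (simp only: mult_ac)
      qed
      have le: "2 powr (1 - p) * w n x \<le> f x * (c * (s x * b x))" for x
      proof -
        have "m x powr p = m x * m x powr (p - 1)" using m(1)[of x] by (cases "m x = 0") (auto simp: powr_mult_base)
        then have "m x powr p \<le> \<bar>f x\<bar> * m x powr (p - 1)" using m(2)[of x] by (simp add: mult_right_mono)
        then show ?thesis unfolding eq w using b(2)[of x] by (intro mult_left_mono mult_right_mono) auto
      qed
      have i: "integrable lebesgue (\<lambda>x. f x * (c * (s x * b x)))"
      proof (rule Bochner_Integration.integrable_bound[of _ "\<lambda>x. c * (f x * b x)"])
        show "AE x in lebesgue. norm (f x * (c * (s x * b x))) \<le> norm (c * (f x * b x))"
        proof (rule AE_I2)
          fix x
          have "c * (\<bar>f x * b x\<bar> * \<bar>s x\<bar>) \<le> c * (\<bar>f x * b x\<bar> * 1)"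
            using c s1 by (intro mult_left_mono) auto
          then show "norm (f x * (c * (s x * b x))) \<le> norm (c * (f x * b x))"
            using c by (simp add: abs_mult mult_ac)
        qed
      qed (use ifb in auto)
      show ?thesis unfolding I_def
        using integral_mono[OF _ i le] iw by simp
    qed
    have upper: "(LINT x|lebesgue. f x * (c * (s x * b x))) \<le> M + 2 powr - p * I"
    proof (cases "p = 1")
      case True
      have "(LINT x|lebesgue. f x * (c * \<phi> k x)) \<le> M" for k
      proof -
        have "admissible p (\<phi> k)" using order_trans[OF \<phi>(2) b(3)] by (simp add: admissible_def)
        from dual_boundedD[OF dual \<phi>(1) this] show ?thesis
          using True c1 by (simp add: dual_gauge_def)
      qed
      then have "(LINT x|lebesgue. f x * (c * (s x * b x))) \<le> M" by (intro LIMSEQ_le_const2[OF l1]) auto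
      moreover have "I \<ge> 0" unfolding I_def using b(2) by (intro integral_nonneg_AE) (auto simp: w)
      ultimately show ?thesis by (simp add: add_increasing2)
    next
      case False
      then have p1: "p > 1" using p by simp
      define q where "q = p / (p - 1)"
      have q: "q > 1" "(p - 1) * q = p" using p1 by (auto simp: q_def)
      have bd: "(LINT x|lebesgue. f x * (c * \<phi> k x)) \<le> M + (LINT x|lebesgue. \<bar>c * \<phi> k x\<bar> powr q)" for k
        using dual_boundedD[OF dual Cc_inf_scale[OF \<phi>(1)[of k], of c]] False
        by (simp add: admissible_def dual_gauge_def q_def)
      (* The bump lies between 0 and 1, so its power with exponent \<open>q \<ge> 1\<close> is dominated by the bump itself. *)
      have pb: "b x powr q \<le> b x" for x using powr_mono'[of 1 q "b x"] b(2,3)[of x] q by simp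
      have l2: "(\<lambda>k. LINT x|lebesgue. \<bar>c * \<phi> k x\<bar> powr q) \<longlonglongrightarrow> (LINT x|lebesgue. \<bar>c * (s x * b x)\<bar> powr q)"
      proof (rule integral_dominated_convergence[where w="\<lambda>x. c powr q * b x"])
        show "integrable lebesgue (\<lambda>x. c powr q * b x)" using ib by auto
        show "AE x in lebesgue. (\<lambda>k. \<bar>c * \<phi> k x\<bar> powr q) \<longlonglongrightarrow> \<bar>c * (s x * b x)\<bar> powr q"
          using lim
        proof eventually_elim
          case (elim x)
          show ?case
            by (rule tendsto_powr2) (use q in \<open>auto intro!: tendsto_intros elim\<close>)
        qed
        show "AE x in lebesgue. norm (\<bar>c * \<phi> k x\<bar> powr q) \<le> c powr q * b x" for k
        proof (rule AE_I2)
          fix x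
          have "\<bar>c * \<phi> k x\<bar> powr q \<le> (c * b x) powr q"
            using \<phi>(2)[of k x] c q by (intro powr_mono2) (auto simp: abs_mult)
          also have "\<dots> = c powr q * b x powr q" using c b(2)[of x] by (simp add: powr_mult)
          also have "\<dots> \<le> c powr q * b x" using pb by (intro mult_left_mono) auto
          finally show "norm (\<bar>c * \<phi> k x\<bar> powr q) \<le> c powr q * b x" by simp
        qed
      qed measurable
      have "(LINT x|lebesgue. f x * (c * (s x * b x))) \<le> M + (LINT x|lebesgue. \<bar>c * (s x * b x)\<bar> powr q)"
        by (rule LIMSEQ_le[OF l1 tendsto_add[OF tendsto_const l2]]) (use bd in auto)
      also have "(LINT x|lebesgue. \<bar>c * (s x * b x)\<bar> powr q) \<le> (LINT x|lebesgue. 2 powr - p * w n x)"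
      proof (rule integral_mono)
        have le: "\<bar>c * (s x * b x)\<bar> powr q \<le> 2 powr - p * w n x" for x
        proof -
          have "\<bar>c * s x\<bar> \<le> (m x / 2) powr (p - 1)"
            using L m(1)[of x] by (auto simp: c_def s_def abs_mult sgn_if powr_mult[symmetric])
          then have "\<bar>c * s x\<bar> powr q \<le> ((m x / 2) powr (p - 1)) powr q"
            using q by (intro powr_mono2) auto
          also have "\<dots> = 2 powr - p * m x powr p"
            using m(1)[of x] by (simp add: powr_powr q powr_divide powr_minus_divide)
          finally have "\<bar>c * s x\<bar> powr q * b x powr q \<le> 2 powr - p * m x powr p * b x"
            using pb[of x] b(2)[of x] by (intro mult_mono) auto
          moreover have "\<bar>c * (s x * b x)\<bar> powr q = \<bar>c * s x\<bar> powr q * b x powr q"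
            using b(2)[of x] by (simp add: abs_mult powr_mult mult.assoc[symmetric])
          ultimately show ?thesis by (simp add: w mult.assoc)
        qed
        then show "\<And>x. \<bar>c * (s x * b x)\<bar> powr q \<le> 2 powr - p * w n x" .
        show i2: "integrable lebesgue (\<lambda>x. 2 powr - p * w n x)" using iw by auto
        show "integrable lebesgue (\<lambda>x. \<bar>c * (s x * b x)\<bar> powr q)"
          by (rule Bochner_Integration.integrable_bound[OF i2]) (auto intro!: AE_I2 order_trans[OF le abs_ge_self])
      qed
      finally show ?thesis by (simp add: I_def)
    qed
    (* Half of the left side absorbs the gauge. *)
    have "2 powr (1 - p) = 2 * 2 powr - p" by (simp add: powr_diff powr_minus_divide)
    then have "2 powr - p * I \<le> M" using lower upper by simp
    then have "2 powr p * (2 powr - p * I) \<le> 2 powr p * M" by (intro mult_left_mono) auto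
    moreover have "2 powr p * (2 powr - p * I) = I"
      by (simp only: mult.assoc[symmetric] powr_add[symmetric]) simp
    ultimately have "I \<le> 2 powr p * M" by simp
    moreover have "(\<integral>\<^sup>+x. ennreal (w n x) \<partial>lebesgue) = ennreal I"
      unfolding I_def by (rule nn_integral_eq_integral[OF iw]) (use b(2) in \<open>auto simp: w\<close>)
    ultimately show ?thesis by (simp add: ennreal_leI)
  qed
  have lim: "(\<lambda>n. w n x) \<longlonglongrightarrow> \<bar>f x\<bar> powr p" for x
  proof -
    have "\<forall>\<^sub>F n in sequentially. min \<bar>f x\<bar> (real (Suc n)) powr p = \<bar>f x\<bar> powr p"
    proof -
      obtain N where "\<bar>f x\<bar> \<le> real N" using real_arch_simple by blast
      then show ?thesis by (auto simp: eventually_sequentially intro!: exI[of _ N])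
    qed
    then have "(\<lambda>n. min \<bar>f x\<bar> (real (Suc n)) powr p) \<longlonglongrightarrow> \<bar>f x\<bar> powr p" by (rule tendsto_eventually)
    from tendsto_mult[OF this bump_tendsto_1[of x]] show ?thesis unfolding w_def mult_1_right .
  qed
  show ?thesis
    by (rule nn_integral_le_of_tendsto[where f = w, OF wm AE_I2[OF lim] main])
qed

section \<open>Quadratic bounds for second differences\<close>

text \<open>The property on which everything turns: both sides of the theorem are equivalent to a bound, uniform
in \<open>h\<close>, of the second difference quotients in \<open>L\<^sup>p\<close>. Unlike a bound
on derivatives, it can be stated for every function, and it can be averaged over \<open>h\<close>.\<close>

definition quadratic_diff_bounded :: "real \<Rightarrow> real \<Rightarrow> (real^'n::finite \<Rightarrow> real) \<Rightarrow> bool" where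
  "quadratic_diff_bounded p C u \<longleftrightarrow>
     (\<forall>h. h \<noteq> 0 \<longrightarrow> (\<integral>\<^sup>+x. ennreal (\<bar>second_diff h u x / (norm h)\<^sup>2\<bar> powr p) \<partial>lebesgue) \<le> ennreal C)"

lemma second_diff_Cc_inf:
  fixes \<phi> :: "real^'n::finite \<Rightarrow> real"
  assumes "\<phi> \<in> Cc_k k"
  shows "integrable lebesgue (second_diff h \<phi>)" "\<exists>B. \<forall>x. \<bar>second_diff h \<phi> x\<bar> \<le> B"
proof -
  show "integrable lebesgue (second_diff h \<phi>)"
    unfolding second_diff_def[abs_def]
    using integrable_shift[OF Cc_k_integrable[OF assms], of h] integrable_shift[OF Cc_k_integrable[OF assms], of "-h"]
      Cc_k_integrable[OF assms] by (auto intro!: Bochner_Integration.integrable_add Bochner_Integration.integrable_diff)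
  obtain B where B: "B \<ge> 0" "\<And>x. \<bar>\<phi> x\<bar> \<le> B" using Cc_k_bounded[OF assms] by metis
  have "\<bar>second_diff h \<phi> x\<bar> \<le> 4 * B" for x
    using B(2)[of "x + h"] B(2)[of x] B(2)[of "x - h"] unfolding second_diff_def by linarith
  then show "\<exists>B. \<forall>x. \<bar>second_diff h \<phi> x\<bar> \<le> B" by blast
qed

lemma integrable_Lp_second_diff_test:
  fixes u :: "real^'n::finite \<Rightarrow> real"
  assumes "p \<ge> 1" "u \<in> Lp p" "\<phi> \<in> Cc_k k"
  shows "integrable lebesgue (\<lambda>x. u x * second_diff h \<phi> x)"
  using Lp_mult_integrable(1)[OF assms(1,2) second_diff_Cc_inf(1)[OF assms(3)]] second_diff_Cc_inf(2)[OF assms(3)]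
  by metis

lemma second_diff_by_parts:
  fixes u :: "real^'n::finite \<Rightarrow> real"
  assumes "p \<ge> 1" "u \<in> Lp p" "\<phi> \<in> Cc_k k"
  shows "\<langle>second_diff h u, \<phi>\<rangle> = \<langle>u, second_diff h \<phi>\<rangle>"
proof -
  have i: "integrable lebesgue (\<lambda>x. u x * \<phi> x)" by (rule Lp_Cc_k_integrable[OF assms])
  have m: "u \<in> borel_measurable lebesgue" "\<phi> \<in> borel_measurable lebesgue"
    using assms Cc_k_measurable by (auto simp: Lp_real)
  obtain B where B: "\<And>x. \<bar>\<phi> x\<bar> \<le> B" using Cc_k_bounded[OF assms(3)] by metis
  have i1: "integrable lebesgue (\<lambda>x. u (x + a) * \<phi> x)" for a
    by (rule Lp_Cc_k_integrable[OF assms(1) Lp_shift[OF assms(2)] assms(3)])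
  have i2: "integrable lebesgue (\<lambda>x. u x * \<phi> (x + a))" for a
    by (rule Lp_mult_integrable(1)[OF assms(1,2) integrable_shift[OF Cc_k_integrable[OF assms(3)]] B])
  have t: "(LINT x|lebesgue. u (x + a) * \<phi> x) = (LINT x|lebesgue. u x * \<phi> (x + - a))" for a
    using integral_shift[of "\<lambda>x. u x * \<phi> (x + - a)" a] m measurable_shift[OF m(2), of "- a"] by simp
  have "\<langle>second_diff h u, \<phi>\<rangle> =
     (LINT x|lebesgue. u (x + h) * \<phi> x - 2 * (u x * \<phi> x) + u (x + - h) * \<phi> x)"
    by (simp add: second_diff_def algebra_simps)
  also have "\<dots> = (LINT x|lebesgue. u (x + h) * \<phi> x) - 2 * \<langle>u, \<phi>\<rangle> + (LINT x|lebesgue. u (x + - h) * \<phi> x)"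
    using i1[of h] i1[of "- h"] i
    by (subst Bochner_Integration.integral_add Bochner_Integration.integral_diff; simp)+
  also have "\<dots> = (LINT x|lebesgue. u x * \<phi> (x + - h)) - 2 * \<langle>u, \<phi>\<rangle> + (LINT x|lebesgue. u x * \<phi> (x + h))"
    using t[of h] t[of "- h"] by simp
  also have "\<dots> = (LINT x|lebesgue. u x * \<phi> (x + - h) - 2 * (u x * \<phi> x) + u x * \<phi> (x + h))"
    using i2[of h] i2[of "- h"] i
    by (subst Bochner_Integration.integral_add Bochner_Integration.integral_diff; simp)+
  also have "\<dots> = \<langle>u, second_diff h \<phi>\<rangle>"
    by (simp add: second_diff_def algebra_simps)
  finally show ?thesis .
qed

lemma second_diff_shift: "second_diff h (\<lambda>x. f (x + a)) x = second_diff h f (x + a)"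
  by (simp add: second_diff_def algebra_simps)

text \<open>A second difference is a sum of four second differences with half the step: three positions, the
middle one counted twice.\<close>

lemma second_diff_double:
  "second_diff (2 *\<^sub>R k) f x = second_diff k f (x + k) + 2 * second_diff k f x + second_diff k f (x - k)"
  by (simp add: second_diff_def scaleR_2 add.assoc diff_diff_eq)

text \<open>Halving the step replaces the second difference by four of half the step, by
\<open>second_diff_double\<close>.  The largest of the three pairings that occur is at least a quarter of
the total, and it is the one kept.  After \<open>m\<close> steps a single pairing with step
\<open>h / 2 ^ m\<close>, at a position within distance \<open>\<bar>h\<bar>\<close>, controls the original one.\<close>

lemma second_diff_descent:
  fixes u :: "real^'n::finite \<Rightarrow> real"
  assumes p: "p \<ge> 1" "u \<in> Lp p" and \<phi>: "\<phi> \<in> Cc_inf"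
  shows "\<exists>a. norm a \<le> norm h * (1 - (1/2) ^ m) \<and>
    \<langle>u, second_diff h \<phi>\<rangle> \<le>
    4 ^ m * (LINT x|lebesgue. u x * second_diff ((1/2) ^ m *\<^sub>R h) \<phi> (x + a))"
proof (induction m)
  case 0
  then show ?case by (auto intro: exI[of _ 0])
next
  case (Suc m)
  then obtain a where a: "norm a \<le> norm h * (1 - (1/2) ^ m)" and
    le: "\<langle>u, second_diff h \<phi>\<rangle> \<le>
    4 ^ m * (LINT x|lebesgue. u x * second_diff ((1/2) ^ m *\<^sub>R h) \<phi> (x + a))" by blast
  define k where "k = (1/2) ^ Suc m *\<^sub>R h"
  have k: "(1/2) ^ m *\<^sub>R h = 2 *\<^sub>R k" by (simp add: k_def)
  define E where "E b = (LINT x|lebesgue. u x * second_diff k \<phi> (x + b))" for b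
  have i: "integrable lebesgue (\<lambda>x. u x * second_diff k \<phi> (x + b))" for b
    using integrable_Lp_second_diff_test[OF p Cc_inf_Cc_k[OF Cc_inf_shift[OF \<phi>, of b]], of k]
    by (simp only: second_diff_shift)
  have "(LINT x|lebesgue. u x * second_diff ((1/2) ^ m *\<^sub>R h) \<phi> (x + a)) =
     (LINT x|lebesgue. u x * second_diff k \<phi> (x + (a + k)) + 2 * (u x * second_diff k \<phi> (x + a)) + u x * second_diff k \<phi> (x + (a - k)))"
    unfolding k second_diff_double by (simp only: distrib_left mult.left_commute[of _ 2] add.assoc add_diff_eq)
  also have "\<dots> = E (a + k) + 2 * E a + E (a - k)"
    unfolding E_def using i[of a] i[of "a + k"] i[of "a - k"]
    by (subst Bochner_Integration.integral_add; simp)+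
  finally have e: "(LINT x|lebesgue. u x * second_diff ((1/2) ^ m *\<^sub>R h) \<phi> (x + a)) = E (a + k) + 2 * E a + E (a - k)" .
  (* The weights are 1, 2, 1, so four times the largest of the three values is at least the sum. *)
  then obtain b where b: "b \<in> {0, k, - k}" and "E (a + k) + 2 * E a + E (a - k) \<le> 4 * E (a + b)"
  proof -
    have "E (a + k) + 2 * E a + E (a - k) \<le> 4 * E (a + 0) \<or> E (a + k) + 2 * E a + E (a - k) \<le> 4 * E (a + k)
      \<or> E (a + k) + 2 * E a + E (a - k) \<le> 4 * E (a + - k)"
      unfolding add_0_right add_uminus_conv_diff by linarith
    then show ?thesis using that by blast
  qed
  then have "4 ^ m * (LINT x|lebesgue. u x * second_diff ((1/2) ^ m *\<^sub>R h) \<phi> (x + a)) \<le> 4 ^ m * (4 * E (a + b))"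
    unfolding e by (intro mult_left_mono) auto
  from order_trans[OF le this] have 1: "\<langle>u, second_diff h \<phi>\<rangle> \<le> 4 ^ Suc m * E (a + b)"
    by (simp add: mult_ac)
  have "norm (a + b) \<le> norm a + norm b" by (rule norm_triangle_ineq)
  also have "norm b \<le> norm k" using b by auto
  also have "norm k = norm h * (1/2) ^ Suc m" by (simp add: k_def)
  finally have "norm (a + b) \<le> norm h * (1 - (1/2) ^ Suc m)" using a by (simp add: algebra_simps)
  then show ?case using 1 unfolding E_def k_def by blast
qed

text \<open>The descent leads to a step so small that the second difference of the test function is uniformly
close to its Hessian form, for which the hypothesis applies.  Nothing is lost on the way: the factor
\<open>4 ^ m\<close> is exactly compensated by the square of the step, and both the class of test functions
and the gauge are invariant under the translation by \<open>a\<close>.  In this way no derivative of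
\<open>u\<close> is ever needed, and the argument is the same for functions and for measures as second
derivatives.\<close>

lemma second_diff_dual_bound:
  fixes u :: "real^'n::finite \<Rightarrow> real"
  assumes p: "p \<ge> 1" "u \<in> Lp p" and M: "M \<ge> 0"
    and T: "\<And>k l. dual_bounded p M (\<lambda>\<phi>. \<langle>u, partial_deriv k (partial_deriv l \<phi>)\<rangle>)"
    and \<phi>: "\<phi> \<in> Cc_inf" "admissible p \<phi>"
  shows "\<langle>u, second_diff h \<phi>\<rangle> \<le> (real CARD('n))\<^sup>2 * (norm h)\<^sup>2 * (M + dual_gauge p \<phi>)"
proof (rule field_le_epsilon)
  fix \<epsilon> :: real assume \<epsilon>: "\<epsilon> > 0"
  have \<phi>2: "\<phi> \<in> Cc_k 2" by (rule Cc_inf_Cc_k[OF \<phi>(1)])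
  obtain R where R: "R > 0" "\<And>x. norm x > R \<Longrightarrow> \<phi> x = 0" using Cc_k_support[OF \<phi>2] by metis
  have pd: "partial_deriv k (partial_deriv l \<phi>) \<in> Cc_inf" for k l by (intro partial_deriv_Cc_inf \<phi>(1))
  (* A ball that contains the supports of all translates by \<open>a\<close> and by \<open>a \<plusminus> k\<close>. *)
  define R' where "R' = R + 2 * norm h"
  define U where "U = (LINT x|lebesgue. \<bar>u x * indicator (cball 0 R') x\<bar>)"
  have iU: "integrable lebesgue (\<lambda>x. \<bar>u x * indicator (cball 0 R') x\<bar>)"
    using Lp_locally_integrable[OF p, of R'] by auto
  have U: "U \<ge> 0" unfolding U_def by (intro integral_nonneg_AE) auto
  (* The accuracy for which the error, after multiplication by \<open>4 ^ m\<close>, is at most \<open>\<epsilon>\<close>. *)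
  define e where "e = \<epsilon> / ((norm h)\<^sup>2 * U + 1)"
  have e: "e > 0" using \<epsilon> U by (simp add: e_def add_nonneg_pos)
  obtain d where d: "d > 0" "\<And>h x. norm h \<le> d \<Longrightarrow> \<bar>second_diff h \<phi> x - hess_form \<phi> h x\<bar> \<le> e * (norm h)\<^sup>2"
    using second_diff_consistent[OF \<phi>2 e] by metis
  obtain m where m: "(1/2) ^ m * norm h \<le> d"
  proof -
    have "(\<lambda>m. (1/2) ^ m * norm h) \<longlonglongrightarrow> 0 * norm h" by (intro tendsto_intros LIMSEQ_power_zero) auto
    then have "\<forall>\<^sub>F m in sequentially. (1/2) ^ m * norm h < d" using d(1) by (intro order_tendstoD) auto
    then obtain m where "(1/2) ^ m * norm h < d" unfolding eventually_sequentially by blast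
    then show ?thesis by (intro that[of m]) simp
  qed
  obtain a where a: "norm a \<le> norm h * (1 - (1/2) ^ m)" and
    le: "\<langle>u, second_diff h \<phi>\<rangle> \<le>
      4 ^ m * (LINT x|lebesgue. u x * second_diff ((1/2) ^ m *\<^sub>R h) \<phi> (x + a))"
    using second_diff_descent[OF p \<phi>(1)] by blast
  define k where "k = (1/2) ^ m *\<^sub>R h"
  have k: "norm k \<le> d" "norm k \<le> norm h" "4 ^ m * (norm k)\<^sup>2 = (norm h)\<^sup>2"
  proof -
    have n: "norm k = (1/2) ^ m * norm h" by (simp add: k_def)
    show "norm k \<le> d" using m by (simp add: n)
    show "norm k \<le> norm h" unfolding n by (intro mult_left_le_one_le power_le_one) auto
    have "4 ^ m * ((1/2) ^ m)\<^sup>2 = (1::real)"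
      by (simp only: power2_eq_square power_mult_distrib[symmetric] mult.assoc[symmetric]) simp
    then show "4 ^ m * (norm k)\<^sup>2 = (norm h)\<^sup>2"
      unfolding n power_mult_distrib mult.assoc[symmetric] by simp
  qed
  have a': "norm a \<le> norm h" using a mult_left_mono[of "1 - (1/2) ^ m" 1 "norm h"] by simp
  define \<psi> where "\<psi> x = \<phi> (x + a)" for x
  have \<psi>: "\<psi> \<in> Cc_inf" "admissible p \<psi>" "dual_gauge p \<psi> = dual_gauge p \<phi>"
    unfolding \<psi>_def[abs_def] using Cc_inf_shift \<phi> admissible_shift dual_gauge_shift[OF \<phi>2] by blast+
  have pd\<psi>: "partial_deriv i (partial_deriv j \<psi>) x = partial_deriv i (partial_deriv j \<phi>) (x + a)" for i j x
    unfolding \<psi>_def[abs_def] using \<phi>(1) by (simp add: partial_deriv_shift partial_deriv_Cc_inf)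
  define t where "t i j = \<langle>u, partial_deriv i (partial_deriv j \<psi>)\<rangle>" for i j
  have it: "integrable lebesgue (\<lambda>x. u x * partial_deriv i (partial_deriv j \<psi>) x)" for i j
    by (rule Lp_Cc_k_integrable[OF p Cc_inf_Cc_k[of _ 0]]) (intro partial_deriv_Cc_inf \<psi>(1))
  have t: "\<bar>t i j\<bar> \<le> M + dual_gauge p \<phi>" for i j
    unfolding t_def \<psi>(3)[symmetric]
    by (rule dual_bounded_abs[OF T \<psi>(1,2)]) (simp add: partial_deriv_scale[OF \<psi>(1), of _ "-1", simplified]
        partial_deriv_scale[OF partial_deriv_Cc_inf[OF \<psi>(1)], of _ "-1", simplified])
  have ihf: "integrable lebesgue (\<lambda>x. u x * hess_form \<psi> k x)"
    and hf: "\<langle>u, hess_form \<psi> k\<rangle> = (\<Sum>i\<in>UNIV. \<Sum>j\<in>UNIV. k $ i * k $ j * t i j)"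
  proof -
    have eq: "u x * hess_form \<psi> k x = (\<Sum>i\<in>UNIV. \<Sum>j\<in>UNIV. k $ i * k $ j * (u x * partial_deriv i (partial_deriv j \<psi>) x))" for x
      by (simp add: hess_form_def sum_distrib_left mult_ac)
    show "integrable lebesgue (\<lambda>x. u x * hess_form \<psi> k x)" unfolding eq
      by (intro Bochner_Integration.integrable_sum integrable_mult_right it)
    show "\<langle>u, hess_form \<psi> k\<rangle> = (\<Sum>i\<in>UNIV. \<Sum>j\<in>UNIV. k $ i * k $ j * t i j)"
      unfolding eq t_def using it by (simp add: Bochner_Integration.integral_sum)
  qed
  have isd: "integrable lebesgue (\<lambda>x. u x * second_diff k \<psi> x)"
    by (rule integrable_Lp_second_diff_test[OF p Cc_inf_Cc_k[OF \<psi>(1), of 0]])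
  have "\<langle>u, second_diff k \<psi>\<rangle> - \<langle>u, hess_form \<psi> k\<rangle>
     = (LINT x|lebesgue. u x * second_diff k \<psi> x - u x * hess_form \<psi> k x)"
    using isd ihf by simp
  also have "\<dots> \<le> (LINT x|lebesgue. (e * (norm k)\<^sup>2) * \<bar>u x * indicator (cball 0 R') x\<bar>)"
  proof (rule integral_mono)
    fix x
    have sd: "second_diff k \<psi> x = second_diff k \<phi> (x + a)" by (simp add: \<psi>_def second_diff_def algebra_simps)
    have hd: "hess_form \<psi> k x = hess_form \<phi> k (x + a)" by (simp add: hess_form_def pd\<psi>)
    have "\<bar>second_diff k \<psi> x - hess_form \<psi> k x\<bar> \<le> (e * (norm k)\<^sup>2) * indicator (cball 0 R') x"
    proof (cases "norm x \<le> R'")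
      case True
      then show ?thesis using d(2)[OF k(1), of "x + a"] by (simp add: sd hd)
    next
      case False
      have "norm x \<le> norm (x + a) + norm a" using norm_triangle_ineq4[of "x + a" a] by simp
      moreover have "norm (x + a) \<le> norm (x + a + k) + norm k" "norm (x + a) \<le> norm (x + a - k) + norm k"
        using norm_triangle_ineq4[of "x + a + k" k] norm_triangle_ineq[of "x + a - k" k] by simp_all
      ultimately have "norm (x + a) > R" "norm (x + a + k) > R" "norm (x + a - k) > R"
        using False a' k(2) norm_ge_zero[of h] unfolding R'_def by linarith+
      then have "second_diff k \<phi> (x + a) = 0" "hess_form \<phi> k (x + a) = 0"
        using R hess_form_outside[OF R(2)] by (auto simp: second_diff_def)
      then show ?thesis by (simp add: sd hd indicator_def e less_imp_le)
    qed
    then have "\<bar>u x\<bar> * \<bar>second_diff k \<psi> x - hess_form \<psi> k x\<bar> \<le> \<bar>u x\<bar> * ((e * (norm k)\<^sup>2) * indicator (cball 0 R') x)"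
      by (intro mult_left_mono) auto
    then have "\<bar>u x * second_diff k \<psi> x - u x * hess_form \<psi> k x\<bar> \<le> (e * (norm k)\<^sup>2) * \<bar>u x * indicator (cball 0 R') x\<bar>"
      by (simp add: abs_mult right_diff_distrib[symmetric] mult_ac)
    then show "u x * second_diff k \<psi> x - u x * hess_form \<psi> k x \<le> (e * (norm k)\<^sup>2) * \<bar>u x * indicator (cball 0 R') x\<bar>"
      by linarith
  qed (use isd ihf iU in auto)
  also have "\<dots> = (e * (norm k)\<^sup>2) * U" by (simp add: U_def)
  finally have 1: "\<langle>u, second_diff k \<psi>\<rangle> \<le> (\<Sum>i\<in>UNIV. \<Sum>j\<in>UNIV. k $ i * k $ j * t i j) + e * (norm k)\<^sup>2 * U"
    unfolding hf by linarith
  have 2: "(\<Sum>i\<in>UNIV. \<Sum>j\<in>UNIV. k $ i * k $ j * t i j) \<le> (real CARD('n))\<^sup>2 * (norm k)\<^sup>2 * (M + dual_gauge p \<phi>)"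
    using quadratic_form_bound[of t "M + dual_gauge p \<phi>" k] t by (simp add: abs_le_iff)
  have "\<langle>u, second_diff h \<phi>\<rangle> \<le> 4 ^ m * \<langle>u, second_diff k \<psi>\<rangle>"
    using le by (simp add: k_def \<psi>_def second_diff_def algebra_simps)
  also have "\<dots> \<le> 4 ^ m * ((real CARD('n))\<^sup>2 * (norm k)\<^sup>2 * (M + dual_gauge p \<phi>) + e * (norm k)\<^sup>2 * U)"
    using 1 2 by (intro mult_left_mono) auto
  also have "\<dots> = (real CARD('n))\<^sup>2 * (4 ^ m * (norm k)\<^sup>2) * (M + dual_gauge p \<phi>) + e * ((4 ^ m * (norm k)\<^sup>2) * U)"
    by (simp add: algebra_simps)
  also have "\<dots> = (real CARD('n))\<^sup>2 * (norm h)\<^sup>2 * (M + dual_gauge p \<phi>) + e * ((norm h)\<^sup>2 * U)"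
    by (simp only: k(3))
  also have "e * ((norm h)\<^sup>2 * U) \<le> \<epsilon>"
  proof -
    have "e * ((norm h)\<^sup>2 * U) \<le> e * ((norm h)\<^sup>2 * U + 1)" using e by (intro mult_left_mono) auto
    also have "\<dots> = \<epsilon>" using U add_nonneg_pos[of "(norm h)\<^sup>2 * U" 1] by (simp add: e_def)
    finally show ?thesis .
  qed
  finally show "\<langle>u, second_diff h \<phi>\<rangle> \<le> (real CARD('n))\<^sup>2 * (norm h)\<^sup>2 * (M + dual_gauge p \<phi>) + \<epsilon>"
    by simp
qed

text \<open>The bound on pairings with test functions becomes one in \<open>L\<^sup>p\<close> by duality,
applied to the quotient of the second difference by \<open>K \<bar>h\<bar>\<^sup>2\<close>: with
this normalization the additive gauge appears with coefficient 1.\<close>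

lemma dual_bounded_hessian_imp_quadratic:
  fixes u :: "real^'n::finite \<Rightarrow> real"
  assumes p: "p \<ge> 1" "u \<in> Lp p" and M: "M \<ge> 0"
    and T: "\<And>k l. dual_bounded p M (\<lambda>\<phi>. \<langle>u, partial_deriv k (partial_deriv l \<phi>)\<rangle>)"
  shows "\<exists>C\<ge>0. quadratic_diff_bounded p C u"
proof -
  define K where "K = (real CARD('n))\<^sup>2"
  have K: "K > 0" by (simp add: K_def)
  have "(\<integral>\<^sup>+x. ennreal (\<bar>second_diff h u x / (norm h)\<^sup>2\<bar> powr p) \<partial>lebesgue) \<le> ennreal (K powr p * (2 powr p * M))"
    if h: "h \<noteq> 0" for h
  proof -
    define f where "f x = 1 / (K * (norm h)\<^sup>2) * second_diff h u x" for x
    have fL: "f \<in> Lp p" unfolding f_def[abs_def] by (intro Lp_cmult Lp_second_diff p)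
    have "dual_bounded p M (\<lambda>\<phi>. \<langle>f, \<phi>\<rangle>)"
    proof (rule dual_boundedI)
      fix \<phi> :: "real^'n \<Rightarrow> real" assume \<phi>: "\<phi> \<in> Cc_inf" "admissible p \<phi>"
      have "\<langle>f, \<phi>\<rangle> = 1 / (K * (norm h)\<^sup>2) * \<langle>second_diff h u, \<phi>\<rangle>"
        by (simp add: f_def mult.assoc)
      also have "\<dots> = 1 / (K * (norm h)\<^sup>2) * \<langle>u, second_diff h \<phi>\<rangle>"
        using second_diff_by_parts[OF p Cc_inf_Cc_k[OF \<phi>(1), of 0]] by simp
      also have "\<dots> \<le> 1 / (K * (norm h)\<^sup>2) * (K * (norm h)\<^sup>2 * (M + dual_gauge p \<phi>))"
        unfolding K_def using second_diff_dual_bound[OF p M T \<phi>] by (intro mult_left_mono) auto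
      also have "\<dots> = M + dual_gauge p \<phi>" using K h by simp
      finally show "\<langle>f, \<phi>\<rangle> \<le> M + dual_gauge p \<phi>" .
    qed
    then have b: "(\<integral>\<^sup>+x. ennreal (\<bar>f x\<bar> powr p) \<partial>lebesgue) \<le> ennreal (2 powr p * M)"
      using fL Lp_Cc_k_integrable[OF p(1) fL] Cc_inf_Cc_k
      by (intro dual_bounded_imp_nn_integral[OF p(1) _ _ M]) (auto simp: Lp_real)
    have "\<bar>second_diff h u x / (norm h)\<^sup>2\<bar> powr p = K powr p * \<bar>f x\<bar> powr p" for x
      using K h by (simp add: f_def powr_mult[symmetric] abs_mult)
    then have "(\<integral>\<^sup>+x. ennreal (\<bar>second_diff h u x / (norm h)\<^sup>2\<bar> powr p) \<partial>lebesgue) = ennreal (K powr p) * (\<integral>\<^sup>+x. ennreal (\<bar>f x\<bar> powr p) \<partial>lebesgue)"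
      using fL by (subst nn_integral_cmult[symmetric]) (auto simp: ennreal_mult Lp_real)
    also have "\<dots> \<le> ennreal (K powr p) * ennreal (2 powr p * M)" by (intro mult_left_mono b) auto
    also have "\<dots> = ennreal (K powr p * (2 powr p * M))" using M by (simp add: ennreal_mult)
    finally show ?thesis .
  qed
  then show ?thesis unfolding quadratic_diff_bounded_def using M
    by (intro exI[of _ "K powr p * (2 powr p * M)"]) auto
qed

section \<open>Minkowski's inequality and completeness of \<open>L\<^sup>p\<close>\<close>

lemma powr_convex_comb:
  fixes a b l p :: real
  assumes "p \<ge> 1" "0 \<le> l" "l \<le> 1" "a \<ge> 0" "b \<ge> 0"
  shows "(l * a + (1 - l) * b) powr p \<le> l * a powr p + (1 - l) * b powr p"
proof -
  have z: "(l * x) powr p \<le> l * x powr p" if "0 \<le> l" "l \<le> 1" "x \<ge> 0" for l x :: real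
  proof -
    have "l powr p \<le> l" using powr_mono'[of 1 p l] that assms(1) by (cases "l = 0") auto
    then show ?thesis using that by (simp add: powr_mult mult_right_mono)
  qed
  consider "a = 0" | "b = 0" | "a > 0" "b > 0" using assms by linarith
  then show ?thesis
  proof cases
    case 1 then show ?thesis using z[of "1 - l" b] assms by simp
  next
    case 2 then show ?thesis using z[of l a] assms by simp
  next
    case 3
    have "convex_on {0<..} (\<lambda>x::real. x powr p)" by (rule powr_convex) (use assms in simp)
    from convex_onD[OF this, of l b a] 3 assms show ?thesis
      by (simp add: algebra_simps)
  qed
qed

text \<open>Convexity of the power function, applied at each point to \<open>\<bar>f\<bar> / A\<close> and
\<open>\<bar>g\<bar> / B\<close> with the weights \<open>A / (A + B)\<close> and \<open>B / (A +
B)\<close>. Stating it with upper bounds \<open>A\<close> and \<open>B\<close> instead of norms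
avoids roots and the case of a vanishing norm.\<close>

lemma Lp_minkowski:
  fixes f g :: "real^'n::finite \<Rightarrow> real"
  assumes p: "p \<ge> 1" and f: "f \<in> Lp p" and g: "g \<in> Lp p" and A: "A > 0" and B: "B > 0"
    and fA: "Lp_mass p f \<le> A powr p" and gB: "Lp_mass p g \<le> B powr p"
  shows "(LINT x|lebesgue. \<bar>f x + g x\<bar> powr p) \<le> (A + B) powr p"
proof -
  define l where "l = A / (A + B)"
  have l: "0 \<le> l" "l \<le> 1" "1 - l = B / (A + B)" "l \<ge> 0" "1 - l \<ge> 0" using A B by (auto simp: l_def divide_simps)
  have i: "integrable lebesgue (\<lambda>x. \<bar>f x\<bar> powr p)" "integrable lebesgue (\<lambda>x. \<bar>g x\<bar> powr p)"
    using f g by (auto simp: Lp_real)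
  have le: "\<bar>f x + g x\<bar> powr p \<le> (A + B) powr p * (l * (\<bar>f x\<bar> powr p / A powr p) + (1 - l) * (\<bar>g x\<bar> powr p / B powr p))" for x
  proof -
    have "l * (\<bar>f x\<bar> / A) = \<bar>f x\<bar> / (A + B)" "(1 - l) * (\<bar>g x\<bar> / B) = \<bar>g x\<bar> / (A + B)"
      unfolding l(3) using A B by (simp_all add: l_def)
    then have "\<bar>f x\<bar> + \<bar>g x\<bar> = (A + B) * (l * (\<bar>f x\<bar> / A) + (1 - l) * (\<bar>g x\<bar> / B))"
      using A B by (simp add: add_divide_distrib[symmetric])
    moreover have "\<bar>f x + g x\<bar> powr p \<le> (\<bar>f x\<bar> + \<bar>g x\<bar>) powr p" using p by (intro powr_mono2) auto
    moreover have "l * (\<bar>f x\<bar> / A) + (1 - l) * (\<bar>g x\<bar> / B) \<ge> 0"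
      using A B l by (intro add_nonneg_nonneg mult_nonneg_nonneg) auto
    ultimately have "\<bar>f x + g x\<bar> powr p \<le> (A + B) powr p * (l * (\<bar>f x\<bar> / A) + (1 - l) * (\<bar>g x\<bar> / B)) powr p"
      using A B by (simp add: powr_mult)
    also have "\<dots> \<le> (A + B) powr p * (l * (\<bar>f x\<bar> / A) powr p + (1 - l) * (\<bar>g x\<bar> / B) powr p)"
      using l(1,2) A B p by (intro mult_left_mono powr_convex_comb) auto
    finally show ?thesis using A B by (simp add: powr_divide)
  qed
  have i2: "integrable lebesgue (\<lambda>x. (A + B) powr p * (l * (\<bar>f x\<bar> powr p / A powr p) + (1 - l) * (\<bar>g x\<bar> powr p / B powr p)))"
    using i by auto
  have "(LINT x|lebesgue. \<bar>f x + g x\<bar> powr p) \<le> (LINT x|lebesgue. (A + B) powr p * (l * (\<bar>f x\<bar> powr p / A powr p) + (1 - l) * (\<bar>g x\<bar> powr p / B powr p)))"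
    using Lp_add[OF p f g] i2 le by (intro integral_mono) (auto simp: Lp_real)
  also have "\<dots> = (A + B) powr p * (l * (Lp_mass p f / A powr p) + (1 - l) * (Lp_mass p g / B powr p))"
    using i by simp
  also have "\<dots> \<le> (A + B) powr p * (l * 1 + (1 - l) * 1)"
    using fA gB A B l by (intro mult_left_mono add_mono) (auto simp: divide_le_eq)
  finally show ?thesis by simp
qed

text \<open>The geometric sum would give \<open>2 (1/2) ^ n - 2 (1/2) ^ (n + m)\<close>, which is 0 for
\<open>m = 0\<close>; the coefficient 3 keeps the bound positive, as Minkowski's inequality requires above.\<close>

lemma Lp_geometric_telescope:
  fixes f :: "nat \<Rightarrow> real^'n::finite \<Rightarrow> real"
  assumes p: "p \<ge> 1" and f: "\<And>n. f n \<in> Lp p" and C: "C > 0"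
    and step: "\<And>k. (LINT x|lebesgue. \<bar>f (Suc k) x - f k x\<bar> powr p) \<le> (C * (1/2) ^ k) powr p"
  shows "(LINT x|lebesgue. \<bar>f (n + m) x - f n x\<bar> powr p) \<le> (C * (3 * (1/2) ^ n - 2 * (1/2) ^ (n + m))) powr p"
proof (induction m)
  case 0
  then show ?case using C by simp
next
  case (Suc m)
  have pos: "C * (3 * (1/2) ^ n - 2 * (1/2) ^ (n + m)) > 0"
  proof -
    have "(1/2::real) ^ (n + m) \<le> (1/2) ^ n" by (intro power_decreasing) auto
    moreover have "(0::real) < (1/2) ^ n" by simp
    ultimately have "(3 * (1/2) ^ n - 2 * (1/2) ^ (n + m)) > (0::real)" by linarith
    then show ?thesis using C by simp
  qed
  have "(LINT x|lebesgue. \<bar>(f (Suc (n + m)) x - f (n + m) x) + (f (n + m) x - f n x)\<bar> powr p)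
     \<le> (C * (1/2) ^ (n + m) + C * (3 * (1/2) ^ n - 2 * (1/2) ^ (n + m))) powr p"
    by (rule Lp_minkowski[OF p Lp_diff[OF p f f] Lp_diff[OF p f f] _ pos step Suc.IH]) (use C in auto)
  also have "C * (1/2) ^ (n + m) + C * (3 * (1/2) ^ n - 2 * (1/2) ^ (n + m)) = C * (3 * (1/2) ^ n - 2 * (1/2) ^ (n + Suc m))"
    by (simp add: algebra_simps)
  finally show ?case by simp
qed

text \<open>The Riesz-Fischer theorem. Along a fast subsequence, the integrals of \<open>(2 ^ k
\<bar>d\<^sub>k\<bar>) powr p\<close> for the increments \<open>d\<^sub>k\<close> are summable, so
almost everywhere the increments decay geometrically and the subsequence converges. Fatou's lemma
turns the limit at almost every point into one in \<open>L\<^sup>p\<close>.\<close>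

lemma Lp_complete:
  fixes f :: "nat \<Rightarrow> real^'n::finite \<Rightarrow> real"
  assumes p: "p \<ge> 1" and f: "\<And>n. f n \<in> Lp p"
    and cauchy: "\<And>e. e > 0 \<Longrightarrow> \<exists>N. \<forall>n\<ge>N. \<forall>m\<ge>N. (LINT x|lebesgue. \<bar>f n x - f m x\<bar> powr p) \<le> e"
  obtains g where "g \<in> Lp p" "(\<lambda>n. LINT x|lebesgue. \<bar>f n x - g x\<bar> powr p) \<longlonglongrightarrow> 0"
proof -
  have fm[measurable]: "f n \<in> borel_measurable lebesgue" for n using f by (auto simp: Lp_real)
  (* The first factor compensates the weight \<open>2 ^ k\<close> of the increment, the second makes the series converge. *)
  define e where "e k = ((1/2) ^ k) powr p * (1/2::real) ^ k" for k :: nat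
  have e: "e k > 0" for k by (simp add: e_def)
  obtain N0 where N0: "\<And>k n m. n \<ge> N0 k \<Longrightarrow> m \<ge> N0 k \<Longrightarrow> (LINT x|lebesgue. \<bar>f n x - f m x\<bar> powr p) \<le> e k"
    using cauchy[OF e] by metis
  (* Beyond the thresholds of all \<open>j \<le> k\<close>; the summand \<open>k\<close> makes the indices exceed every bound. *)
  define r where "r k = Max (N0 ` {..k}) + k" for k
  have rN: "r j \<ge> N0 k" if "j \<ge> k" for j k
  proof -
    have "N0 k \<le> Max (N0 ` {..j})" using that by (intro Max_ge) auto
    then show ?thesis by (simp add: r_def)
  qed
  define d where "d k x = f (r (Suc k)) x - f (r k) x" for k x
  have dm[measurable]: "d k \<in> borel_measurable lebesgue" for k unfolding d_def[abs_def] by measurable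
  have dL: "d k \<in> Lp p" for k unfolding d_def[abs_def] by (intro Lp_diff p f)
  define G where "G k x = (2 ^ k) powr p * \<bar>d k x\<bar> powr p" for k x
  have Gm[measurable]: "G k \<in> borel_measurable lebesgue" for k unfolding G_def[abs_def] by measurable
  have G: "(\<integral>\<^sup>+x. ennreal (G k x) \<partial>lebesgue) \<le> ennreal ((1/2) ^ k)" for k
  proof -
    have i: "integrable lebesgue (G k)" using dL[of k] unfolding G_def[abs_def] by (auto simp: Lp_real)
    have "(LINT x|lebesgue. G k x) = (2 ^ k) powr p * Lp_mass p (d k)" by (simp add: G_def)
    also have "\<dots> \<le> (2 ^ k) powr p * e k"
      unfolding d_def by (intro mult_left_mono N0 rN) auto
    also have "\<dots> = (1/2) ^ k" by (simp add: e_def mult.assoc[symmetric] powr_mult[symmetric] power_mult_distrib[symmetric])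
    finally have "(LINT x|lebesgue. G k x) \<le> (1/2) ^ k" .
    moreover have "(\<integral>\<^sup>+x. ennreal (G k x) \<partial>lebesgue) = ennreal (LINT x|lebesgue. G k x)"
      by (rule nn_integral_eq_integral[OF i]) (simp add: G_def)
    ultimately show ?thesis by (simp add: ennreal_leI)
  qed
  have "(\<integral>\<^sup>+x. (\<Sum>k. ennreal (G k x)) \<partial>lebesgue) = (\<Sum>k. \<integral>\<^sup>+x. ennreal (G k x) \<partial>lebesgue)"
    by (rule nn_integral_suminf) measurable
  also have "\<dots> \<le> (\<Sum>k. ennreal ((1/2) ^ k))" by (intro suminf_le G) auto
  also have "\<dots> = ennreal (\<Sum>k. (1/2) ^ k)" by (intro suminf_ennreal2 summable_geometric) auto
  finally have "(\<integral>\<^sup>+x. (\<Sum>k. ennreal (G k x)) \<partial>lebesgue) \<noteq> \<infinity>" by (auto simp: top_unique)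
  then have "AE x in lebesgue. (\<Sum>k. ennreal (G k x)) \<noteq> \<infinity>"
    by (intro nn_integral_noteq_infinite) auto
  then have conv: "AE x in lebesgue. convergent (\<lambda>k. f (r k) x)"
  proof eventually_elim
    case (elim x)
    define S where "S = enn2real (\<Sum>k. ennreal (G k x))"
    have "ennreal (G k x) \<le> ennreal S" for k
      using elim sum_le_suminf[of "\<lambda>k. ennreal (G k x)" "{k}"] by (simp add: S_def ennreal_enn2real top.not_eq_extremum)
    moreover have S: "S \<ge> 0" by (simp add: S_def)
    ultimately have GS: "G k x \<le> S" for k by simp
    have db: "norm (d k x) \<le> S powr (1/p) * (1/2) ^ k" for k
    proof -
      have "G k x = (2 ^ k * \<bar>d k x\<bar>) powr p" by (simp add: G_def powr_mult)
      then have "2 ^ k * \<bar>d k x\<bar> = (G k x) powr (1/p)" using p by (simp add: powr_powr)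
      also have "\<dots> \<le> S powr (1/p)" using GS p by (intro powr_mono2) (auto simp: G_def)
      finally show ?thesis by (simp add: power_one_over divide_simps mult.commute)
    qed
    have "summable (\<lambda>k. S powr (1/p) * (1/2::real) ^ k)" by (intro summable_mult summable_geometric) simp
    then have "summable (\<lambda>k. d k x)" by (rule summable_comparison_test'[where N=0]) (rule db)
    then have "convergent (\<lambda>n. \<Sum>k<n. d k x)" by (simp add: summable_iff_convergent)
    moreover have "(\<Sum>k<n. d k x) = f (r n) x - f (r 0) x" for n
      unfolding d_def by (rule sum_lessThan_telescope)
    ultimately have "convergent (\<lambda>n. f (r n) x - f (r 0) x)" by simp
    then show ?case using convergent_diff_const_right_iff by blast
  qed
  define g where "g x = lim (\<lambda>k. f (r k) x)" for x
  have gm[measurable]: "g \<in> borel_measurable lebesgue" unfolding g_def by measurable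
  have lim: "AE x in lebesgue. (\<lambda>k. f (r k) x) \<longlonglongrightarrow> g x"
    using conv by eventually_elim (simp add: g_def convergent_LIMSEQ_iff)
  have fatou: "\<exists>N. \<forall>n\<ge>N. (\<integral>\<^sup>+x. ennreal (\<bar>f n x - g x\<bar> powr p) \<partial>lebesgue) \<le> ennreal \<epsilon>" if "\<epsilon> > 0" for \<epsilon>
  proof -
    obtain N where N: "\<And>n m. n \<ge> N \<Longrightarrow> m \<ge> N \<Longrightarrow> (LINT x|lebesgue. \<bar>f n x - f m x\<bar> powr p) \<le> \<epsilon>"
      using cauchy[OF \<open>\<epsilon> > 0\<close>] by metis
    have "(\<integral>\<^sup>+x. ennreal (\<bar>f n x - g x\<bar> powr p) \<partial>lebesgue) \<le> ennreal \<epsilon>" if "n \<ge> N" for n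
    proof (rule nn_integral_le_of_tendsto[where f="\<lambda>k x. \<bar>f n x - f (r (k + N)) x\<bar> powr p"])
      show "AE x in lebesgue. (\<lambda>k. \<bar>f n x - f (r (k + N)) x\<bar> powr p) \<longlonglongrightarrow> \<bar>f n x - g x\<bar> powr p"
        using lim
      proof eventually_elim
        case (elim x)
        then have "(\<lambda>k. f (r (k + N)) x) \<longlonglongrightarrow> g x" by (rule LIMSEQ_ignore_initial_segment)
        then show ?case by (intro tendsto_powr2 tendsto_intros) (use p in auto)
      qed
      show "(\<integral>\<^sup>+x. ennreal (\<bar>f n x - f (r (k + N)) x\<bar> powr p) \<partial>lebesgue) \<le> ennreal \<epsilon>" for k
      proof -
        have i: "integrable lebesgue (\<lambda>x. \<bar>f n x - f (r (k + N)) x\<bar> powr p)"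
          using Lp_diff[OF p f f] by (auto simp: Lp_real)
        show ?thesis using nn_integral_eq_integral[OF i] N[OF that, of "r (k + N)"] by (simp add: r_def ennreal_leI)
      qed
    qed measurable
    then show ?thesis by blast
  qed
  have diffL: "(\<lambda>x. f n x - g x) \<in> Lp p" "(LINT x|lebesgue. \<bar>f n x - g x\<bar> powr p) \<le> \<epsilon>"
    if "(\<integral>\<^sup>+x. ennreal (\<bar>f n x - g x\<bar> powr p) \<partial>lebesgue) \<le> ennreal \<epsilon>" "\<epsilon> > 0" for n \<epsilon>
  proof -
    have "(\<integral>\<^sup>+x. ennreal (\<bar>f n x - g x\<bar> powr p) \<partial>lebesgue) < \<infinity>" using that(1) by (simp add: le_less_trans)
    then have i: "integrable lebesgue (\<lambda>x. \<bar>f n x - g x\<bar> powr p)"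
      by (intro integrableI_nonneg) auto
    then show "(\<lambda>x. f n x - g x) \<in> Lp p" by (simp add: Lp_real)
    show "(LINT x|lebesgue. \<bar>f n x - g x\<bar> powr p) \<le> \<epsilon>"
      using that nn_integral_eq_integral[OF i] by simp
  qed
  obtain N1 where "(\<integral>\<^sup>+x. ennreal (\<bar>f N1 x - g x\<bar> powr p) \<partial>lebesgue) \<le> ennreal 1" using fatou[of 1] by auto
  then have "(\<lambda>x. f N1 x - g x) \<in> Lp p" by (rule diffL) simp
  from Lp_diff[OF p f[of N1] this] have gL: "g \<in> Lp p" by simp
  have "(\<lambda>n. LINT x|lebesgue. \<bar>f n x - g x\<bar> powr p) \<longlonglongrightarrow> 0"
  proof (rule LIMSEQ_I)
    fix \<epsilon> :: real assume \<epsilon>: "\<epsilon> > 0"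
    then obtain N where N: "\<And>n. n \<ge> N \<Longrightarrow> (\<integral>\<^sup>+x. ennreal (\<bar>f n x - g x\<bar> powr p) \<partial>lebesgue) \<le> ennreal (\<epsilon>/2)"
      using fatou[of "\<epsilon>/2"] by auto
    have "(LINT x|lebesgue. \<bar>f n x - g x\<bar> powr p) \<le> \<epsilon>/2" if "n \<ge> N" for n
      using diffL(2)[OF N[OF that]] \<epsilon> by simp
    moreover have "(LINT x|lebesgue. \<bar>f n x - g x\<bar> powr p) \<ge> 0" for n by (intro integral_nonneg_AE) auto
    ultimately show "\<exists>N. \<forall>n\<ge>N. norm ((LINT x|lebesgue. \<bar>f n x - g x\<bar> powr p) - 0) < \<epsilon>"
      using \<epsilon> by (intro exI[of _ N]) force
  qed
  then show ?thesis using that gL by blast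
qed

text \<open>The test functions may vary with \<open>n\<close>.  The crude product bound of
\<open>Lp_mult_integrable\<close> contains a term that does not vanish with \<open>f n - g\<close>; applying it
to \<open>(f n - g) / \<delta>\<close> multiplies that term by \<open>\<delta>\<close>.\<close>

lemma Lp_tendsto_test:
  fixes f :: "nat \<Rightarrow> real^'n::finite \<Rightarrow> real"
  assumes p: "p \<ge> 1" and f: "\<And>n. f n \<in> Lp p" and g: "g \<in> Lp p"
    and lim: "(\<lambda>n. LINT x|lebesgue. \<bar>f n x - g x\<bar> powr p) \<longlonglongrightarrow> 0"
    and \<psi>: "\<And>n. integrable lebesgue (\<psi> n)" "\<And>n x. \<bar>\<psi> n x\<bar> \<le> B" "\<And>n. (LINT x|lebesgue. \<bar>\<psi> n x\<bar>) \<le> D"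
  shows "(\<lambda>n. \<langle>f n, \<psi> n\<rangle> - \<langle>g, \<psi> n\<rangle>) \<longlonglongrightarrow> 0"
proof (rule LIMSEQ_I)
  fix \<epsilon> :: real assume \<epsilon>: "\<epsilon> > 0"
  have "0 \<le> (LINT x|lebesgue. \<bar>\<psi> 0 x\<bar>)" by (intro integral_nonneg_AE) auto
  also note \<psi>(3)[of 0]
  finally have D: "D \<ge> 0" .
  have B: "B \<ge> 0" using \<psi>(2)[of 0 0] by linarith
  define \<delta> where "\<delta> = \<epsilon> / (2 * (D + 1))"
  have \<delta>: "\<delta> > 0" using \<epsilon> D by (simp add: \<delta>_def)
  define I where "I n = (LINT x|lebesgue. \<bar>f n x - g x\<bar> powr p)" for n
  have est: "\<bar>\<langle>f n, \<psi> n\<rangle> - \<langle>g, \<psi> n\<rangle>\<bar> \<le> \<delta> * (D + B * ((1/\<delta>) powr p * I n))" for n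
  proof -
    have L: "(\<lambda>x. (1/\<delta>) * (f n x - g x)) \<in> Lp p" by (intro Lp_cmult Lp_diff p f g)
    have i: "integrable lebesgue (\<lambda>x. f n x * \<psi> n x)" "integrable lebesgue (\<lambda>x. g x * \<psi> n x)"
      by (rule Lp_mult_integrable(1)[OF p _ \<psi>(1) \<psi>(2)], fact f g)+
    have "\<langle>f n, \<psi> n\<rangle> - \<langle>g, \<psi> n\<rangle> = (LINT x|lebesgue. f n x * \<psi> n x - g x * \<psi> n x)"
      using i by simp
    also have "\<dots> = (LINT x|lebesgue. \<delta> * ((1/\<delta>) * (f n x - g x) * \<psi> n x))" using \<delta> by (simp add: algebra_simps)
    also have "\<bar>\<dots>\<bar> = \<delta> * \<bar>LINT x|lebesgue. (1/\<delta>) * (f n x - g x) * \<psi> n x\<bar>" using \<delta> by (simp only: integral_mult_right_zero abs_mult abs_of_pos)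
    also have "\<dots> \<le> \<delta> * (LINT x|lebesgue. \<bar>(1/\<delta>) * (f n x - g x) * \<psi> n x\<bar>)"
      using \<delta> by (intro mult_left_mono integral_abs_bound) auto
    also have "\<dots> \<le> \<delta> * ((LINT x|lebesgue. \<bar>\<psi> n x\<bar>) + B * (LINT x|lebesgue. \<bar>(1/\<delta>) * (f n x - g x)\<bar> powr p))"
      using \<delta> by (intro mult_left_mono Lp_mult_integrable(2)[OF p L \<psi>(1) \<psi>(2)]) auto
    also have "(LINT x|lebesgue. \<bar>(1/\<delta>) * (f n x - g x)\<bar> powr p) = (1/\<delta>) powr p * I n"
      using \<delta> unfolding I_def abs_mult by (subst powr_mult) (auto simp del: powr_divide)
    also have "\<delta> * ((LINT x|lebesgue. \<bar>\<psi> n x\<bar>) + B * ((1/\<delta>) powr p * I n)) \<le> \<delta> * (D + B * ((1/\<delta>) powr p * I n))"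
      using \<delta> \<psi>(3) by (intro mult_left_mono add_right_mono) auto
    finally show ?thesis .
  qed
  have "(\<lambda>n. \<delta> * (D + B * ((1/\<delta>) powr p * I n))) \<longlonglongrightarrow> \<delta> * (D + B * ((1/\<delta>) powr p * 0))"
    using lim unfolding I_def by (intro tendsto_intros)
  moreover have "\<delta> * (D + B * ((1/\<delta>) powr p * 0)) < \<epsilon>"
  proof -
    have "D + 1 \<noteq> 0" using D by simp
    then have "\<delta> * (D + 1) = \<epsilon> / 2"
      unfolding \<delta>_def times_divide_eq_left by (rule mult_divide_mult_cancel_right)
    then have "\<delta> * D + \<delta> = \<epsilon> / 2" by (simp add: distrib_left)
    then show ?thesis using \<delta> \<epsilon> by simp
  qed
  ultimately have "\<forall>\<^sub>F n in sequentially. \<delta> * (D + B * ((1/\<delta>) powr p * I n)) < \<epsilon>" by (rule order_tendstoD)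
  then obtain N where "\<And>n. n \<ge> N \<Longrightarrow> \<delta> * (D + B * ((1/\<delta>) powr p * I n)) < \<epsilon>" unfolding eventually_sequentially by blast
  then show "\<exists>N. \<forall>n\<ge>N. norm (\<langle>f n, \<psi> n\<rangle> - \<langle>g, \<psi> n\<rangle> - 0) < \<epsilon>"
    using est by (intro exI[of _ N]) (auto intro: le_less_trans)
qed

section \<open>Weak first derivatives\<close>

lemma scaled_second_diff_Lp:
  fixes u :: "real^'n::finite \<Rightarrow> real"
  assumes p: "p \<ge> 1" "u \<in> Lp p" and C: "C \<ge> 0" and q: "quadratic_diff_bounded p C u"
  shows "(\<lambda>x. 1 / (norm h)\<^sup>2 * second_diff h u x) \<in> Lp p"
    "(LINT x|lebesgue. \<bar>1 / (norm h)\<^sup>2 * second_diff h u x\<bar> powr p) \<le> C"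
proof -
  show L: "(\<lambda>x. 1 / (norm h)\<^sup>2 * second_diff h u x) \<in> Lp p" by (intro Lp_cmult Lp_second_diff p)
  show "(LINT x|lebesgue. \<bar>1 / (norm h)\<^sup>2 * second_diff h u x\<bar> powr p) \<le> C"
  proof (cases "h = 0")
    case False
    have i: "integrable lebesgue (\<lambda>x. \<bar>1 / (norm h)\<^sup>2 * second_diff h u x\<bar> powr p)" using L by (simp only: Lp_real)
    have "(\<integral>\<^sup>+x. ennreal (\<bar>1 / (norm h)\<^sup>2 * second_diff h u x\<bar> powr p) \<partial>lebesgue) \<le> ennreal C"
      using q False unfolding quadratic_diff_bounded_def by simp
    then show ?thesis using nn_integral_eq_integral[OF i] C by simp
  qed (use C in simp)
qed

lemma quadratic_diff_bounded_second_diff: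
  fixes u :: "real^'n::finite \<Rightarrow> real"
  assumes p: "p \<ge> 1" "u \<in> Lp p" and C: "C \<ge> 0" and q: "quadratic_diff_bounded p C u"
  shows "Lp_mass p (second_diff h u) \<le> C * ((norm h)\<^sup>2) powr p"
proof (cases "h = 0")
  case True
  then show ?thesis by (simp add: second_diff_def)
next
  case False
  have "Lp_mass p (second_diff h u) = (LINT x|lebesgue. ((norm h)\<^sup>2) powr p * \<bar>1 / (norm h)\<^sup>2 * second_diff h u x\<bar> powr p)"
    using False by (simp add: powr_mult[symmetric])
  also have "\<dots> = ((norm h)\<^sup>2) powr p * (LINT x|lebesgue. \<bar>1 / (norm h)\<^sup>2 * second_diff h u x\<bar> powr p)" by simp
  also have "\<dots> \<le> ((norm h)\<^sup>2) powr p * C" by (intro mult_left_mono scaled_second_diff_Lp[OF p C q]) auto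
  finally show ?thesis by (simp add: mult.commute)
qed

text \<open>The polarization identity, taken at the centre of the parallelogram spanned by \<open>a\<close> and
\<open>b\<close>: its two diagonals carry the two second differences.\<close>

lemma mixed_diff_polarization:
  "mixed_diff a b u x = second_diff ((1/2) *\<^sub>R (a + b)) u (x + (1/2) *\<^sub>R (a + b))
     - second_diff ((1/2) *\<^sub>R (a - b)) u (x + (1/2) *\<^sub>R (a + b))"
proof -
  have h: "(1/2) *\<^sub>R y + (1/2) *\<^sub>R y = y" for y :: 'a by (simp flip: scaleR_add_left)
  have 1: "x + (1/2) *\<^sub>R (a + b) + (1/2) *\<^sub>R (a + b) = x + a + b" by (simp only: add.assoc h)
  have 2: "x + (1/2) *\<^sub>R (a + b) + (1/2) *\<^sub>R (a - b) = x + a"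
    using h[of a] by (simp add: scaleR_add_right scaleR_diff_right)
  have 3: "x + (1/2) *\<^sub>R (a + b) - (1/2) *\<^sub>R (a - b) = x + b"
    using h[of b] by (simp add: scaleR_add_right scaleR_diff_right)
  show ?thesis unfolding second_diff_def mixed_diff_def 1 2 3 by simp
qed

lemma Lp_mixed_diff:
  fixes u :: "real^'n::finite \<Rightarrow> real"
  assumes p: "p \<ge> 1" "u \<in> Lp p"
  shows "mixed_diff a b u \<in> Lp p"
  unfolding mixed_diff_def[abs_def] add.assoc
  by (intro Lp_add Lp_diff Lp_shift p)

lemma mixed_diff_Lp_bound:
  fixes u :: "real^'n::finite \<Rightarrow> real"
  assumes p: "p \<ge> 1" "u \<in> Lp p" and C: "C \<ge> 0" and q: "quadratic_diff_bounded p C u"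
    and ab: "norm a \<le> s" "norm b \<le> s"
  shows "Lp_mass p (mixed_diff a b u) \<le> 2 powr p * (2 * C) * (s\<^sup>2) powr p"
proof -
  define c where "c = (1/2) *\<^sub>R (a + b)"
  define d where "d = (1/2) *\<^sub>R (a - b)"
  have "norm (a + b) \<le> 2 * s" "norm (a - b) \<le> 2 * s"
    using ab norm_triangle_ineq[of a b] norm_triangle_ineq4[of a b] by linarith+
  then have cd: "norm c \<le> s" "norm d \<le> s" by (auto simp: c_def d_def)
  have sd: "(LINT x|lebesgue. \<bar>second_diff h u (x + c)\<bar> powr p) \<le> C * (s\<^sup>2) powr p" if "norm h \<le> s" for h
  proof -
    have "second_diff h u \<in> borel_measurable lebesgue" using Lp_second_diff[OF p, of h] by (simp add: Lp_real)
    then have "(LINT x|lebesgue. \<bar>second_diff h u (x + c)\<bar> powr p) = Lp_mass p (second_diff h u)"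
      by (intro integral_shift[of "\<lambda>x. \<bar>second_diff h u x\<bar> powr p"]) auto
    also have "\<dots> \<le> C * ((norm h)\<^sup>2) powr p" by (rule quadratic_diff_bounded_second_diff[OF p C q])
    also have "\<dots> \<le> C * (s\<^sup>2) powr p" using that C p by (intro mult_left_mono powr_mono2 power_mono) auto
    finally show ?thesis .
  qed
  have i: "integrable lebesgue (\<lambda>x. \<bar>second_diff h u (x + c)\<bar> powr p)" for h
    using Lp_shift[OF Lp_second_diff[OF p, of h], of c] by (simp add: Lp_real)
  have "Lp_mass p (mixed_diff a b u)
    \<le> (LINT x|lebesgue. 2 powr p * (\<bar>second_diff c u (x + c)\<bar> powr p + \<bar>second_diff d u (x + c)\<bar> powr p))"
  proof (rule integral_mono)
    show "\<bar>mixed_diff a b u x\<bar> powr p \<le> 2 powr p * (\<bar>second_diff c u (x + c)\<bar> powr p + \<bar>second_diff d u (x + c)\<bar> powr p)" for x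
      using powr_add_le[OF p(1), of "second_diff c u (x + c)" "- second_diff d u (x + c)"]
      by (simp add: mixed_diff_polarization c_def d_def)
  qed (use Lp_mixed_diff[OF p, of a b] i in \<open>auto simp: Lp_real\<close>)
  also have "\<dots> = 2 powr p * ((LINT x|lebesgue. \<bar>second_diff c u (x + c)\<bar> powr p) + (LINT x|lebesgue. \<bar>second_diff d u (x + c)\<bar> powr p))"
    using i by simp
  also have "\<dots> \<le> 2 powr p * (C * (s\<^sup>2) powr p + C * (s\<^sup>2) powr p)"
    by (intro mult_left_mono add_mono sd cd) auto
  finally show ?thesis by (simp add: algebra_simps)
qed

lemma Lp_test_dominated:
  fixes u :: "real^'n::finite \<Rightarrow> real"
  assumes p: "p \<ge> 1" "u \<in> Lp p" and m: "\<And>n. \<psi> n \<in> borel_measurable lebesgue" "\<psi>0 \<in> borel_measurable lebesgue"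
    and B: "\<And>n x. \<bar>\<psi> n x\<bar> \<le> B" and R: "\<And>n x. norm x > R \<Longrightarrow> \<psi> n x = 0"
    and lim: "\<And>x. (\<lambda>n. \<psi> n x) \<longlonglongrightarrow> \<psi>0 x"
  shows "(\<lambda>n::nat. \<langle>u, \<psi> n\<rangle>) \<longlonglongrightarrow> \<langle>u, \<psi>0\<rangle>"
proof (rule integral_dominated_convergence[where w="\<lambda>x. B * \<bar>u x * indicator (cball 0 R) x\<bar>"])
  show "integrable lebesgue (\<lambda>x. B * \<bar>u x * indicator (cball 0 R) x\<bar>)"
    using Lp_locally_integrable[OF p, of R] by auto
  show "AE x in lebesgue. norm (u x * \<psi> n x) \<le> B * \<bar>u x * indicator (cball 0 R) x\<bar>" for n
  proof (rule AE_I2)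
    fix x
    have "\<bar>u x\<bar> * \<bar>\<psi> n x\<bar> \<le> \<bar>u x\<bar> * B" using B by (intro mult_left_mono) auto
    then show "norm (u x * \<psi> n x) \<le> B * \<bar>u x * indicator (cball 0 R) x\<bar>"
      using R[of x n] by (cases "norm x > R") (auto simp: abs_mult mult.commute)
  qed
qed (use m p lim in \<open>auto simp: Lp_real intro!: tendsto_intros\<close>)

text \<open>By the mean value theorem the difference quotients of a test function are values of its derivative
at nearby points. This gives, for step sizes at most 1, a common bound, a common support and the
limit: the hypotheses of dominated convergence.\<close>

lemma diff_quotient_facts:
  fixes \<phi> :: "real^'n::finite \<Rightarrow> real"
  assumes \<phi>: "\<phi> \<in> Cc_k 1" and s: "\<And>n. s n \<noteq> 0" "\<And>n. \<bar>s n\<bar> \<le> 1" "s \<longlonglongrightarrow> (0::real)"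
  obtains B R where "R > 0" "\<And>n x. \<bar>(\<phi> (x + axis i (s n)) - \<phi> x) / s n\<bar> \<le> B"
    "\<And>n x. norm x > R \<Longrightarrow> (\<phi> (x + axis i (s n)) - \<phi> x) / s n = 0"
    "\<And>x. (\<lambda>n::nat. (\<phi> (x + axis i (s n)) - \<phi> x) / s n) \<longlonglongrightarrow> partial_deriv i \<phi> x"
proof -
  have c: "partial_deriv i \<phi> \<in> Cc_k 0" using \<phi> by (intro partial_deriv_Cc_k) simp
  obtain B where B: "\<And>x. \<bar>partial_deriv i \<phi> x\<bar> \<le> B" using Cc_k_bounded[OF c] by metis
  obtain R where R: "R > 0" "\<And>x. norm x > R \<Longrightarrow> \<phi> x = 0" using Cc_k_support[OF \<phi>] by metis
  have C1: "C_k 1 \<phi>" using \<phi> by (simp only: Cc_k_def) simp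
  have ex: "\<exists>y. norm (y - x) \<le> \<bar>s n\<bar> \<and> (\<phi> (x + axis i (s n)) - \<phi> x) / s n = partial_deriv i \<phi> y" for n x
    by (rule first_diff_mvt[OF C1, of x "s n" i]) (use s(1)[of n] in auto)
  have 1: "\<bar>(\<phi> (x + axis i (s n)) - \<phi> x) / s n\<bar> \<le> B" for n x
    using ex[of x n] B by metis
  have 2: "(\<phi> (x + axis i (s n)) - \<phi> x) / s n = 0" if "norm x > R + 1" for n x
  proof -
    have "norm x \<le> norm (x + axis i (s n)) + norm (axis i (s n) :: real^'n)" using norm_triangle_ineq4[of "x + axis i (s n)" "axis i (s n)"] by simp
    then have "norm (x + axis i (s n)) > R" using that s(2)[of n] by simp
    then show ?thesis using R(2) that by simp
  qed
  have 3: "(\<lambda>n. (\<phi> (x + axis i (s n)) - \<phi> x) / s n) \<longlonglongrightarrow> partial_deriv i \<phi> x" for x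
  proof -
    obtain y where y: "\<And>n. norm (y n - x) \<le> \<bar>s n\<bar>" "\<And>n. (\<phi> (x + axis i (s n)) - \<phi> x) / s n = partial_deriv i \<phi> (y n)"
      using ex[of x] by metis
    have "(\<lambda>n. y n - x) \<longlonglongrightarrow> 0"
      by (rule Lim_null_comparison[of _ "\<lambda>n. \<bar>s n\<bar>"]) (use y s(3) in \<open>auto intro: tendsto_rabs_zero\<close>)
    then have "y \<longlonglongrightarrow> x" by (rule LIM_zero_cancel)
    moreover have "isCont (partial_deriv i \<phi>) x"
      using Cc_k_continuous[OF c, of UNIV] by (simp add: continuous_on_eq_continuous_at)
    ultimately have "(\<lambda>n. partial_deriv i \<phi> (y n)) \<longlonglongrightarrow> partial_deriv i \<phi> x"
      by (rule isCont_tendsto_compose[rotated])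
    then show ?thesis unfolding y(2) .
  qed
  show ?thesis by (rule that[OF _ 1 2 3]) (use R in auto)
qed

lemma mixed_quotient_facts:
  fixes \<phi> :: "real^'n::finite \<Rightarrow> real"
  assumes \<phi>: "\<phi> \<in> Cc_k 2" and s: "\<And>n. s n \<noteq> 0" "\<And>n. \<bar>s n\<bar> \<le> 1" "s \<longlonglongrightarrow> (0::real)"
  obtains B R where "R > 0" "\<And>n x. \<bar>mixed_diff (axis i (s n)) (axis j (s n)) \<phi> x / (s n)\<^sup>2\<bar> \<le> B"
    "\<And>n x. norm x > R \<Longrightarrow> mixed_diff (axis i (s n)) (axis j (s n)) \<phi> x / (s n)\<^sup>2 = 0"
    "\<And>x. (\<lambda>n::nat. mixed_diff (axis i (s n)) (axis j (s n)) \<phi> x / (s n)\<^sup>2) \<longlonglongrightarrow> partial_deriv j (partial_deriv i \<phi>) x"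
proof -
  have c: "partial_deriv j (partial_deriv i \<phi>) \<in> Cc_k 0" using \<phi> by (intro partial_deriv_Cc_k) (simp add: numeral_2_eq_2)
  obtain B where B: "\<And>x. \<bar>partial_deriv j (partial_deriv i \<phi>) x\<bar> \<le> B" using Cc_k_bounded[OF c] by metis
  obtain R where R: "R > 0" "\<And>x. norm x > R \<Longrightarrow> \<phi> x = 0" using Cc_k_support[OF \<phi>] by metis
  have C2: "C_k 2 \<phi>" using \<phi> by (simp only: Cc_k_def) simp
  have ex: "\<exists>y. norm (y - x) \<le> 2 * \<bar>s n\<bar> \<and> mixed_diff (axis i (s n)) (axis j (s n)) \<phi> x / (s n)\<^sup>2 = partial_deriv j (partial_deriv i \<phi>) y" for n x
    by (rule mixed_diff_mvt[OF C2, of x "s n" i j]) (use s(1)[of n] in auto)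
  have 1: "\<bar>mixed_diff (axis i (s n)) (axis j (s n)) \<phi> x / (s n)\<^sup>2\<bar> \<le> B" for n x
    using ex[of x n] B by metis
  have 2: "mixed_diff (axis i (s n)) (axis j (s n)) \<phi> x / (s n)\<^sup>2 = 0" if "norm x > R + 2" for n x
  proof -
    have *: "norm x \<le> norm (x + a) + norm a" for a :: "real^'n" using norm_triangle_ineq4[of "x + a" a] by simp
    have "norm (axis i (s n) + axis j (s n) :: real^'n) \<le> 2" using norm_triangle_ineq[of "axis i (s n) :: real^'n" "axis j (s n)"] s(2)[of n] by simp
    then have "norm (x + (axis i (s n) + axis j (s n))) > R" "norm (x + axis i (s n)) > R" "norm (x + axis j (s n)) > R"
      using that s(2)[of n] *[of "axis i (s n)"] *[of "axis j (s n)"] *[of "axis i (s n) + axis j (s n)"] by simp_all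
    then show ?thesis using R that by (simp add: mixed_diff_def add.assoc)
  qed
  have 3: "(\<lambda>n. mixed_diff (axis i (s n)) (axis j (s n)) \<phi> x / (s n)\<^sup>2) \<longlonglongrightarrow> partial_deriv j (partial_deriv i \<phi>) x" for x
  proof -
    obtain y where y: "\<And>n. norm (y n - x) \<le> 2 * \<bar>s n\<bar>" "\<And>n. mixed_diff (axis i (s n)) (axis j (s n)) \<phi> x / (s n)\<^sup>2 = partial_deriv j (partial_deriv i \<phi>) (y n)"
      using ex[of x] by metis
    have "(\<lambda>n. y n - x) \<longlonglongrightarrow> 0"
      by (rule Lim_null_comparison[of _ "\<lambda>n. 2 * \<bar>s n\<bar>"]) (use y s(3) in \<open>auto intro: tendsto_mult_right_zero tendsto_rabs_zero\<close>)
    then have "y \<longlonglongrightarrow> x" by (rule LIM_zero_cancel)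
    moreover have "isCont (partial_deriv j (partial_deriv i \<phi>)) x"
      using Cc_k_continuous[OF c, of UNIV] by (simp add: continuous_on_eq_continuous_at)
    ultimately have "(\<lambda>n. partial_deriv j (partial_deriv i \<phi>) (y n)) \<longlonglongrightarrow> partial_deriv j (partial_deriv i \<phi>) x"
      by (rule isCont_tendsto_compose[rotated])
    then show ?thesis unfolding y(2) .
  qed
  show ?thesis by (rule that[OF _ 1 2 3]) (use R in auto)
qed

lemma integral_shift_test:
  fixes u \<phi> :: "real^'n::finite \<Rightarrow> real"
  assumes "u \<in> borel_measurable lebesgue" "\<phi> \<in> borel_measurable lebesgue"
  shows "(LINT x|lebesgue. u (x + a) * \<phi> x) = (LINT x|lebesgue. u x * \<phi> (x + - a))"
  using integral_shift[of "\<lambda>x. u x * \<phi> (x + - a)" a] assms measurable_shift[OF assms(2), of "- a"] by simp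

lemma integrable_shift_test:
  fixes u \<phi> :: "real^'n::finite \<Rightarrow> real"
  assumes "p \<ge> 1" "u \<in> Lp p" "\<phi> \<in> Cc_k k"
  shows "integrable lebesgue (\<lambda>x. u x * \<phi> (x + a))" "integrable lebesgue (\<lambda>x. u (x + a) * \<phi> x)"
proof -
  obtain B where B: "\<And>x. \<bar>\<phi> x\<bar> \<le> B" using Cc_k_bounded[OF assms(3)] by metis
  show "integrable lebesgue (\<lambda>x. u x * \<phi> (x + a))"
    by (rule Lp_mult_integrable(1)[OF assms(1,2) integrable_shift[OF Cc_k_integrable[OF assms(3)]] B])
  show "integrable lebesgue (\<lambda>x. u (x + a) * \<phi> x)"
    by (rule Lp_Cc_k_integrable[OF assms(1) Lp_shift[OF assms(2)] assms(3)])
qed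

lemma first_diff_by_parts:
  fixes u \<phi> :: "real^'n::finite \<Rightarrow> real"
  assumes "p \<ge> 1" "u \<in> Lp p" "\<phi> \<in> Cc_k k"
  shows "(LINT x|lebesgue. (u (x + a) - u x) / s * \<phi> x) = (LINT x|lebesgue. u x * ((\<phi> (x + - a) - \<phi> x) / s))"
proof -
  have m: "u \<in> borel_measurable lebesgue" "\<phi> \<in> borel_measurable lebesgue"
    using assms Cc_k_measurable by (auto simp: Lp_real)
  note i = integrable_shift_test[OF assms]
  have "(LINT x|lebesgue. (u (x + a) - u x) / s * \<phi> x) = (LINT x|lebesgue. (u (x + a) * \<phi> x - u x * \<phi> x) / s)"
    by (simp add: left_diff_distrib diff_divide_distrib)
  also have "\<dots> = ((LINT x|lebesgue. u (x + a) * \<phi> x) - \<langle>u, \<phi>\<rangle>) / s"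
    using i(2)[of a] i(2)[of 0] by simp
  also have "\<dots> = ((LINT x|lebesgue. u x * \<phi> (x + - a)) - \<langle>u, \<phi>\<rangle>) / s"
    using integral_shift_test[OF m] by simp
  also have "\<dots> = (LINT x|lebesgue. (u x * \<phi> (x + - a) - u x * \<phi> x) / s)"
    using i(1)[of "- a"] i(1)[of 0] by simp
  also have "\<dots> = (LINT x|lebesgue. u x * ((\<phi> (x + - a) - \<phi> x) / s))"
    by (simp add: right_diff_distrib diff_divide_distrib)
  finally show ?thesis .
qed

lemma mixed_diff_by_parts:
  fixes u \<phi> :: "real^'n::finite \<Rightarrow> real"
  assumes "p \<ge> 1" "u \<in> Lp p" "\<phi> \<in> Cc_k k"
  shows "\<langle>mixed_diff a b u, \<phi>\<rangle> = (LINT x|lebesgue. u x * mixed_diff (- a) (- b) \<phi> x)"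
proof -
  have m: "u \<in> borel_measurable lebesgue" "\<phi> \<in> borel_measurable lebesgue"
    using assms Cc_k_measurable by (auto simp: Lp_real)
  note i = integrable_shift_test[OF assms]
  have e: "x + a + b = x + (a + b)" "x + - a + - b = x + - (a + b)" for x :: "real^'n" by (simp_all add: add.assoc)
  have "\<langle>mixed_diff a b u, \<phi>\<rangle> =
     (LINT x|lebesgue. u (x + (a + b)) * \<phi> x - u (x + a) * \<phi> x - u (x + b) * \<phi> x + u (x + 0) * \<phi> x)"
    by (simp add: mixed_diff_def e algebra_simps)
  also have "\<dots> = (LINT x|lebesgue. u (x + (a + b)) * \<phi> x) - (LINT x|lebesgue. u (x + a) * \<phi> x)
      - (LINT x|lebesgue. u (x + b) * \<phi> x) + (LINT x|lebesgue. u (x + 0) * \<phi> x)"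
    by (subst Bochner_Integration.integral_add Bochner_Integration.integral_diff;
        (intro Bochner_Integration.integrable_diff i)?)+ simp
  also have "\<dots> = (LINT x|lebesgue. u x * \<phi> (x + - (a + b))) - (LINT x|lebesgue. u x * \<phi> (x + - a))
      - (LINT x|lebesgue. u x * \<phi> (x + - b)) + (LINT x|lebesgue. u x * \<phi> (x + - 0))"
    unfolding integral_shift_test[OF m] ..
  also have "\<dots> = (LINT x|lebesgue. u x * \<phi> (x + - (a + b)) - u x * \<phi> (x + - a) - u x * \<phi> (x + - b) + u x * \<phi> (x + - 0))"
    by (subst Bochner_Integration.integral_add Bochner_Integration.integral_diff;
        (intro Bochner_Integration.integrable_diff i)?)+ simp
  also have "\<dots> = (LINT x|lebesgue. u x * mixed_diff (- a) (- b) \<phi> x)"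
    unfolding mixed_diff_def e by (simp add: algebra_simps)
  finally show ?thesis .
qed

definition dyadic_quotient :: "'n \<Rightarrow> (real^'n::finite \<Rightarrow> real) \<Rightarrow> nat \<Rightarrow> real^'n \<Rightarrow> real" where
  "dyadic_quotient i u k x = (u (x + axis i ((1/2) ^ k)) - u x) / (1/2) ^ k"

lemma Lp_dyadic_quotient:
  fixes u :: "real^'n::finite \<Rightarrow> real"
  assumes p: "p \<ge> 1" "u \<in> Lp p"
  shows "dyadic_quotient i u k \<in> Lp p"
  unfolding dyadic_quotient_def[abs_def]
  using Lp_cmult[OF Lp_diff[OF p(1) Lp_shift[OF p(2), of "axis i ((1/2) ^ k)"] p(2)], of "1 / (1/2) ^ k"] by simp

text \<open>Quotients with steps \<open>2 s\<close> and \<open>s\<close> differ by a second difference with step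
\<open>s\<close>, divided by \<open>2 s\<close>.\<close>

lemma dyadic_quotient_step:
  "dyadic_quotient i u k x - dyadic_quotient i u (Suc k) x
     = 2 ^ k * second_diff (axis i ((1/2) ^ Suc k)) u (x + axis i ((1/2) ^ Suc k))"
proof -
  define a :: "real^'a" where "a = axis i ((1/2) ^ Suc k)"
  have a: "axis i ((1/2) ^ k) = a + a" by (auto simp: a_def axis_def vec_eq_iff)
  show ?thesis unfolding dyadic_quotient_def second_diff_def a a_def[symmetric]
    by (simp add: add.assoc field_simps power_divide)
qed

text \<open>By \<open>dyadic_quotient_step\<close> successive dyadic quotients differ in \<open>L\<^sup>p\<close> by a quantity
of the order of their step.  They thus form a Cauchy sequence, whose limit is the weak derivative.
This works for \<open>p = 1\<close> as well, where bounded sequences have no weak limits.  The strong convergence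
is part of the conclusion, since the estimate of second derivatives for \<open>p = 1\<close> uses it.\<close>

lemma quadratic_diff_bounded_gradient:
  fixes u :: "real^'n::finite \<Rightarrow> real"
  assumes p: "p \<ge> 1" "u \<in> Lp p" and C: "C \<ge> 0" and q: "quadratic_diff_bounded p C u"
  obtains g where "g \<in> Lp p" "(\<lambda>k. LINT x|lebesgue. \<bar>dyadic_quotient i u k x - g x\<bar> powr p) \<longlonglongrightarrow> 0"
    "\<And>\<phi>. \<phi> \<in> Cc_k 1 \<Longrightarrow> \<langle>u, partial_deriv i \<phi>\<rangle> = - \<langle>g, \<phi>\<rangle>"
proof -
  define f where "f k = dyadic_quotient i u k" for k
  have f: "f k \<in> Lp p" for k unfolding f_def by (rule Lp_dyadic_quotient[OF p])
  (* A \<open>p\<close>-th root of a bound; adding 1 makes it strictly positive. *)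
  define C0 where "C0 = (C + 1) powr (1/p)"
  have C0: "C0 > 0" "C \<le> C0 powr p" using C p by (simp_all add: C0_def powr_powr)
  have step: "(LINT x|lebesgue. \<bar>f (Suc k) x - f k x\<bar> powr p) \<le> (C0 * (1/2) ^ k) powr p" for k
  proof -
    define a :: "real^'n" where "a = axis i ((1/2) ^ Suc k)"
    have na: "norm a = (1/2) ^ Suc k" by (simp add: a_def)
    have m: "second_diff a u \<in> borel_measurable lebesgue" using Lp_second_diff[OF p, of a] by (simp add: Lp_real)
    have "\<bar>f (Suc k) x - f k x\<bar> = \<bar>2 ^ k * second_diff a u (x + a)\<bar>" for x
      unfolding f_def abs_minus_commute[of "dyadic_quotient i u (Suc k) x"] dyadic_quotient_step a_def ..
    then have "(LINT x|lebesgue. \<bar>f (Suc k) x - f k x\<bar> powr p) = (LINT x|lebesgue. (2 ^ k) powr p * \<bar>second_diff a u (x + a)\<bar> powr p)"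
      by (simp add: abs_mult powr_mult)
    also have "\<dots> = (2 ^ k) powr p * (LINT x|lebesgue. \<bar>second_diff a u (x + a)\<bar> powr p)" by simp
    also have "(LINT x|lebesgue. \<bar>second_diff a u (x + a)\<bar> powr p) = Lp_mass p (second_diff a u)"
      using m by (intro integral_shift[of "\<lambda>x. \<bar>second_diff a u x\<bar> powr p"]) auto
    also have "\<dots> \<le> C * ((norm a)\<^sup>2) powr p" by (rule quadratic_diff_bounded_second_diff[OF p C q])
    also have "\<dots> \<le> C0 powr p * ((norm a)\<^sup>2) powr p" using C0 by (intro mult_right_mono) auto
    also have "(2 ^ k) powr p * (C0 powr p * ((norm a)\<^sup>2) powr p) = (C0 * (2 ^ k * (norm a)\<^sup>2)) powr p"
      using C0 by (simp add: powr_mult mult_ac)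
    also have "2 ^ k * (norm a)\<^sup>2 = (1/4) * (1/2) ^ k"
      unfolding na by (simp add: power2_eq_square power_one_over)
    also have "(C0 * ((1/4) * (1/2) ^ k)) powr p \<le> (C0 * (1/2) ^ k) powr p"
      using C0 p by (intro powr_mono2 mult_left_mono) auto
    finally show ?thesis by simp
  qed
  have cauchy: "\<exists>N. \<forall>n\<ge>N. \<forall>m\<ge>N. (LINT x|lebesgue. \<bar>f n x - f m x\<bar> powr p) \<le> e" if "e > 0" for e
  proof -
    have "(\<lambda>n. (C0 * (3 * (1/2) ^ n)) powr p) \<longlonglongrightarrow> (C0 * (3 * 0)) powr p"
      by (intro tendsto_powr2 tendsto_intros LIMSEQ_power_zero) (use C0 p in auto)
    then have "\<forall>\<^sub>F n in sequentially. (C0 * (3 * (1/2) ^ n)) powr p < e" using that p by (intro order_tendstoD) auto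
    then obtain N where N: "\<And>n. n \<ge> N \<Longrightarrow> (C0 * (3 * (1/2) ^ n)) powr p < e" unfolding eventually_sequentially by blast
    have *: "(LINT x|lebesgue. \<bar>f (n + m) x - f n x\<bar> powr p) \<le> e" if "n \<ge> N" for n m
    proof -
      have "(LINT x|lebesgue. \<bar>f (n + m) x - f n x\<bar> powr p) \<le> (C0 * (3 * (1/2) ^ n - 2 * (1/2) ^ (n + m))) powr p"
        by (rule Lp_geometric_telescope[OF p(1) f C0(1) step])
      also have "\<dots> \<le> (C0 * (3 * (1/2) ^ n)) powr p"
      proof (intro powr_mono2 mult_left_mono)
        have "(1/2::real) ^ (n + m) \<le> (1/2) ^ n" by (intro power_decreasing) auto
        moreover have "(0::real) < (1/2) ^ n" by simp
        ultimately have "(3 * (1/2) ^ n - 2 * (1/2) ^ (n + m)) \<ge> (0::real)" by linarith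
        then show "0 \<le> C0 * (3 * (1/2) ^ n - 2 * (1/2) ^ (n + m))" using C0 by simp
      qed (use C0 p in auto)
      also have "\<dots> < e" by (rule N[OF that])
      finally show ?thesis by simp
    qed
    have "(LINT x|lebesgue. \<bar>f n x - f m x\<bar> powr p) \<le> e" if "n \<ge> N" "m \<ge> N" for n m
    proof (cases "n \<le> m")
      case True then show ?thesis using *[of n "m - n"] that by (simp add: abs_minus_commute)
    next
      case False then show ?thesis using *[of m "n - m"] that by simp
    qed
    then show ?thesis by blast
  qed
  obtain g where g: "g \<in> Lp p" and lim: "(\<lambda>n. LINT x|lebesgue. \<bar>f n x - g x\<bar> powr p) \<longlonglongrightarrow> 0"
    using Lp_complete[OF p(1) f cauchy] by blast
  have "\<langle>u, partial_deriv i \<phi>\<rangle> = - \<langle>g, \<phi>\<rangle>" if \<phi>: "\<phi> \<in> Cc_k 1" for \<phi>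
  proof -
    obtain B where B: "\<And>x. \<bar>\<phi> x\<bar> \<le> B" using Cc_k_bounded[OF \<phi>] by metis
    have "(\<lambda>n. \<langle>f n, \<phi>\<rangle> - \<langle>g, \<phi>\<rangle>) \<longlonglongrightarrow> 0"
      by (rule Lp_tendsto_test[OF p(1) f g lim Cc_k_integrable[OF \<phi>] B order_refl])
    then have l1: "(\<lambda>n. \<langle>f n, \<phi>\<rangle>) \<longlonglongrightarrow> \<langle>g, \<phi>\<rangle>" by (rule LIM_zero_cancel)
    define s where "s n = - ((1/2::real) ^ n)" for n :: nat
    have s: "s n \<noteq> 0" "\<bar>s n\<bar> \<le> 1" "s \<longlonglongrightarrow> 0" for n
      unfolding s_def by (auto simp: power_le_one intro!: tendsto_eq_intros LIMSEQ_power_zero)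
    obtain B R where BR: "R > 0" "\<And>n x. \<bar>(\<phi> (x + axis i (s n)) - \<phi> x) / s n\<bar> \<le> B"
      "\<And>n x. norm x > R \<Longrightarrow> (\<phi> (x + axis i (s n)) - \<phi> x) / s n = 0"
      "\<And>x. (\<lambda>n::nat. (\<phi> (x + axis i (s n)) - \<phi> x) / s n) \<longlonglongrightarrow> partial_deriv i \<phi> x"
      by (rule diff_quotient_facts[OF \<phi> s, where i = i]) blast
    have m: "\<phi> \<in> borel_measurable lebesgue" "partial_deriv i \<phi> \<in> borel_measurable lebesgue"
      using Cc_k_measurable[OF \<phi>] Cc_k_measurable[OF partial_deriv_Cc_k[of \<phi> 0 i]] \<phi> by auto
    have l2: "(\<lambda>n. LINT x|lebesgue. u x * ((\<phi> (x + axis i (s n)) - \<phi> x) / s n)) \<longlonglongrightarrow> \<langle>u, partial_deriv i \<phi>\<rangle>"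
      by (rule Lp_test_dominated[OF p _ m(2) BR(2,3,4)]) (use m(1) measurable_shift[OF m(1)] in measurable)
    have e: "- \<langle>f n, \<phi>\<rangle> = (LINT x|lebesgue. u x * ((\<phi> (x + axis i (s n)) - \<phi> x) / s n))" for n
    proof -
      have a: "- axis i ((1/2) ^ n) = (axis i (s n) :: real^'n)" by (auto simp: s_def axis_def vec_eq_iff)
      have "\<langle>f n, \<phi>\<rangle> = (LINT x|lebesgue. u x * ((\<phi> (x + axis i (s n)) - \<phi> x) / (1/2) ^ n))"
        unfolding f_def dyadic_quotient_def first_diff_by_parts[OF p \<phi>] a ..
      also have "\<dots> = (LINT x|lebesgue. - (u x * ((\<phi> (x + axis i (s n)) - \<phi> x) / s n)))" by (simp add: s_def)
      finally show ?thesis by simp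
    qed
    have "(\<lambda>n. LINT x|lebesgue. u x * ((\<phi> (x + axis i (s n)) - \<phi> x) / s n)) \<longlonglongrightarrow> - \<langle>g, \<phi>\<rangle>"
      unfolding e[symmetric] by (rule tendsto_minus[OF l1])
    with l2 show ?thesis by (rule LIMSEQ_unique)
  qed
  then show ?thesis using that g lim unfolding f_def by blast
qed

section \<open>Uniform convexity and weak limits\<close>

text \<open>For two distinct nonnegative numbers, the mean value theorem on both sides of the midpoint and the
strict monotonicity of \<open>z powr (p - 1)\<close>; numbers of arbitrary sign are reduced to their
absolute values, unless they are opposite, where the midpoint is 0.\<close>

lemma powr_midpoint_strict:
  fixes a b p :: real
  assumes p: "p > 1" and ab: "a \<noteq> b"
  shows "\<bar>(a + b) / 2\<bar> powr p < (\<bar>a\<bar> powr p + \<bar>b\<bar> powr p) / 2"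
proof -
  have strict: "((x + y) / 2) powr p < (x powr p + y powr p) / 2" if xy: "0 \<le> y" "y < x" for x y :: real
  proof -
    define m where "m = (x + y) / 2"
    have m: "y < m" "m < x" "x - m = m - y" using xy by (auto simp: m_def field_simps)
    have mvt: "\<exists>z. s < z \<and> z < t \<and> t powr p - s powr p = (t - s) * (p * z powr (p - 1))" if st: "0 \<le> s" "s < t" for s t :: real
    proof -
      have c: "continuous_on {s..t} (\<lambda>x. x powr p)"
        using st p by (intro continuous_on_powr' continuous_on_const continuous_on_id) auto
      have d: "((\<lambda>x. x powr p) has_derivative (\<lambda>h. h * (p * z powr (p - 1)))) (at z)" if "s < z" "z < t" for z
      proof -
        have "((\<lambda>x. x powr p) has_real_derivative p * z powr (p - 1)) (at z)"
          using st that by (intro has_real_derivative_powr) auto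
        then show ?thesis by (simp add: has_field_derivative_def mult.commute[of _ "_ * _"])
      qed
      show ?thesis by (rule mvt[OF st(2) c d]) auto
    qed
    obtain z1 where z1: "m < z1" "x powr p - m powr p = (x - m) * (p * z1 powr (p - 1))"
      using mvt[of m x] m xy by auto
    obtain z2 where z2: "y < z2" "z2 < m" "m powr p - y powr p = (m - y) * (p * z2 powr (p - 1))"
      using mvt[of y m] m xy by auto
    have "z2 powr (p - 1) < z1 powr (p - 1)" using z1 z2 p xy by (intro powr_less_mono2) auto
    then have "(m - y) * (p * z2 powr (p - 1)) < (m - y) * (p * z1 powr (p - 1))" using p m by simp
    then have "m powr p - y powr p < x powr p - m powr p" using z1(2) z2(3) m(3) by simp
    then show ?thesis by (simp add: m_def)
  qed
  consider "\<bar>a\<bar> < \<bar>b\<bar>" | "\<bar>b\<bar> < \<bar>a\<bar>" | "\<bar>a\<bar> = \<bar>b\<bar>" by linarith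
  then show ?thesis
  proof cases
    case 1
    have "\<bar>(a + b) / 2\<bar> powr p \<le> ((\<bar>b\<bar> + \<bar>a\<bar>) / 2) powr p" using p by (intro powr_mono2) auto
    also have "\<dots> < (\<bar>b\<bar> powr p + \<bar>a\<bar> powr p) / 2" using 1 by (intro strict) auto
    finally show ?thesis by (simp add: add.commute)
  next
    case 2
    have "\<bar>(a + b) / 2\<bar> powr p \<le> ((\<bar>a\<bar> + \<bar>b\<bar>) / 2) powr p" using p by (intro powr_mono2) auto
    also have "\<dots> < (\<bar>a\<bar> powr p + \<bar>b\<bar> powr p) / 2" using 2 by (intro strict) auto
    finally show ?thesis .
  next
    case 3
    then have "a = - b" "b \<noteq> 0" using ab by (auto simp: abs_if split: if_splits)
    then show ?thesis by simp
  qed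
qed

text \<open>Both sides are homogeneous of degree \<open>p\<close>, so it is enough to consider
\<open>\<bar>a\<bar> powr p + \<bar>b\<bar> powr p = 1\<close>. There the pairs with \<open>\<bar>a
- b\<bar> powr p \<ge> \<delta>\<close> form a compact set, on which the convexity defect, positive
by \<open>powr_midpoint_strict\<close>, has a positive minimum. This is uniform convexity of
\<open>L\<^sup>p\<close> in a pointwise form that can be integrated.\<close>

lemma powr_uniform_convexity:
  fixes p \<delta> :: real
  assumes p: "p > 1" and \<delta>: "\<delta> > 0"
  obtains K where "K \<ge> 0" "\<And>a b :: real. \<bar>a - b\<bar> powr p \<le> \<delta> * (\<bar>a\<bar> powr p + \<bar>b\<bar> powr p)
     + K * ((\<bar>a\<bar> powr p + \<bar>b\<bar> powr p) / 2 - \<bar>(a + b) / 2\<bar> powr p)"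
proof -
  define N where "N z = \<bar>fst z\<bar> powr p + \<bar>snd z\<bar> powr p" for z :: "real \<times> real"
  define D where "D z = N z / 2 - \<bar>(fst z + snd z) / 2\<bar> powr p" for z
  define E where "E z = \<bar>fst z - snd z\<bar> powr p" for z :: "real \<times> real"
  have cN: "continuous_on UNIV N" and cD: "continuous_on UNIV D" and cE: "continuous_on UNIV E"
    unfolding N_def D_def E_def using p by (intro continuous_on_add continuous_on_diff continuous_on_divide continuous_on_powr' continuous_on_const
        continuous_on_rabs continuous_on_fst continuous_on_snd continuous_on_id; auto)+
  define S where "S = {z. N z = 1} \<inter> {z. E z \<ge> \<delta>}"
  have cl: "closed S" unfolding S_def
    by (intro closed_Int closed_Collect_eq[OF cN] closed_Collect_le[OF _ cE] continuous_on_const)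
  have "S \<subseteq> cbox (-1, -1) (1, 1)"
  proof
    fix z assume "z \<in> S"
    then have "\<bar>fst z\<bar> powr p + \<bar>snd z\<bar> powr p = 1" by (simp add: S_def N_def)
    then have "\<bar>fst z\<bar> powr p \<le> 1" "\<bar>snd z\<bar> powr p \<le> 1"
      using powr_ge_zero[of "\<bar>fst z\<bar>" p] powr_ge_zero[of "\<bar>snd z\<bar>" p] by linarith+
    moreover have "\<bar>t\<bar> \<le> 1" if "\<bar>t\<bar> powr p \<le> 1" for t :: real
    proof (rule ccontr)
      assume "\<not> \<bar>t\<bar> \<le> 1"
      then have "1 powr p < \<bar>t\<bar> powr p" using p by (intro powr_less_mono2) auto
      then show False using that by simp
    qed
    ultimately have "\<bar>fst z\<bar> \<le> 1" "\<bar>snd z\<bar> \<le> 1" by blast+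
    then show "z \<in> cbox (-1, -1) (1, 1)" by (cases z) (auto simp: cbox_Pair_eq)
  qed
  then have comp: "compact S" using cl by (meson bounded_cbox bounded_subset compact_eq_bounded_closed)
  have Dpos: "D z > 0" if "z \<in> S" for z
  proof -
    have "fst z \<noteq> snd z" using that \<delta> by (auto simp: S_def E_def)
    then show ?thesis using powr_midpoint_strict[OF p, of "fst z" "snd z"] by (simp add: D_def N_def)
  qed
  have Dnn: "D z \<ge> 0" for z
    using powr_midpoint_strict[OF p, of "fst z" "snd z"] by (cases "fst z = snd z") (auto simp: D_def N_def)
  have "\<exists>c>0. \<forall>z\<in>S. D z \<ge> c"
  proof (cases "S = {}")
    case False
    obtain z0 where "z0 \<in> S" "\<forall>z\<in>S. D z0 \<le> D z"
      using continuous_attains_inf[OF comp False continuous_on_subset[OF cD]] by auto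
    then show ?thesis using Dpos by blast
  qed (auto intro: exI[of _ 1])
  then obtain c where c: "c > 0" "\<And>z. z \<in> S \<Longrightarrow> D z \<ge> c" by blast
  (* On the compact set the left side is at most \<open>2 powr p\<close>, and the defect at least \<open>c\<close>. *)
  define K where "K = 2 powr p / c"
  have K: "K \<ge> 0" using c by (simp add: K_def)
  have unit: "E z \<le> \<delta> + K * D z" if "N z = 1" for z
  proof (cases "z \<in> S")
    case True
    have "E z \<le> 2 powr p * N z"
      using powr_add_le[of p "fst z" "- snd z"] p by (simp add: E_def N_def)
    also have "\<dots> = K * c" using that c by (simp add: K_def)
    also have "\<dots> \<le> K * D z" using c(2)[OF True] K by (intro mult_left_mono)
    finally show ?thesis using \<delta> by simp
  next
    case False
    then have "E z < \<delta>" using that by (auto simp: S_def)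
    then show ?thesis using K Dnn[of z] by (simp add: add_increasing2)
  qed
  have "\<bar>a - b\<bar> powr p \<le> \<delta> * (\<bar>a\<bar> powr p + \<bar>b\<bar> powr p) + K * ((\<bar>a\<bar> powr p + \<bar>b\<bar> powr p) / 2 - \<bar>(a + b) / 2\<bar> powr p)" for a b :: real
  proof (cases "a = 0 \<and> b = 0")
    case False
    define R where "R = \<bar>a\<bar> powr p + \<bar>b\<bar> powr p"
    have "\<bar>a\<bar> powr p > 0 \<or> \<bar>b\<bar> powr p > 0" using False by auto
    then have R: "R > 0" using powr_ge_zero[of "\<bar>a\<bar>" p] powr_ge_zero[of "\<bar>b\<bar>" p] unfolding R_def by linarith
    define r where "r = R powr (1/p)"
    have r: "r > 0" "r powr p = R" using R p by (simp_all add: r_def powr_powr)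
    define z where "z = (a / r, b / r)"
    have s: "\<bar>t / r\<bar> powr p = \<bar>t\<bar> powr p / R" for t using r by (simp add: powr_divide)
    have N: "N z = 1" 
      unfolding N_def z_def fst_conv snd_conv s add_divide_distrib[symmetric] R_def[symmetric] using R by simp
    have "\<bar>a / r - b / r\<bar> powr p = \<bar>a - b\<bar> powr p / R" by (simp only: diff_divide_distrib[symmetric] s)
    moreover have "\<bar>(a / r + b / r) / 2\<bar> powr p = \<bar>(a + b) / 2\<bar> powr p / R"
    proof -
      have "(a / r + b / r) / 2 = ((a + b) / 2) / r"
        by (simp only: add_divide_distrib[symmetric] divide_divide_eq_left mult.commute)
      then show ?thesis by (simp only: s)
    qed
    ultimately have "\<bar>a - b\<bar> powr p / R \<le> \<delta> + K * (1 / 2 - \<bar>(a + b) / 2\<bar> powr p / R)"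
      using unit[OF N] N by (simp add: E_def D_def z_def)
    then have "R * (\<bar>a - b\<bar> powr p / R) \<le> R * (\<delta> + K * (1 / 2 - \<bar>(a + b) / 2\<bar> powr p / R))"
      using R by (intro mult_left_mono) auto
    then have "\<bar>a - b\<bar> powr p \<le> \<delta> * R + K * (R / 2 - \<bar>(a + b) / 2\<bar> powr p)"
      using R by (simp add: algebra_simps)
    then show ?thesis by (simp add: R_def)
  qed simp
  then show ?thesis using that K by blast
qed

text \<open>A bounded sequence whose pairings converge has a weak limit. Let \<open>\<C> n\<close> be the set of
the functions whose pairing with each test function is at least as close to the limit functional as
that of some \<open>f k\<close> with \<open>k \<ge> n\<close>. These sets decrease and contain
midpoints, so by uniform convexity nearly minimal elements \<open>h n\<close> of \<open>\<C>
n\<close> form a Cauchy sequence. Their limit in \<open>L\<^sup>p\<close> represents the functional.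
The minimization avoids the dual space and representation theorems.\<close>

lemma Lp_weak_compactness:
  fixes f :: "nat \<Rightarrow> real^'n::finite \<Rightarrow> real"
  assumes p: "p > 1" and f: "\<And>n. f n \<in> Lp p" and M: "\<And>n. Lp_mass p (f n) \<le> M"
    and lim: "\<And>\<phi>. \<phi> \<in> Cc_inf \<Longrightarrow> (\<lambda>n. \<langle>f n, \<phi>\<rangle>) \<longlonglongrightarrow> T \<phi>"
  obtains g where "g \<in> Lp p" "\<And>\<phi>. \<phi> \<in> Cc_inf \<Longrightarrow> \<langle>g, \<phi>\<rangle> = T \<phi>"
proof -
  have p1: "p \<ge> 1" using p by simp
  define I where "I h = Lp_mass p h" for h :: "real^'n \<Rightarrow> real"
  have I0: "I h \<ge> 0" for h unfolding I_def by (intro integral_nonneg_AE) auto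
  define \<C> where "\<C> n = {h \<in> Lp p. \<forall>\<phi>\<in>Cc_inf. \<exists>k\<ge>n. \<bar>\<langle>h, \<phi>\<rangle> - T \<phi>\<bar> \<le> \<bar>\<langle>f k, \<phi>\<rangle> - T \<phi>\<bar>}" for n
  have fC: "f n \<in> \<C> n" for n using f by (auto simp: \<C>_def)
  have mono: "\<C> m \<subseteq> \<C> n" if "n \<le> m" for n m using that by (simp add: \<C>_def subset_iff) (meson order_trans)
  (* A midpoint deviates by at most the larger of the two deviations.  Which one that is depends on the
     test function, and therefore so does the index in the definition of \<open>\<C>\<close>. *)
  have mid: "(\<lambda>x. (1/2) * (h x + k x)) \<in> \<C> n" if h: "h \<in> \<C> n" and k: "k \<in> \<C> n" for h k n
  proof -
    have hk: "h \<in> Lp p" "k \<in> Lp p" using h k by (auto simp: \<C>_def)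
    have "\<exists>j\<ge>n. \<bar>(LINT x|lebesgue. (1/2) * (h x + k x) * \<phi> x) - T \<phi>\<bar> \<le> \<bar>\<langle>f j, \<phi>\<rangle> - T \<phi>\<bar>" if \<phi>: "\<phi> \<in> Cc_inf" for \<phi>
    proof -
      obtain k1 where k1: "k1 \<ge> n" "\<bar>\<langle>h, \<phi>\<rangle> - T \<phi>\<bar> \<le> \<bar>\<langle>f k1, \<phi>\<rangle> - T \<phi>\<bar>"
        using h \<phi> by (auto simp: \<C>_def)
      obtain k2 where k2: "k2 \<ge> n" "\<bar>\<langle>k, \<phi>\<rangle> - T \<phi>\<bar> \<le> \<bar>\<langle>f k2, \<phi>\<rangle> - T \<phi>\<bar>"
        using k \<phi> by (auto simp: \<C>_def)
      have i: "integrable lebesgue (\<lambda>x. h x * \<phi> x)" "integrable lebesgue (\<lambda>x. k x * \<phi> x)"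
        using Lp_Cc_k_integrable[OF p1 _ Cc_inf_Cc_k[OF \<phi>, of 0]] hk by auto
      have "(LINT x|lebesgue. (1/2) * (h x + k x) * \<phi> x) = (LINT x|lebesgue. (1/2) * (h x * \<phi> x + k x * \<phi> x))"
        by (intro Bochner_Integration.integral_cong) (simp_all add: algebra_simps)
      also have "\<dots> = (1/2) * (\<langle>h, \<phi>\<rangle> + \<langle>k, \<phi>\<rangle>)" using i by simp
      finally have e: "(LINT x|lebesgue. (1/2) * (h x + k x) * \<phi> x) = (1/2) * (\<langle>h, \<phi>\<rangle> + \<langle>k, \<phi>\<rangle>)" .
      define t1 where "t1 = \<langle>f k1, \<phi>\<rangle> - T \<phi>"
      define t2 where "t2 = \<langle>f k2, \<phi>\<rangle> - T \<phi>"
      have aux: "\<bar>(1/2) * (a + b) - c\<bar> \<le> max s t" if "\<bar>a - c\<bar> \<le> s" "\<bar>b - c\<bar> \<le> t" for a b c s t :: real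
        using that by (auto simp: max_def abs_le_iff field_simps)
      have "\<bar>(LINT x|lebesgue. (1/2) * (h x + k x) * \<phi> x) - T \<phi>\<bar> \<le> max \<bar>t1\<bar> \<bar>t2\<bar>"
        unfolding e t1_def t2_def by (rule aux[OF k1(2) k2(2)])
      then have le: "\<bar>(LINT x|lebesgue. (1/2) * (h x + k x) * \<phi> x) - T \<phi>\<bar> \<le> \<bar>t1\<bar> \<or>
          \<bar>(LINT x|lebesgue. (1/2) * (h x + k x) * \<phi> x) - T \<phi>\<bar> \<le> \<bar>t2\<bar>"
        by (simp only: le_max_iff_disj)
      show ?thesis using disjE[OF le] k1(1) k2(1) unfolding t1_def t2_def by blast
    qed
    then show ?thesis using Lp_cmult[OF Lp_add[OF p1 hk], of "1/2"] by (auto simp: \<C>_def)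
  qed
  define d where "d n = Inf (I ` \<C> n)" for n
  have bdd: "bdd_below (I ` \<C> n)" for n using I0 by (intro bdd_belowI[of _ 0]) auto
  have dI: "d n \<le> I h" if "h \<in> \<C> n" for h n unfolding d_def by (rule cInf_lower) (use that bdd in auto)
  have dM: "d n \<le> M" for n using dI[OF fC[of n]] M[of n] unfolding I_def by linarith
  have dinc: "incseq d"
  proof (rule incseq_SucI)
    fix n
    have "I ` \<C> (Suc n) \<subseteq> I ` \<C> n" using mono[of n "Suc n"] by (intro image_mono) simp
    moreover have "I ` \<C> (Suc n) \<noteq> {}" using fC[of "Suc n"] by blast
    ultimately show "d n \<le> d (Suc n)" unfolding d_def by (intro cInf_superset_mono bdd)
  qed
  obtain L where L: "d \<longlonglongrightarrow> L" "\<And>n. d n \<le> L"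
    using incseq_convergent[OF dinc, of M] dM by auto
  have LM: "L \<le> M" by (rule LIMSEQ_le_const2[OF L(1)]) (use dM in auto)
  have "\<exists>h\<in>\<C> n. I h < d n + 1 / real (Suc n)" for n
  proof -
    have lt: "Inf (I ` \<C> n) < d n + 1 / real (Suc n)" by (simp add: d_def)
    have "I ` \<C> n \<noteq> {}" using fC by auto
    from cInf_lessD[OF this lt] show ?thesis by blast
  qed
  then obtain h where h: "\<And>n. h n \<in> \<C> n" "\<And>n. I (h n) < d n + 1 / real (Suc n)" by metis
  have hL: "h n \<in> Lp p" for n using h(1) by (auto simp: \<C>_def)
  have hi: "integrable lebesgue (\<lambda>x. \<bar>h n x\<bar> powr p)" for n using hL by (simp add: Lp_real)
  (* A bound for the convexity defect of \<open>h n\<close> and \<open>h m\<close> with \<open>n \<le> m\<close>: their midpoint lies in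
     \<open>\<C> n\<close>, so its mass is at least \<open>d n\<close>. *)
  define \<eta> where "\<eta> n = (L - d n) / 2 + 1 / real (Suc n)" for n
  have \<eta>: "\<eta> \<longlonglongrightarrow> 0"
  proof -
    have "(\<lambda>n. (L - d n) / 2 + 1 / real (Suc n)) \<longlonglongrightarrow> (L - L) / 2 + 0"
      by (intro tendsto_add tendsto_divide tendsto_diff L(1) tendsto_const LIMSEQ_Suc[OF lim_const_over_n]) auto
    then show ?thesis by (simp add: \<eta>_def[abs_def])
  qed
  have hM: "I (h n) \<le> M + 1" for n
  proof -
    have "1 / real (Suc n) \<le> 1" by simp
    then show ?thesis using h(2)[of n] dM[of n] by linarith
  qed
  have M1: "M + 1 \<ge> 0" using hM[of 0] I0[of "h 0"] by linarith
  have main: "I (\<lambda>x. h n x - h m x) \<le> \<delta> * (2 * (M + 1)) + K * \<eta> n"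
    if K: "K \<ge> 0" "\<And>a b :: real. \<bar>a - b\<bar> powr p \<le> \<delta> * (\<bar>a\<bar> powr p + \<bar>b\<bar> powr p)
     + K * ((\<bar>a\<bar> powr p + \<bar>b\<bar> powr p) / 2 - \<bar>(a + b) / 2\<bar> powr p)" and \<delta>: "\<delta> > 0" and nm: "n \<le> m" for K \<delta> n m
  proof -
    have midC: "(\<lambda>x. (1/2) * (h n x + h m x)) \<in> \<C> n" using h(1) mono[OF nm] by (intro mid) auto
    have e: "(1/2) * (h n x + h m x) = (h n x + h m x) / 2" for x by simp
    have im: "integrable lebesgue (\<lambda>x. \<bar>(h n x + h m x) / 2\<bar> powr p)"
      using midC unfolding e by (auto simp: \<C>_def Lp_real)
    have dm: "d n \<le> (LINT x|lebesgue. \<bar>(h n x + h m x) / 2\<bar> powr p)"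
      using dI[OF midC] unfolding e by (simp add: I_def)
    have "I (\<lambda>x. h n x - h m x) \<le> (LINT x|lebesgue. \<delta> * (\<bar>h n x\<bar> powr p + \<bar>h m x\<bar> powr p)
     + K * ((\<bar>h n x\<bar> powr p + \<bar>h m x\<bar> powr p) / 2 - \<bar>(h n x + h m x) / 2\<bar> powr p))"
      unfolding I_def
    proof (rule integral_mono[OF _ _ K(2)])
      show "integrable lebesgue (\<lambda>x. \<bar>h n x - h m x\<bar> powr p)" using Lp_diff[OF p1 hL hL] by (simp add: Lp_real)
      show "integrable lebesgue (\<lambda>x. \<delta> * (\<bar>h n x\<bar> powr p + \<bar>h m x\<bar> powr p)
        + K * ((\<bar>h n x\<bar> powr p + \<bar>h m x\<bar> powr p) / 2 - \<bar>(h n x + h m x) / 2\<bar> powr p))"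
        by (intro Bochner_Integration.integrable_add Bochner_Integration.integrable_diff integrable_mult_right integrable_divide hi im)
    qed
    also have "\<dots> = \<delta> * (I (h n) + I (h m)) + K * ((I (h n) + I (h m)) / 2 - (LINT x|lebesgue. \<bar>(h n x + h m x) / 2\<bar> powr p))"
      unfolding I_def using hi im by (simp add: Bochner_Integration.integrable_add Bochner_Integration.integrable_diff)
    also have "\<dots> \<le> \<delta> * (2 * (M + 1)) + K * \<eta> n"
    proof (intro add_mono mult_left_mono)
      show "I (h n) + I (h m) \<le> 2 * (M + 1)" using add_mono[OF hM[of n] hM[of m]] by simp
      have "1 / real (Suc m) \<le> 1 / real (Suc n)" using nm by (simp add: frac_le)
      moreover have "\<eta> n = (L - d n) / 2 + 1 / real (Suc n)" by (simp add: \<eta>_def)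
      ultimately show "(I (h n) + I (h m)) / 2 - (LINT x|lebesgue. \<bar>(h n x + h m x) / 2\<bar> powr p) \<le> \<eta> n"
        using h(2)[of n] h(2)[of m] dm L(2)[of m] by argo
    qed (use K \<delta> in auto)
    finally show ?thesis .
  qed
  have cauchy: "\<exists>N. \<forall>n\<ge>N. \<forall>m\<ge>N. (LINT x|lebesgue. \<bar>h n x - h m x\<bar> powr p) \<le> e" if e: "e > 0" for e
  proof -
    define \<delta> where "\<delta> = e / 2 / (2 * (M + 1) + 1)"
    have \<delta>: "\<delta> > 0" using e M1 by (simp add: \<delta>_def)
    have "\<delta> * (2 * (M + 1)) \<le> \<delta> * (2 * (M + 1) + 1)" using \<delta> by (intro mult_left_mono) auto
    also have "\<dots> = e / 2"
    proof -
      have "2 * (M + 1) + 1 \<noteq> 0" using M1 by argo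
      then show ?thesis unfolding \<delta>_def by (rule nonzero_eq_divide_eq[THEN iffD1, OF _ refl])
    qed
    finally have \<delta>e: "\<delta> * (2 * (M + 1)) \<le> e / 2" .
    obtain K where K: "K \<ge> 0" "\<And>a b :: real. \<bar>a - b\<bar> powr p \<le> \<delta> * (\<bar>a\<bar> powr p + \<bar>b\<bar> powr p)
     + K * ((\<bar>a\<bar> powr p + \<bar>b\<bar> powr p) / 2 - \<bar>(a + b) / 2\<bar> powr p)"
      by (rule powr_uniform_convexity[OF p \<delta>]) blast
    have "(\<lambda>n. K * \<eta> n) \<longlonglongrightarrow> K * 0" by (intro tendsto_intros \<eta>)
    then have "\<forall>\<^sub>F n in sequentially. K * \<eta> n < e / 2" using e by (intro order_tendstoD) auto
    then obtain N where N: "\<And>n. n \<ge> N \<Longrightarrow> K * \<eta> n < e / 2" unfolding eventually_sequentially by blast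
    have *: "I (\<lambda>x. h n x - h m x) \<le> e" if "N \<le> n" "n \<le> m" for n m
      using main[OF K \<delta> that(2)] N[OF that(1)] \<delta>e by linarith
    have "I (\<lambda>x. h n x - h m x) \<le> e" if "N \<le> n" "N \<le> m" for n m
    proof (cases "n \<le> m")
      case False
      have "I (\<lambda>x. h n x - h m x) = I (\<lambda>x. h m x - h n x)" unfolding I_def by (simp add: abs_minus_commute)
      then show ?thesis using *[of m n] False that by simp
    qed (use * that in auto)
    then show ?thesis unfolding I_def by blast
  qed
  obtain g where g: "g \<in> Lp p" and gl: "(\<lambda>n. LINT x|lebesgue. \<bar>h n x - g x\<bar> powr p) \<longlonglongrightarrow> 0"
    using Lp_complete[OF p1 hL cauchy] by blast
  have "\<langle>g, \<phi>\<rangle> = T \<phi>" if \<phi>: "\<phi> \<in> Cc_inf" for \<phi>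
  proof -
    have \<phi>0: "\<phi> \<in> Cc_k 0" by (rule Cc_inf_Cc_k[OF \<phi>])
    obtain B where B: "\<And>x. \<bar>\<phi> x\<bar> \<le> B" using Cc_k_bounded[OF \<phi>0] by metis
    have "(\<lambda>n. \<langle>h n, \<phi>\<rangle> - \<langle>g, \<phi>\<rangle>) \<longlonglongrightarrow> 0"
      by (rule Lp_tendsto_test[OF p1 hL g gl Cc_k_integrable[OF \<phi>0] B order_refl])
    then have l1: "(\<lambda>n. \<langle>h n, \<phi>\<rangle>) \<longlonglongrightarrow> \<langle>g, \<phi>\<rangle>" by (rule LIM_zero_cancel)
    have "\<exists>k\<ge>n. \<bar>\<langle>h n, \<phi>\<rangle> - T \<phi>\<bar> \<le> \<bar>\<langle>f k, \<phi>\<rangle> - T \<phi>\<bar>" for n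
      using h(1)[of n] \<phi> by (auto simp: \<C>_def)
    then obtain k where k: "\<And>n. k n \<ge> n" "\<And>n. \<bar>\<langle>h n, \<phi>\<rangle> - T \<phi>\<bar> \<le> \<bar>(LINT x|lebesgue. f (k n) x * \<phi> x) - T \<phi>\<bar>" by metis
    have "filterlim k at_top sequentially"
      by (rule filterlim_at_top_mono[OF filterlim_ident]) (use k in auto)
    then have "(\<lambda>n. LINT x|lebesgue. f (k n) x * \<phi> x) \<longlonglongrightarrow> T \<phi>" by (rule filterlim_compose[OF lim[OF \<phi>]])
    then have "(\<lambda>n. (LINT x|lebesgue. f (k n) x * \<phi> x) - T \<phi>) \<longlonglongrightarrow> 0" by (rule LIM_zero)
    then have "(\<lambda>n. \<langle>h n, \<phi>\<rangle> - T \<phi>) \<longlonglongrightarrow> 0"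
      by (rule Lim_null_comparison[rotated, OF tendsto_rabs_zero]) (use k(2) in auto)
    then have "(\<lambda>n. \<langle>h n, \<phi>\<rangle>) \<longlonglongrightarrow> T \<phi>" by (rule LIM_zero_cancel)
    with l1 show ?thesis by (rule LIMSEQ_unique)
  qed
  then show ?thesis using that g by blast
qed

section \<open>Difference characterizations of \<open>W\<^sup>2\<^sup>,\<^sup>p\<close> and \<open>BV\<^sup>2\<close>\<close>

lemma Lp_functionals_imp_quadratic:
  fixes u :: "real^'n::finite \<Rightarrow> real"
  assumes p: "p \<ge> 1" "u \<in> Lp p" and v: "\<And>k l. v k l \<in> Lp p"
    and eq: "\<And>k l \<phi>. \<phi> \<in> Cc_inf \<Longrightarrow>
      \<langle>u, partial_deriv k (partial_deriv l \<phi>)\<rangle> = \<langle>v k l, \<phi>\<rangle>"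
  shows "\<exists>C\<ge>0. quadratic_diff_bounded p C u"
proof -
  define I where "I k l = Lp_mass p (v k l)" for k l
  have I: "I k l \<ge> 0" for k l unfolding I_def by (intro integral_nonneg_AE) auto
  define M where "M = (\<Sum>k\<in>UNIV. \<Sum>l\<in>UNIV. I k l)"
  have IM: "I k l \<le> M" for k l unfolding M_def by (rule member_le_double_sum) (rule I)
  have M: "M \<ge> 0" using I IM order_trans by blast
  have "dual_bounded p M (\<lambda>\<phi>. \<langle>v k l, \<phi>\<rangle>)" for k l
    using Lp_dual_bounded[OF p(1) v] IM by (simp add: I_def)
  then have "dual_bounded p M (\<lambda>\<phi>. \<langle>u, partial_deriv k (partial_deriv l \<phi>)\<rangle>)" for k l
    by (simp add: dual_bounded_def eq)
  from dual_bounded_hessian_imp_quadratic[OF p M this] show ?thesis .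
qed

text \<open>Weak second derivatives in \<open>L\<^sup>p\<close> bound the distributional second derivatives by
Young's inequality.\<close>

lemma Sobolev_imp_quadratic:
  fixes u :: "real^'n::finite \<Rightarrow> real"
  assumes p: "p \<ge> 1" and u: "u \<in> Sobolev 2 p"
  shows "\<exists>C\<ge>0. quadratic_diff_bounded p C u"
proof -
  have "\<exists>v\<in>Lp p. weak_deriv [k, l] u v" for k l using u by (auto simp: Sobolev_def)
  then obtain v where v: "\<And>k l. v k l \<in> Lp p" "\<And>k l. weak_deriv [k, l] u (v k l)" by metis
  show ?thesis
    by (rule Lp_functionals_imp_quadratic[OF p _ v(1)])
      (use u v(2) in \<open>auto simp: Sobolev_def weak_deriv_def multi_deriv_def\<close>)
qed

text \<open>By polarization the mixed difference quotients of \<open>u\<close> are bounded in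
\<open>L\<^sup>p\<close>, and paired with a test function they converge to the distributional
derivative. The weak limit is the weak second derivative. Here \<open>p > 1\<close> is essential.\<close>

lemma quadratic_imp_weak_hessian:
  fixes u :: "real^'n::finite \<Rightarrow> real"
  assumes p: "p > 1" "u \<in> Lp p" and C: "C \<ge> 0" and q: "quadratic_diff_bounded p C u"
  shows "\<exists>v\<in>Lp p. weak_deriv [i, j] u v"
proof -
  have p1: "p \<ge> 1" using p by simp
  (* Negative steps on the test function, so that the steps on \<open>u\<close> become positive after the summation by parts. *)
  define s where "s n = - ((1/2::real) ^ n)" for n :: nat
  have s: "s n \<noteq> 0" "\<bar>s n\<bar> \<le> 1" "s \<longlonglongrightarrow> 0" for n
    unfolding s_def by (auto simp: power_le_one intro!: tendsto_eq_intros LIMSEQ_power_zero)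
  have neg: "- axis k (- t) = (axis k t :: real^'n)" for k and t :: real by (auto simp: axis_def vec_eq_iff)
  define f where "f n x = 1 / (s n)\<^sup>2 * mixed_diff (axis j (- s n)) (axis i (- s n)) u x" for n x
  have f: "f n \<in> Lp p" for n unfolding f_def by (intro Lp_cmult Lp_mixed_diff p1 p)
  have fM: "Lp_mass p (f n) \<le> 2 powr p * (2 * C)" for n
  proof -
    have "Lp_mass p (f n) = (LINT x|lebesgue. (1 / (s n)\<^sup>2) powr p * \<bar>mixed_diff (axis j (- s n)) (axis i (- s n)) u x\<bar> powr p)"
      unfolding f_def abs_mult by (subst powr_mult) (auto simp del: powr_divide)
    also have "\<dots> = (1 / (s n)\<^sup>2) powr p * (LINT x|lebesgue. \<bar>mixed_diff (axis j (- s n)) (axis i (- s n)) u x\<bar> powr p)"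
      by simp
    also have "\<dots> \<le> (1 / (s n)\<^sup>2) powr p * (2 powr p * (2 * C) * (\<bar>s n\<bar>\<^sup>2) powr p)"
      by (intro mult_left_mono mixed_diff_Lp_bound[OF p1 p(2) C q]) auto
    also have "\<dots> = 2 powr p * (2 * C) * ((1 / (s n)\<^sup>2) * \<bar>s n\<bar>\<^sup>2) powr p"
      by (subst powr_mult) (simp_all add: mult_ac del: powr_divide)
    also have "(1 / (s n)\<^sup>2) * \<bar>s n\<bar>\<^sup>2 = 1" using s(1)[of n] by simp
    finally show ?thesis by simp
  qed
  have lim: "(\<lambda>n. \<langle>f n, \<phi>\<rangle>) \<longlonglongrightarrow> \<langle>u, partial_deriv i (partial_deriv j \<phi>)\<rangle>"
    if \<phi>: "\<phi> \<in> Cc_inf" for \<phi>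
  proof -
    have \<phi>2: "\<phi> \<in> Cc_k 2" and c: "partial_deriv i (partial_deriv j \<phi>) \<in> Cc_k 0"
      using \<phi> by (auto intro: Cc_inf_Cc_k partial_deriv_Cc_inf)
    obtain B R where BR: "R > 0" "\<And>n x. \<bar>mixed_diff (axis j (s n)) (axis i (s n)) \<phi> x / (s n)\<^sup>2\<bar> \<le> B"
      "\<And>n x. norm x > R \<Longrightarrow> mixed_diff (axis j (s n)) (axis i (s n)) \<phi> x / (s n)\<^sup>2 = 0"
      "\<And>x. (\<lambda>n::nat. mixed_diff (axis j (s n)) (axis i (s n)) \<phi> x / (s n)\<^sup>2) \<longlonglongrightarrow> partial_deriv i (partial_deriv j \<phi>) x"
      by (rule mixed_quotient_facts[OF \<phi>2 s, where i = j and j = i]) blast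
    have m: "\<phi> \<in> borel_measurable lebesgue" using Cc_k_measurable[OF \<phi>2] .
    have mm: "(\<lambda>x. mixed_diff a b \<phi> x / t) \<in> borel_measurable lebesgue" for a b t
      unfolding mixed_diff_def add.assoc using m measurable_shift[OF m] by measurable
    have "\<langle>f n, \<phi>\<rangle> = (LINT x|lebesgue. u x * (mixed_diff (axis j (s n)) (axis i (s n)) \<phi> x / (s n)\<^sup>2))" for n
    proof -
      have "\<langle>f n, \<phi>\<rangle> = 1 / (s n)\<^sup>2 * (LINT x|lebesgue. mixed_diff (axis j (- s n)) (axis i (- s n)) u x * \<phi> x)"
        by (simp add: f_def)
      also have "\<dots> = 1 / (s n)\<^sup>2 * (LINT x|lebesgue. u x * mixed_diff (axis j (s n)) (axis i (s n)) \<phi> x)"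
        unfolding mixed_diff_by_parts[OF p1 p(2) \<phi>2] neg ..
      finally show ?thesis by simp
    qed
    then show ?thesis using Lp_test_dominated[OF p1 p(2) mm Cc_k_measurable[OF c] BR(2,3,4)] by simp
  qed
  obtain v where "v \<in> Lp p" "\<And>\<phi>. \<phi> \<in> Cc_inf \<Longrightarrow> \<langle>v, \<phi>\<rangle> = \<langle>u, partial_deriv i (partial_deriv j \<phi>)\<rangle>"
    using Lp_weak_compactness[OF p(1) f fM lim] by metis
  then show ?thesis by (intro bexI[of _ v]) (auto simp: weak_deriv_def multi_deriv_def)
qed

lemma quadratic_imp_weak_partial:
  fixes u :: "real^'n::finite \<Rightarrow> real"
  assumes p: "p \<ge> 1" "u \<in> Lp p" and C: "C \<ge> 0" and q: "quadratic_diff_bounded p C u"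
  shows "\<exists>v\<in>Lp p. weak_deriv [i] u v"
proof -
  obtain g where "g \<in> Lp p" "\<And>\<phi>. \<phi> \<in> Cc_k 1 \<Longrightarrow> \<langle>u, partial_deriv i \<phi>\<rangle> = - \<langle>g, \<phi>\<rangle>"
    by (rule quadratic_diff_bounded_gradient[OF p C q, where i = i]) blast
  then show ?thesis using Cc_inf_Cc_k by (intro bexI[of _ g]) (auto simp: weak_deriv_def multi_deriv_def)
qed

lemma weak_deriv_Nil: "weak_deriv [] u u"
  by (simp add: weak_deriv_def multi_deriv_def)

lemma Sobolev_iff_quadratic:
  fixes u :: "real^'n::finite \<Rightarrow> real"
  assumes p: "p > 1" "u \<in> Lp p"
  shows "u \<in> Sobolev 2 p \<longleftrightarrow> (\<exists>C\<ge>0. quadratic_diff_bounded p C u)"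
proof
  assume "u \<in> Sobolev 2 p"
  then show "\<exists>C\<ge>0. quadratic_diff_bounded p C u" using p by (intro Sobolev_imp_quadratic) auto
next
  assume "\<exists>C\<ge>0. quadratic_diff_bounded p C u"
  then obtain C where C: "C \<ge> 0" "quadratic_diff_bounded p C u" by blast
  have "\<exists>v\<in>Lp p. weak_deriv \<alpha> u v" if len: "length \<alpha> \<le> 2" for \<alpha> :: "'n list"
  proof -
    consider "\<alpha> = []" | i where "\<alpha> = [i]" | i j where "\<alpha> = [i, j]"
      by (cases \<alpha>; cases "tl \<alpha>"; cases "tl (tl \<alpha>)") (use len in auto)
    then show ?thesis
    proof cases
      case 1 then show ?thesis using p weak_deriv_Nil by blast
    next
      case 2 then show ?thesis using quadratic_imp_weak_partial[OF _ p(2) C] p by simp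
    next
      case 3 then show ?thesis using quadratic_imp_weak_hessian[OF p C] by simp
    qed
  qed
  then show "u \<in> Sobolev 2 p" using p by (simp add: Sobolev_def)
qed

lemma partial_deriv_zero: "partial_deriv i (\<lambda>x. 0) = (\<lambda>x. 0)"
  using partial_deriv_eqI[OF has_derivative_const[of 0]] by (auto simp: fun_eq_iff)

lemma Cc_inf_zero: "(\<lambda>x. 0) \<in> Cc_inf"
  using Cc_inf_scale[OF bump_Cc_inf[of 1], of 0] by simp

text \<open>A matrix field with the single entry \<open>- \<phi>\<close> in position \<open>(k, l)\<close> has
Frobenius norm \<open>\<bar>\<phi>\<bar>\<close> and shows that each second derivative, as a
functional, is bounded by the variation of the gradient.\<close>

lemma BV2_imp_quadratic:
  fixes u :: "real^'n::finite \<Rightarrow> real"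
  assumes u: "u \<in> BV2"
  shows "\<exists>C\<ge>0. quadratic_diff_bounded 1 C u"
proof -
  obtain g where uS: "u \<in> Sobolev 1 1" and g: "weak_gradient u g" "g \<in> BV" using u by (auto simp: BV2_def)
  have uL: "u \<in> Lp 1" using uS by (simp add: Sobolev_def)
  have fin: "variation g < \<infinity>" using g by (simp add: BV_def)
  define M where "M = max 0 (real_of_ereal (variation g))"
  have vM: "variation g \<le> ereal M"
    using fin by (cases "variation g") (auto simp: M_def)
  have "dual_bounded 1 M (\<lambda>\<phi>. \<langle>u, partial_deriv k (partial_deriv l \<phi>)\<rangle>)" for k l
  proof (rule dual_boundedI)
    fix \<phi> :: "real^'n \<Rightarrow> real" assume \<phi>: "\<phi> \<in> Cc_inf" "admissible 1 \<phi>"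
    define \<Phi> :: "real^'n \<Rightarrow> real^'n^'n" where "\<Phi> x = axis k (axis l (- 1 * \<phi> x))" for x
    have ent: "(\<lambda>x. \<Phi> x $ i $ j) = (if i = k \<and> j = l then (\<lambda>x. - 1 * \<phi> x) else (\<lambda>x. 0))" for i j
      by (auto simp: \<Phi>_def axis_def fun_eq_iff)
    have ent_in: "(\<lambda>x. \<Phi> x $ i $ j) \<in> Cc_inf" for i j
      unfolding ent by (split if_split) (intro conjI impI Cc_inf_zero Cc_inf_scale \<phi>(1))
    have "norm (\<Phi> x) \<le> 1" for x
    proof -
      have "norm (\<Phi> x) = norm (axis l (- 1 * \<phi> x) :: real^'n)"
        unfolding \<Phi>_def by (simp add: norm_eq_sqrt_inner inner_axis_axis)
      then show ?thesis using \<phi>(2) by (simp add: admissible_def)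
    qed
    then have "ereal (\<Sum>i\<in>UNIV. LINT x|lebesgue. g x $ i * (\<Sum>j\<in>UNIV. partial_deriv j (\<lambda>y. \<Phi> y $ i $ j) x)) \<le> variation g"
      unfolding variation_def using Cc_inf_Cc_k[OF ent_in] by (intro SUP_upper) auto
    also note vM
    finally have le: "(\<Sum>i\<in>UNIV. LINT x|lebesgue. g x $ i * (\<Sum>j\<in>UNIV. partial_deriv j (\<lambda>y. \<Phi> y $ i $ j) x)) \<le> M" by simp
    have pd: "partial_deriv j (\<lambda>y. \<Phi> y $ i $ j) = (if i = k \<and> j = l then (\<lambda>x. - 1 * partial_deriv l \<phi> x) else (\<lambda>x. 0))" for i j
      unfolding ent using partial_deriv_scale[OF \<phi>(1), of l "-1"] by (auto simp: partial_deriv_zero)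
    have "(\<Sum>j\<in>UNIV. partial_deriv j (\<lambda>y. \<Phi> y $ i $ j) x) = (if i = k then - 1 * partial_deriv l \<phi> x else 0)" for i x
    proof -
      have "(\<Sum>j\<in>UNIV. partial_deriv j (\<lambda>y. \<Phi> y $ i $ j) x) = (\<Sum>j\<in>UNIV. if j = l then (if i = k then - 1 * partial_deriv l \<phi> x else 0) else 0)"
        unfolding pd by (intro sum.cong) auto
      then show ?thesis by simp
    qed
    then have "(\<Sum>i\<in>UNIV. LINT x|lebesgue. g x $ i * (\<Sum>j\<in>UNIV. partial_deriv j (\<lambda>y. \<Phi> y $ i $ j) x))
       = (\<Sum>i\<in>UNIV. if i = k then - (LINT x|lebesgue. g x $ k * partial_deriv l \<phi> x) else 0)"
      by (intro sum.cong) auto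
    also have "\<dots> = - (LINT x|lebesgue. g x $ k * partial_deriv l \<phi> x)" by simp
    also have "\<dots> = \<langle>u, partial_deriv k (partial_deriv l \<phi>)\<rangle>"
      using g(1) partial_deriv_Cc_inf[OF \<phi>(1), of l] by (auto simp: weak_gradient_def weak_deriv_def multi_deriv_def)
    finally show "\<langle>u, partial_deriv k (partial_deriv l \<phi>)\<rangle> \<le> M + dual_gauge 1 \<phi>"
      using le by (simp add: dual_gauge_def)
  qed
  from dual_bounded_hessian_imp_quadratic[OF _ uL _ this] show ?thesis by (simp add: M_def)
qed

text \<open>Moving the difference quotient of \<open>\<phi>\<close> onto that of \<open>u\<close> yields a mixed
difference, whose integral is at most \<open>4 C s\<^sup>2\<close> by polarization. The limit is
taken in the two factors simultaneously: the quotients of \<open>u\<close> converge strongly to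
\<open>g\<close>, those of \<open>\<phi>\<close> boundedly to the derivative.\<close>

lemma quadratic_imp_gradient_bounded:
  fixes u :: "real^'n::finite \<Rightarrow> real"
  assumes u: "u \<in> Lp 1" and C: "C \<ge> 0" and q: "quadratic_diff_bounded 1 C u"
    and g: "g \<in> Lp 1" and lim: "(\<lambda>k. LINT x|lebesgue. \<bar>dyadic_quotient i u k x - g x\<bar> powr 1) \<longlonglongrightarrow> 0"
    and \<phi>: "\<phi> \<in> Cc_k 1" "\<And>x. \<bar>\<phi> x\<bar> \<le> 1"
  shows "\<langle>g, partial_deriv j \<phi>\<rangle> \<le> 4 * C"
proof -
  define s where "s n = ((1/2::real) ^ n)" for n :: nat
  have s: "s n \<noteq> 0" "\<bar>s n\<bar> \<le> 1" "s \<longlonglongrightarrow> 0" for n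
    unfolding s_def by (auto simp: power_le_one intro!: LIMSEQ_power_zero)
  define \<psi> where "\<psi> n x = (\<phi> (x + axis j (s n)) - \<phi> x) / s n" for n x
  obtain B R where BR: "R > 0" "\<And>n x. \<bar>\<psi> n x\<bar> \<le> B" "\<And>n x. norm x > R \<Longrightarrow> \<psi> n x = 0"
      "\<And>x. (\<lambda>n. \<psi> n x) \<longlonglongrightarrow> partial_deriv j \<phi> x"
    unfolding \<psi>_def by (rule diff_quotient_facts[OF \<phi>(1) s, where i = j]) blast
  have m: "\<phi> \<in> borel_measurable lebesgue" "partial_deriv j \<phi> \<in> borel_measurable lebesgue"
    using Cc_k_measurable[OF \<phi>(1)] Cc_k_measurable[OF partial_deriv_Cc_k[of \<phi> 0 j]] \<phi>(1) by auto
  have \<psi>m: "\<psi> n \<in> borel_measurable lebesgue" for n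
    unfolding \<psi>_def using m(1) measurable_shift[OF m(1)] by measurable
  have \<psi>i: "integrable lebesgue (\<psi> n)" for n by (rule integrable_bounded_support[OF \<psi>m BR(2,3)])
  have B: "B \<ge> 0" using BR(2)[of 0 0] by linarith
  have \<psi>D: "(LINT x|lebesgue. \<bar>\<psi> n x\<bar>) \<le> (LINT x|lebesgue. B * indicator (cball 0 R) (x::real^'n))" for n
  proof (rule integral_mono)
    show "integrable lebesgue (\<lambda>x::real^'n. B * indicator (cball 0 R) x)"
      by (rule integrable_mult_right[OF integrable_indicator_cball])
    show "\<bar>\<psi> n x\<bar> \<le> B * indicator (cball 0 R) x" for x using BR(2)[of n x] BR(3)[of x n] by (cases "norm x > R") auto
  qed (use \<psi>i in auto)
  define f where "f n = dyadic_quotient i u n" for n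
  have f: "f n \<in> Lp 1" for n unfolding f_def by (rule Lp_dyadic_quotient[OF _ u]) simp
  have l1: "(\<lambda>n. \<langle>g, \<psi> n\<rangle>) \<longlonglongrightarrow> \<langle>g, partial_deriv j \<phi>\<rangle>"
    by (rule Lp_test_dominated[OF _ g \<psi>m m(2) BR(2,3,4)]) simp
  have "(\<lambda>n. \<langle>f n, \<psi> n\<rangle> - \<langle>g, \<psi> n\<rangle>) \<longlonglongrightarrow> 0"
    by (rule Lp_tendsto_test[OF _ f g lim[folded f_def] \<psi>i BR(2) \<psi>D]) simp
  from tendsto_add[OF this l1] have l2: "(\<lambda>n. \<langle>f n, \<psi> n\<rangle>) \<longlonglongrightarrow> \<langle>g, partial_deriv j \<phi>\<rangle>"
    by simp
  have "\<langle>f n, \<psi> n\<rangle> \<le> 4 * C" for n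
  proof -
    have neg: "- (- axis k t) = (axis k t :: real^'n)" for k and t :: real by simp
    define a :: "real^'n" where "a = axis i (s n)"
    define b :: "real^'n" where "b = - axis j (s n)"
    have nab: "norm a \<le> s n" "norm b \<le> s n" using s by (auto simp: a_def b_def s_def)
    have "\<langle>f n, \<psi> n\<rangle> = (LINT x|lebesgue. (f n (x + b) - f n x) / s n * \<phi> x)"
      unfolding first_diff_by_parts[OF order_refl f \<phi>(1)] \<psi>_def b_def neg ..
    also have "\<dots> = (LINT x|lebesgue. 1 / (s n)\<^sup>2 * (mixed_diff a b u x * \<phi> x))"
    proof (rule Bochner_Integration.integral_cong)
      fix x
      have e: "x + b + a = x + a + b" by (simp add: add_ac)
      have "f n (x + b) - f n x = mixed_diff a b u x / s n"
        unfolding f_def dyadic_quotient_def s_def[symmetric] a_def[symmetric] e mixed_diff_def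
        by (simp add: diff_divide_distrib[symmetric] algebra_simps)
      then show "(f n (x + b) - f n x) / s n * \<phi> x = 1 / (s n)\<^sup>2 * (mixed_diff a b u x * \<phi> x)"
        by (simp add: power2_eq_square)
    qed simp
    also have "\<dots> = 1 / (s n)\<^sup>2 * \<langle>mixed_diff a b u, \<phi>\<rangle>" by simp
    also have "\<dots> \<le> 1 / (s n)\<^sup>2 * (LINT x|lebesgue. \<bar>mixed_diff a b u x\<bar> powr 1)"
    proof (intro mult_left_mono integral_mono)
      have L: "mixed_diff a b u \<in> Lp 1" by (rule Lp_mixed_diff[OF _ u]) simp
      show "integrable lebesgue (\<lambda>x. mixed_diff a b u x * \<phi> x)" by (rule Lp_Cc_k_integrable[OF _ L \<phi>(1)]) simp
      show "integrable lebesgue (\<lambda>x. \<bar>mixed_diff a b u x\<bar> powr 1)" using L by (simp only: Lp_real)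
      fix x
      have "mixed_diff a b u x * \<phi> x \<le> \<bar>mixed_diff a b u x\<bar> * \<bar>\<phi> x\<bar>" by (metis abs_ge_self abs_mult)
      also have "\<dots> \<le> \<bar>mixed_diff a b u x\<bar> * 1" using \<phi>(2) by (intro mult_left_mono) auto
      finally show "mixed_diff a b u x * \<phi> x \<le> \<bar>mixed_diff a b u x\<bar> powr 1" by simp
    qed auto
    also have "\<dots> \<le> 1 / (s n)\<^sup>2 * (2 powr 1 * (2 * C) * ((s n)\<^sup>2) powr 1)"
      by (intro mult_left_mono mixed_diff_Lp_bound[OF _ u C q nab]) auto
    also have "\<dots> = 4 * C" using s(1)[of n] by simp
    finally show ?thesis .
  qed
  then show ?thesis by (intro LIMSEQ_le_const2[OF l2]) auto
qed

text \<open>The entries of a competing matrix field are bounded by 1, so the bound on the individual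
functionals, summed over the entries, bounds the variation.\<close>

lemma BV2_iff_quadratic:
  fixes u :: "real^'n::finite \<Rightarrow> real"
  assumes u: "u \<in> Lp 1"
  shows "u \<in> BV2 \<longleftrightarrow> (\<exists>C\<ge>0. quadratic_diff_bounded 1 C u)"
proof
  assume "\<exists>C\<ge>0. quadratic_diff_bounded 1 C u"
  then obtain C where C: "C \<ge> 0" and q: "quadratic_diff_bounded 1 C u" by blast
  have ex: "\<exists>g. g \<in> Lp 1 \<and> (\<lambda>k. LINT x|lebesgue. \<bar>dyadic_quotient i u k x - g x\<bar> powr 1) \<longlonglongrightarrow> 0 \<and>
     weak_deriv [i] u g" for i
  proof -
    obtain g where "g \<in> Lp 1" "(\<lambda>k. LINT x|lebesgue. \<bar>dyadic_quotient i u k x - g x\<bar> powr 1) \<longlonglongrightarrow> 0"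
      "\<And>\<phi>. \<phi> \<in> Cc_k 1 \<Longrightarrow> \<langle>u, partial_deriv i \<phi>\<rangle> = - \<langle>g, \<phi>\<rangle>"
      by (rule quadratic_diff_bounded_gradient[OF _ u C q, where i = i]) auto
    then show ?thesis using Cc_inf_Cc_k by (intro exI[of _ g]) (auto simp: weak_deriv_def multi_deriv_def)
  qed
  have "\<exists>G. \<forall>i. G i \<in> Lp 1 \<and> (\<lambda>k. LINT x|lebesgue. \<bar>dyadic_quotient i u k x - G i x\<bar> powr 1) \<longlonglongrightarrow> 0 \<and>
     weak_deriv [i] u (G i)"
    by (intro choice allI ex)
  then obtain G where G: "\<And>i. G i \<in> Lp 1" "\<And>i. weak_deriv [i] u (G i)"
    "\<And>i. (\<lambda>k. LINT x|lebesgue. \<bar>dyadic_quotient i u k x - G i x\<bar> powr 1) \<longlonglongrightarrow> 0" by blast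
  have Gm[measurable]: "G i \<in> borel_measurable lebesgue" and Gi: "integrable lebesgue (G i)" for i
    using G(1)[of i] by (auto simp: Lp_real integrable_abs_iff)
  define g :: "real^'n \<Rightarrow> real^'n" where "g x = (\<Sum>i\<in>UNIV. G i x *\<^sub>R axis i 1)" for x
  have gG: "g x $ i = G i x" for x i
    by (simp add: g_def axis_def if_distrib[of "\<lambda>c. _ * c"] cong: if_cong)
  have "u \<in> Sobolev 1 1"
  proof -
    have "\<exists>v\<in>Lp 1. weak_deriv \<alpha> u v" if len: "length \<alpha> \<le> 1" for \<alpha> :: "'n list"
    proof -
      consider "\<alpha> = []" | i where "\<alpha> = [i]" by (cases \<alpha>; cases "tl \<alpha>") (use len in auto)
      then show ?thesis using u weak_deriv_Nil G by cases blast+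
    qed
    then show ?thesis using u by (simp add: Sobolev_def)
  qed
  moreover have "weak_gradient u g" using G(2) by (simp add: weak_gradient_def gG)
  moreover have "g \<in> Lp 1"
  proof -
    have gi: "integrable lebesgue g" unfolding g_def
      by (intro Bochner_Integration.integrable_sum integrable_scaleR_left Gi)
    then show ?thesis by (auto simp: Lp_def)
  qed
  moreover have "variation g < \<infinity>"
  proof -
    have "variation g \<le> ereal (\<Sum>i\<in>(UNIV::'n set). \<Sum>j\<in>(UNIV::'n set). 4 * C)"
      unfolding variation_def
    proof (rule SUP_least)
      fix \<Phi> :: "real^'n \<Rightarrow> real^'n^'n"
      assume "\<Phi> \<in> {\<Phi>. (\<forall>i j. (\<lambda>x. \<Phi> x $ i $ j) \<in> Cc_k 1) \<and> (\<forall>x. norm (\<Phi> x) \<le> 1)}"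
      then have \<Phi>: "(\<lambda>x. \<Phi> x $ i $ j) \<in> Cc_k 1" "norm (\<Phi> x) \<le> 1" for i j x by auto
      have ent: "\<bar>\<Phi> x $ i $ j\<bar> \<le> 1" for i j x
        using component_le_norm_cart[of "\<Phi> x $ i" j] Finite_Cartesian_Product.norm_nth_le[of "\<Phi> x" i] \<Phi>(2)[of x] by simp
      have c: "partial_deriv j (\<lambda>y. \<Phi> y $ i $ j) \<in> Cc_k 0" for i j using \<Phi>(1) by (intro partial_deriv_Cc_k) simp
      have i: "integrable lebesgue (\<lambda>x. G i x * partial_deriv j (\<lambda>y. \<Phi> y $ i $ j) x)" for i j
        by (rule Lp_Cc_k_integrable[OF _ G(1) c]) simp
      have "(\<Sum>i\<in>UNIV. LINT x|lebesgue. g x $ i * (\<Sum>j\<in>UNIV. partial_deriv j (\<lambda>y. \<Phi> y $ i $ j) x))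
         = (\<Sum>i\<in>UNIV. \<Sum>j\<in>UNIV. LINT x|lebesgue. G i x * partial_deriv j (\<lambda>y. \<Phi> y $ i $ j) x)"
        using i by (simp add: gG sum_distrib_left Bochner_Integration.integral_sum)
      also have "\<dots> \<le> (\<Sum>i\<in>(UNIV::'n set). \<Sum>j\<in>(UNIV::'n set). 4 * C)"
        by (intro sum_mono quadratic_imp_gradient_bounded[OF u C q G(1) G(3) \<Phi>(1) ent])
      finally show "ereal (\<Sum>i\<in>UNIV. LINT x|lebesgue. g x $ i * (\<Sum>j\<in>UNIV. partial_deriv j (\<lambda>y. \<Phi> y $ i $ j) x))
         \<le> ereal (\<Sum>i\<in>(UNIV::'n set). \<Sum>j\<in>(UNIV::'n set). 4 * C)" by simp
    qed
    then show ?thesis by (rule le_less_trans) simp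
  qed
  ultimately show "u \<in> BV2" unfolding BV2_def BV_def by blast
qed (rule BV2_imp_quadratic)

section \<open>The non-local Hessian as an average of second differences\<close>

text \<open>The entries of the matrix \<open>(h \<otimes> h - \<bar>h\<bar>\<^sup>2 / (N + 2) I) /
\<bar>h\<bar>\<^sup>2\<close>, where \<open>N\<close> is the dimension. At \<open>h = 0\<close> the
value is 0, by the convention for division.\<close>

definition hess_kernel :: "'n \<Rightarrow> 'n \<Rightarrow> real^'n::finite \<Rightarrow> real" where
  "hess_kernel i j h = (h $ i * h $ j - (norm h)\<^sup>2 / (real CARD('n) + 2) * (if i = j then 1 else 0)) / (norm h)\<^sup>2"

lemma hess_kernel_bound: "\<bar>hess_kernel i j h\<bar> \<le> 2"
  for h :: "real^'n::finite"
proof (cases "h = 0")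
  case False
  have "\<bar>h $ i\<bar> * \<bar>h $ j\<bar> \<le> norm h * norm h" using component_le_norm_cart[of h] by (intro mult_mono) auto
  then have 1: "\<bar>h $ i * h $ j\<bar> \<le> (norm h)\<^sup>2" by (simp add: abs_mult power2_eq_square)
  have "(norm h)\<^sup>2 / (real CARD('n) + 2) \<le> (norm h)\<^sup>2 / 1" by (intro divide_left_mono) auto
  then have 2: "\<bar>(norm h)\<^sup>2 / (real CARD('n) + 2) * (if i = j then 1 else 0)\<bar> \<le> (norm h)\<^sup>2" by simp
  have "\<bar>h $ i * h $ j - (norm h)\<^sup>2 / (real CARD('n) + 2) * (if i = j then 1 else 0)\<bar> \<le> 2 * (norm h)\<^sup>2"
    using abs_triangle_ineq4[of "h $ i * h $ j" "(norm h)\<^sup>2 / (real CARD('n) + 2) * (if i = j then 1 else 0)"] 1 2 by linarith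
  then show ?thesis using False by (simp add: hess_kernel_def divide_le_eq)
qed (simp add: hess_kernel_def)

lemma hess_kernel_measurable [measurable]: "hess_kernel i j \<in> borel_measurable borel"
  unfolding hess_kernel_def[abs_def] by measurable

lemma Cc_k_borel: "\<phi> \<in> Cc_k k \<Longrightarrow> \<phi> \<in> borel_measurable borel"
  by (intro borel_measurable_continuous_onI Cc_k_continuous)

lemma lebesgue_lborel_integral:
  fixes f :: "'a::euclidean_space \<Rightarrow> real"
  assumes "f \<in> borel_measurable lebesgue" "g \<in> borel_measurable borel" "AE x in lborel. f x = g x"
  shows "integral\<^sup>L lebesgue f = integral\<^sup>L lborel g" "integrable lebesgue f \<longleftrightarrow> integrable lborel g"
proof -
  have g: "g \<in> borel_measurable lborel" using assms(2) by simp
  have ae: "AE x in lebesgue. f x = g x" by (rule AE_completion[OF assms(3)])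
  show "integral\<^sup>L lebesgue f = integral\<^sup>L lborel g"
    using integral_cong_AE[OF assms(1) borel_measurable_lebesgueI[OF assms(2)] ae] integral_completion[OF g] by simp
  show "integrable lebesgue f \<longleftrightarrow> integrable lborel g"
    using integrable_cong_AE[OF assms(1) borel_measurable_lebesgueI[OF assms(2)] ae] integrable_completion[OF g] by simp
qed

text \<open>Borel representatives on \<open>lborel\<close> are used here, since the product of two copies of the
completed measure is not complete and joint measurability would fail for Lebesgue measurable
functions.\<close>

lemma kernel_Fubini:
  fixes W :: "'a::euclidean_space \<Rightarrow> 'a \<Rightarrow> real"
  assumes W[measurable]: "(\<lambda>(h, x). W h x) \<in> borel_measurable (borel \<Otimes>\<^sub>M borel)"
    and \<kappa>: "integrable lborel \<kappa>"
    and Wi: "\<And>h. integrable lborel (W h)" and Wb: "\<And>h. (LINT x|lborel. \<bar>W h x\<bar>) \<le> B"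
  shows "integrable lborel (\<lambda>x. LINT h|lborel. \<kappa> h * W h x)"
    and "(LINT x|lborel. LINT h|lborel. \<kappa> h * W h x) = (LINT h|lborel. \<kappa> h * (LINT x|lborel. W h x))"
    and "(\<lambda>h. LINT x|lborel. W h x) \<in> borel_measurable borel"
proof -
  have \<kappa>m[measurable]: "\<kappa> \<in> borel_measurable borel" using borel_measurable_integrable[OF \<kappa>] by simp
  have meas: "(\<lambda>z. \<kappa> (fst z) * W (fst z) (snd z)) \<in> borel_measurable (lborel \<Otimes>\<^sub>M lborel)"
    using W by (simp add: split_beta') measurable
  have P: "integrable (lborel \<Otimes>\<^sub>M lborel) (\<lambda>z. \<kappa> (fst z) * W (fst z) (snd z))"
  proof (rule lborel_pair.Fubini_integrable[OF meas])
    have "integrable lborel (\<lambda>h. \<bar>\<kappa> h\<bar> * (LINT x|lborel. \<bar>W h x\<bar>))"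
    proof (rule Bochner_Integration.integrable_bound)
      show "integrable lborel (\<lambda>h. \<bar>\<kappa> h\<bar> * B)" using \<kappa> by auto
      show "(\<lambda>h. \<bar>\<kappa> h\<bar> * (LINT x|lborel. \<bar>W h x\<bar>)) \<in> borel_measurable lborel"
        using W by measurable
      show "AE h in lborel. norm (\<bar>\<kappa> h\<bar> * (LINT x|lborel. \<bar>W h x\<bar>)) \<le> norm (\<bar>\<kappa> h\<bar> * B)"
      proof (rule AE_I2)
        fix h
        have "0 \<le> (LINT x|lborel. \<bar>W h x\<bar>)" by (intro integral_nonneg_AE) auto
        then show "norm (\<bar>\<kappa> h\<bar> * (LINT x|lborel. \<bar>W h x\<bar>)) \<le> norm (\<bar>\<kappa> h\<bar> * B)"
          using Wb[of h] by (auto simp: abs_mult intro!: mult_left_mono)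
      qed
    qed
    then show "integrable lborel (\<lambda>h. LINT x|lborel. norm (\<kappa> (fst (h, x)) * W (fst (h, x)) (snd (h, x))))"
      by (simp add: abs_mult)
    show "AE h in lborel. integrable lborel (\<lambda>x. \<kappa> (fst (h, x)) * W (fst (h, x)) (snd (h, x)))"
      using Wi by (intro AE_I2) auto
  qed
  have P': "integrable (lborel \<Otimes>\<^sub>M lborel) (case_prod (\<lambda>h x. \<kappa> h * W h x))"
    using P by (simp add: split_beta')
  show "integrable lborel (\<lambda>x. LINT h|lborel. \<kappa> h * W h x)"
    by (rule lborel_pair.integrable_snd[OF P'])
  show "(LINT x|lborel. LINT h|lborel. \<kappa> h * W h x) = (LINT h|lborel. \<kappa> h * (LINT x|lborel. W h x))"
    using lborel_pair.Fubini_integral[OF P'] by simp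
  show "(\<lambda>h. LINT x|lborel. W h x) \<in> borel_measurable borel"
    using W by measurable
qed

text \<open>For \<open>\<bar>h\<bar> \<le> 1\<close> the second difference is supported in a fixed ball and
bounded by a multiple of \<open>\<bar>h\<bar>\<^sup>2\<close>; for larger \<open>h\<close> four
times the integral of \<open>\<bar>\<phi>\<bar>\<close> suffices.\<close>

lemma second_diff_L1_bound:
  fixes \<phi> :: "real^'n::finite \<Rightarrow> real"
  assumes \<phi>: "\<phi> \<in> Cc_k 2"
  obtains D where "D \<ge> 0" "\<And>h. (LINT x|lebesgue. \<bar>second_diff h \<phi> x\<bar>) \<le> D * (norm h)\<^sup>2"
proof -
  obtain R where R: "R > 0" "\<And>x. norm x > R \<Longrightarrow> \<phi> x = 0" using Cc_k_support[OF \<phi>] by metis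
  obtain B where B: "B \<ge> 0" "\<And>h x. \<bar>second_diff h \<phi> x\<bar> \<le> B * (norm h)\<^sup>2" using second_diff_bound[OF \<phi>] by metis
  define J where "J = (LINT x|lebesgue. indicator (cball (0::real^'n) (R + 1)) x :: real)"
  note iJ = integrable_indicator_cball[where 'a = "real^'n" and R = "R + 1"]
  have J: "J \<ge> 0" unfolding J_def by (intro integral_nonneg_AE) auto
  define A where "A = (LINT x|lebesgue. \<bar>\<phi> x\<bar>)"
  have A: "A \<ge> 0" unfolding A_def by (intro integral_nonneg_AE) auto
  have i\<phi>: "integrable lebesgue \<phi>" by (rule Cc_k_integrable[OF \<phi>])
  have "(LINT x|lebesgue. \<bar>second_diff h \<phi> x\<bar>) \<le> (B * J + 4 * A) * (norm h)\<^sup>2" for h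
  proof (cases "norm h \<le> 1")
    case True
    have "(LINT x|lebesgue. \<bar>second_diff h \<phi> x\<bar>) \<le> (LINT x|lebesgue. (B * (norm h)\<^sup>2) * indicator (cball 0 (R + 1)) (x::real^'n))"
    proof (rule integral_mono)
      fix x
      show "\<bar>second_diff h \<phi> x\<bar> \<le> (B * (norm h)\<^sup>2) * indicator (cball 0 (R + 1)) x"
      proof (cases "norm x \<le> R + 1")
        case False
        have "norm x \<le> norm (x + h) + norm h" "norm x \<le> norm (x - h) + norm h"
          using norm_triangle_ineq4[of "x + h" h] norm_triangle_ineq[of "x - h" h] by simp_all
        then have "norm x > R" "norm (x + h) > R" "norm (x - h) > R" using False True by linarith+
        then have "second_diff h \<phi> x = 0" using R by (simp add: second_diff_def)
        then show ?thesis using B(1) by (simp add: indicator_def)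
      qed (use B(2) in simp)
    qed (use second_diff_Cc_inf(1)[OF \<phi>] iJ in auto)
    also have "\<dots> = B * J * (norm h)\<^sup>2" by (simp add: J_def)
    also have "\<dots> \<le> (B * J + 4 * A) * (norm h)\<^sup>2" using A by (intro mult_right_mono) auto
    finally show ?thesis .
  next
    case False
    have i: "integrable lebesgue (\<lambda>x. \<bar>\<phi> (x + a)\<bar>)" for a using integrable_shift[OF i\<phi>] by auto
    have m: "(\<lambda>x. \<bar>\<phi> x\<bar>) \<in> borel_measurable lebesgue" using Cc_k_measurable[OF \<phi>] by auto
    have "(LINT x|lebesgue. \<bar>second_diff h \<phi> x\<bar>) \<le> (LINT x|lebesgue. \<bar>\<phi> (x + h)\<bar> + 2 * \<bar>\<phi> (x + 0)\<bar> + \<bar>\<phi> (x + - h)\<bar>)"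
    proof (rule integral_mono)
      show "integrable lebesgue (\<lambda>x. \<bar>\<phi> (x + h)\<bar> + 2 * \<bar>\<phi> (x + 0)\<bar> + \<bar>\<phi> (x + - h)\<bar>)"
        by (intro Bochner_Integration.integrable_add integrable_mult_right i)
      show "\<bar>second_diff h \<phi> x\<bar> \<le> \<bar>\<phi> (x + h)\<bar> + 2 * \<bar>\<phi> (x + 0)\<bar> + \<bar>\<phi> (x + - h)\<bar>" for x
        by (simp add: second_diff_def)
    qed (use second_diff_Cc_inf(1)[OF \<phi>] in auto)
    also have "\<dots> = (LINT x|lebesgue. \<bar>\<phi> (x + h)\<bar>) + 2 * (LINT x|lebesgue. \<bar>\<phi> (x + 0)\<bar>) + (LINT x|lebesgue. \<bar>\<phi> (x + - h)\<bar>)"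
      using i[of h] i[of 0] i[of "- h"] by (subst Bochner_Integration.integral_add; simp)+
    also have "\<dots> = 4 * A" using integral_shift[OF m, of h] integral_shift[OF m, of 0] integral_shift[OF m, of "- h"] by (simp add: A_def)
    also have "\<dots> \<le> (4 * A) * (norm h)\<^sup>2" using A False by (simp add: mult_left_le_one_le mult_ge1_I power2_eq_square mult_le_cancel_left1 one_le_power)
    also have "\<dots> \<le> (B * J + 4 * A) * (norm h)\<^sup>2" using B J by (intro mult_right_mono) auto
    finally show ?thesis .
  qed
  then show ?thesis using that[of "B * J + 4 * A"] A B J by simp
qed

text \<open>The quantity that the distributional non-local Hessian averages over \<open>h\<close>, both for smooth
\<open>\<phi>\<close> and, after a summation by parts, for difference quotients of \<open>u\<close>.\<close>

definition second_diff_pairing :: "(real^'n::finite \<Rightarrow> real) \<Rightarrow> (real^'n \<Rightarrow> real) \<Rightarrow> real^'n \<Rightarrow> real" where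
  "second_diff_pairing u \<phi> h = (LINT x|lebesgue. u x * (second_diff h \<phi> x / (norm h)\<^sup>2))"

lemma second_diff_pairing_by_parts:
  fixes u :: "real^'n::finite \<Rightarrow> real"
  assumes "p \<ge> 1" "u \<in> Lp p" "\<phi> \<in> Cc_k k"
  shows "(LINT x|lebesgue. (1 / (norm h)\<^sup>2 * second_diff h u x) * \<phi> x) = second_diff_pairing u \<phi> h"
proof -
  have "(LINT x|lebesgue. (1 / (norm h)\<^sup>2 * second_diff h u x) * \<phi> x) = 1 / (norm h)\<^sup>2 * \<langle>second_diff h u, \<phi>\<rangle>"
    unfolding mult.assoc by (rule integral_mult_right_zero)
  also have "\<dots> = 1 / (norm h)\<^sup>2 * \<langle>u, second_diff h \<phi>\<rangle>"
    unfolding second_diff_by_parts[OF assms] ..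
  finally show ?thesis by (simp add: second_diff_pairing_def)
qed

lemma second_diff_pairing_bound:
  fixes u :: "real^'n::finite \<Rightarrow> real"
  assumes p: "p \<ge> 1" "u \<in> Lp p" and \<phi>: "\<phi> \<in> Cc_k 2"
  obtains B where "B \<ge> 0" "\<And>h. integrable lebesgue (\<lambda>x. u x * (second_diff h \<phi> x / (norm h)\<^sup>2))"
    "\<And>h. (LINT x|lebesgue. \<bar>u x * (second_diff h \<phi> x / (norm h)\<^sup>2)\<bar>) \<le> B"
proof -
  obtain D where D: "D \<ge> 0" "\<And>h. (LINT x|lebesgue. \<bar>second_diff h \<phi> x\<bar>) \<le> D * (norm h)\<^sup>2" using second_diff_L1_bound[OF \<phi>] by metis
  obtain B where B: "B \<ge> 0" "\<And>h x. \<bar>second_diff h \<phi> x\<bar> \<le> B * (norm h)\<^sup>2" using second_diff_bound[OF \<phi>] by metis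
  define U where "U = Lp_mass p u"
  have U: "U \<ge> 0" unfolding U_def by (intro integral_nonneg_AE) auto
  have i: "integrable lebesgue (\<lambda>x. second_diff h \<phi> x / (norm h)\<^sup>2)" for h using second_diff_Cc_inf(1)[OF \<phi>] by auto
  have b: "\<bar>second_diff h \<phi> x / (norm h)\<^sup>2\<bar> \<le> B" for h x using B by (cases "h = 0") (auto simp: divide_le_eq)
  have d: "(LINT x|lebesgue. \<bar>second_diff h \<phi> x / (norm h)\<^sup>2\<bar>) \<le> D" for h
    using D by (cases "h = 0") (auto simp: divide_le_eq)
  have "(LINT x|lebesgue. \<bar>u x * (second_diff h \<phi> x / (norm h)\<^sup>2)\<bar>) \<le> D + B * U" for h
    using Lp_mult_integrable(2)[OF p i b, of h] d[of h] unfolding U_def by linarith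
  moreover have "integrable lebesgue (\<lambda>x. u x * (second_diff h \<phi> x / (norm h)\<^sup>2))" for h
    by (rule Lp_mult_integrable(1)[OF p i b])
  ultimately show ?thesis using that[of "D + B * U"] D B U by simp
qed

lemma outer_measurable [measurable]: "(outer :: real^'n::finite \<Rightarrow> real^'n^'n) \<in> borel_measurable borel"
proof (rule borel_measurable_continuous_onI)
  show "continuous_on UNIV (outer :: real^'n \<Rightarrow> real^'n^'n)"
    unfolding outer_def by (intro continuous_on_vec_lambda continuous_intros)
qed

lemma nonlocal_hessian_component:
  fixes \<phi> :: "real^'n::finite \<Rightarrow> real"
  assumes \<phi>: "\<phi> \<in> Cc_k 2" and \<rho>: "integrable lebesgue \<rho>"
  shows "nonlocal_hessian \<rho> \<phi> x $ i $ j = (real CARD('n) * (real CARD('n) + 2) / 2) *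
    (LINT h|lebesgue. (hess_kernel i j h * \<rho> h) * (second_diff h \<phi> x / (norm h)\<^sup>2))"
proof -
  obtain B where B: "B \<ge> 0" "\<And>h x. \<bar>second_diff h \<phi> x\<bar> \<le> B * (norm h)\<^sup>2" using second_diff_bound[OF \<phi>] by metis
  have b: "\<bar>second_diff h \<phi> x / (norm h)\<^sup>2\<bar> \<le> B" for h using B by (cases "h = 0") (auto simp: divide_le_eq)
  have [measurable]: "\<phi> \<in> borel_measurable borel" by (rule Cc_k_borel[OF \<phi>])
  have [measurable]: "\<rho> \<in> borel_measurable lebesgue" using \<rho> by auto
  have sm: "(\<lambda>h. second_diff h \<phi> x / (norm h)\<^sup>2) \<in> borel_measurable lebesgue"
    unfolding second_diff_def by (intro borel_measurable_lebesgueI) measurable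
  define a where "a h = (second_diff h \<phi> x / (norm h)\<^sup>2) * \<rho> h" for h
  have am[measurable]: "a \<in> borel_measurable lebesgue" unfolding a_def[abs_def] using sm by measurable
  have ai: "integrable lebesgue a"
  proof (rule Bochner_Integration.integrable_bound)
    show "integrable lebesgue (\<lambda>h. B * \<rho> h)" using \<rho> by auto
    show "AE h in lebesgue. norm (a h) \<le> norm (B * \<rho> h)"
    proof (rule AE_I2)
      fix h
      have "\<bar>second_diff h \<phi> x / (norm h)\<^sup>2\<bar> * \<bar>\<rho> h\<bar> \<le> B * \<bar>\<rho> h\<bar>" using b by (intro mult_right_mono) auto
      then show "norm (a h) \<le> norm (B * \<rho> h)" using B(1) by (simp add: a_def abs_mult)
    qed
  qed (rule am)
  define K :: "real^'n \<Rightarrow> real^'n^'n" where "K h = (1 / (norm h)\<^sup>2) *\<^sub>R (outer h - ((norm h)\<^sup>2 / (real CARD('n) + 2)) *\<^sub>R mat 1)" for h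
  have Kij: "K h $ i $ j = hess_kernel i j h" for h i j
    by (simp add: K_def hess_kernel_def outer_def mat_def)
  have "K \<in> borel_measurable borel" unfolding K_def[abs_def] by measurable
  then have Km[measurable]: "K \<in> borel_measurable lebesgue" by (intro measurable_completion) simp
  have Kb: "norm (K h) \<le> real CARD('n) * (real CARD('n) * 2)" for h
  proof -
    have "norm (K h) \<le> (\<Sum>i\<in>UNIV. norm (K h $ i))" unfolding norm_vec_def by (rule L2_set_le_sum) simp
    also have "\<dots> \<le> (\<Sum>i\<in>(UNIV::'n set). \<Sum>j\<in>(UNIV::'n set). \<bar>K h $ i $ j\<bar>)"
      by (intro sum_mono norm_le_l1_cart)
    also have "\<dots> \<le> (\<Sum>i\<in>(UNIV::'n set). \<Sum>j\<in>(UNIV::'n set). 2)"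
      by (intro sum_mono) (simp add: Kij hess_kernel_bound)
    finally show ?thesis by simp
  qed
  have int: "integrable lebesgue (\<lambda>h. a h *\<^sub>R K h)"
  proof (rule Bochner_Integration.integrable_bound)
    show "integrable lebesgue (\<lambda>h. (real CARD('n) * (real CARD('n) * 2)) * a h)" using ai by auto
    show "AE h in lebesgue. norm (a h *\<^sub>R K h) \<le> norm ((real CARD('n) * (real CARD('n) * 2)) * a h)"
    proof (rule AE_I2)
      fix h
      have "\<bar>a h\<bar> * norm (K h) \<le> \<bar>a h\<bar> * (real CARD('n) * (real CARD('n) * 2))" using Kb by (intro mult_left_mono) auto
      then show "norm (a h *\<^sub>R K h) \<le> norm ((real CARD('n) * (real CARD('n) * 2)) * a h)" by (simp add: abs_mult mult_ac)
    qed
  qed measurable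
  have bl: "bounded_linear (\<lambda>A::real^'n^'n. A $ i $ j)"
    using bounded_linear_compose[OF bounded_linear_vec_nth bounded_linear_vec_nth, of i j] by simp
  have "nonlocal_hessian \<rho> \<phi> x = (real CARD('n) * (real CARD('n) + 2) / 2) *\<^sub>R (LINT h|lebesgue. a h *\<^sub>R K h)"
    unfolding nonlocal_hessian_def a_def K_def second_diff_def ..
  then have "nonlocal_hessian \<rho> \<phi> x $ i $ j = (real CARD('n) * (real CARD('n) + 2) / 2) * ((LINT h|lebesgue. a h *\<^sub>R K h) $ i $ j)"
    by simp
  also have "(LINT h|lebesgue. a h *\<^sub>R K h) $ i $ j = (LINT h|lebesgue. (a h *\<^sub>R K h) $ i $ j)"
    by (rule integral_bounded_linear[OF bl int, symmetric])
  also have "\<dots> = (LINT h|lebesgue. (hess_kernel i j h * \<rho> h) * (second_diff h \<phi> x / (norm h)\<^sup>2))"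
    by (simp add: Kij a_def mult_ac)
  finally show ?thesis .
qed

lemma Lp_borel_version:
  fixes u :: "real^'n::finite \<Rightarrow> real"
  assumes "u \<in> borel_measurable lebesgue"
  obtains u' where "u' \<in> borel_measurable borel" "AE x in lborel. u x = u' x"
  using completion_ex_borel_measurable_real[of u lborel] assms by auto

text \<open>Fubini's theorem: instead of averaging over \<open>h\<close> first and then pairing with \<open>u\<close>,
pair first.  The dependence on \<open>\<rho>\<close> is then isolated in a weight with bounded total mass.\<close>

lemma dist_nonlocal_hessian_eq:
  fixes u :: "real^'n::finite \<Rightarrow> real"
  assumes p: "p \<ge> 1" "u \<in> Lp p" and \<phi>: "\<phi> \<in> Cc_k 2" and \<rho>: "integrable lebesgue \<rho>"
  shows "dist_nonlocal_hessian \<rho> u i j \<phi> = (real CARD('n) * (real CARD('n) + 2) / 2) *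
    (LINT h|lebesgue. (hess_kernel i j h * \<rho> h) * second_diff_pairing u \<phi> h)"
    "second_diff_pairing u \<phi> \<in> borel_measurable borel"
proof -
  define c where "c = real CARD('n) * (real CARD('n) + 2) / 2"
  have um: "u \<in> borel_measurable lebesgue" using p by (simp add: Lp_real)
  obtain u' where u'[measurable]: "u' \<in> borel_measurable borel" and uu: "AE x in lborel. u x = u' x"
    using Lp_borel_version[OF um] by metis
  have \<rho>m: "\<rho> \<in> borel_measurable lebesgue" using \<rho> by auto
  obtain \<rho>' where \<rho>'[measurable]: "\<rho>' \<in> borel_measurable borel" and \<rho>\<rho>: "AE x in lborel. \<rho> x = \<rho>' x"
    using Lp_borel_version[OF \<rho>m] by metis
  have [measurable]: "\<phi> \<in> borel_measurable borel" by (rule Cc_k_borel[OF \<phi>])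
  have hk: "hess_kernel i j \<in> borel_measurable lebesgue" by (rule borel_measurable_lebesgueI) measurable
  have sdx: "(\<lambda>h. second_diff h \<phi> x / (norm h)\<^sup>2) \<in> borel_measurable borel" for x unfolding second_diff_def by measurable
  have sdh: "(\<lambda>x. second_diff h \<phi> x / (norm h)\<^sup>2) \<in> borel_measurable borel" for h unfolding second_diff_def by measurable
  obtain B where B: "\<And>h. integrable lebesgue (\<lambda>x. u x * (second_diff h \<phi> x / (norm h)\<^sup>2))"
    "\<And>h. (LINT x|lebesgue. \<bar>u x * (second_diff h \<phi> x / (norm h)\<^sup>2)\<bar>) \<le> B"
    using second_diff_pairing_bound[OF p \<phi>] by metis
  define W where "W h x = u' x * (second_diff h \<phi> x / (norm h)\<^sup>2)" for h x
  define \<kappa> where "\<kappa> h = hess_kernel i j h * \<rho>' h" for h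
  have Wm: "(\<lambda>(h, x). W h x) \<in> borel_measurable (borel \<Otimes>\<^sub>M borel)"
    unfolding W_def second_diff_def by measurable
  have Whm: "W h \<in> borel_measurable borel" for h unfolding W_def[abs_def] using sdh by measurable
  have aeW: "AE x in lborel. u x * (second_diff h \<phi> x / (norm h)\<^sup>2) = W h x" for h
    using uu by eventually_elim (simp add: W_def)
  have m1: "(\<lambda>x. u x * (second_diff h \<phi> x / (norm h)\<^sup>2)) \<in> borel_measurable lebesgue" for h
    using um borel_measurable_lebesgueI[OF sdh] by measurable
  have Wi: "integrable lborel (W h)" for h
    using lebesgue_lborel_integral(2)[OF m1 Whm aeW] B(1) by blast
  have Wb: "(LINT x|lborel. \<bar>W h x\<bar>) \<le> B" for h
  proof -
    have "(LINT x|lebesgue. \<bar>u x * (second_diff h \<phi> x / (norm h)\<^sup>2)\<bar>) = (LINT x|lborel. \<bar>W h x\<bar>)"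
    proof (rule lebesgue_lborel_integral(1))
      show "AE x in lborel. \<bar>u x * (second_diff h \<phi> x / (norm h)\<^sup>2)\<bar> = \<bar>W h x\<bar>" using aeW[of h] by eventually_elim simp
    qed (use m1[of h] Whm[of h] in measurable)
    then show ?thesis using B(2) by metis
  qed
  have i\<rho>': "integrable lborel \<rho>'" using lebesgue_lborel_integral(2)[OF \<rho>m \<rho>' \<rho>\<rho>] \<rho> by blast
  have \<kappa>m: "\<kappa> \<in> borel_measurable borel" unfolding \<kappa>_def[abs_def] by measurable
  have i\<kappa>: "integrable lborel \<kappa>"
  proof (rule Bochner_Integration.integrable_bound)
    show "integrable lborel (\<lambda>h. 2 * \<rho>' h)" using i\<rho>' by auto
    show "AE h in lborel. norm (\<kappa> h) \<le> norm (2 * \<rho>' h)"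
      unfolding \<kappa>_def using hess_kernel_bound[of i j] by (intro AE_I2) (auto simp: abs_mult intro!: mult_right_mono)
  qed (use \<kappa>m in simp)
  note F = kernel_Fubini[OF Wm i\<kappa> Wi Wb]
  have pair: "second_diff_pairing u \<phi> h = (LINT x|lborel. W h x)" for h
    unfolding second_diff_pairing_def by (rule lebesgue_lborel_integral(1)[OF m1 Whm aeW])
  show "second_diff_pairing u \<phi> \<in> borel_measurable borel" using F(3) by (simp add: pair[abs_def])
  have comp: "nonlocal_hessian \<rho> \<phi> x $ i $ j = c * (LINT h|lborel. \<kappa> h * (second_diff h \<phi> x / (norm h)\<^sup>2))" for x
  proof -
    have "(LINT h|lebesgue. (hess_kernel i j h * \<rho> h) * (second_diff h \<phi> x / (norm h)\<^sup>2)) = (LINT h|lborel. \<kappa> h * (second_diff h \<phi> x / (norm h)\<^sup>2))"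
    proof (rule lebesgue_lborel_integral(1))
      show "AE h in lborel. (hess_kernel i j h * \<rho> h) * (second_diff h \<phi> x / (norm h)\<^sup>2) = \<kappa> h * (second_diff h \<phi> x / (norm h)\<^sup>2)"
        using \<rho>\<rho> by eventually_elim (simp add: \<kappa>_def)
      show "(\<lambda>h. (hess_kernel i j h * \<rho> h) * (second_diff h \<phi> x / (norm h)\<^sup>2)) \<in> borel_measurable lebesgue"
        using hk \<rho>m borel_measurable_lebesgueI[OF sdx] by measurable
      show "(\<lambda>h. \<kappa> h * (second_diff h \<phi> x / (norm h)\<^sup>2)) \<in> borel_measurable borel" using \<kappa>m sdx by measurable
    qed
    then show ?thesis using nonlocal_hessian_component[OF \<phi> \<rho>, of x i j] by (simp add: c_def)
  qed
  have cm: "(\<lambda>x. LINT h|lborel. \<kappa> h * (second_diff h \<phi> x / (norm h)\<^sup>2)) \<in> borel_measurable borel"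
    unfolding second_diff_def using \<kappa>m by measurable
  have "dist_nonlocal_hessian \<rho> u i j \<phi> = (LINT x|lebesgue. u x * (c * (LINT h|lborel. \<kappa> h * (second_diff h \<phi> x / (norm h)\<^sup>2))))"
    by (simp add: dist_nonlocal_hessian_def comp)
  also have "\<dots> = (LINT x|lborel. u' x * (c * (LINT h|lborel. \<kappa> h * (second_diff h \<phi> x / (norm h)\<^sup>2))))"
  proof (rule lebesgue_lborel_integral(1))
    show "AE x in lborel. u x * (c * (LINT h|lborel. \<kappa> h * (second_diff h \<phi> x / (norm h)\<^sup>2))) = u' x * (c * (LINT h|lborel. \<kappa> h * (second_diff h \<phi> x / (norm h)\<^sup>2)))"
      using uu by eventually_elim simp
  qed (use um cm borel_measurable_lebesgueI[OF cm] in measurable)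
  also have "\<dots> = c * (LINT x|lborel. LINT h|lborel. \<kappa> h * W h x)"
    by (simp add: W_def integral_mult_right_zero[symmetric] mult_ac del: integral_mult_right_zero integral_mult_left_zero)
  also have "\<dots> = c * (LINT h|lborel. \<kappa> h * second_diff_pairing u \<phi> h)"
    unfolding F(2) pair ..
  also have "(LINT h|lborel. \<kappa> h * second_diff_pairing u \<phi> h) = (LINT h|lebesgue. (hess_kernel i j h * \<rho> h) * second_diff_pairing u \<phi> h)"
  proof (rule lebesgue_lborel_integral(1)[symmetric])
    have pm: "second_diff_pairing u \<phi> \<in> borel_measurable borel" using F(3) by (simp add: pair[abs_def])
    show "AE h in lborel. (hess_kernel i j h * \<rho> h) * second_diff_pairing u \<phi> h = \<kappa> h * second_diff_pairing u \<phi> h"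
      using \<rho>\<rho> by eventually_elim (simp add: \<kappa>_def)
    show "(\<lambda>h. (hess_kernel i j h * \<rho> h) * second_diff_pairing u \<phi> h) \<in> borel_measurable lebesgue"
      using hk \<rho>m borel_measurable_lebesgueI[OF pm] by measurable
    show "(\<lambda>h. \<kappa> h * second_diff_pairing u \<phi> h) \<in> borel_measurable borel" using \<kappa>m pm by measurable
  qed
  finally show "dist_nonlocal_hessian \<rho> u i j \<phi> = (real CARD('n) * (real CARD('n) + 2) / 2) *
    (LINT h|lebesgue. (hess_kernel i j h * \<rho> h) * second_diff_pairing u \<phi> h)" by (simp add: c_def)
qed

section \<open>Fourth moments of radial densities\<close>

text \<open>Haar's uniqueness argument. In the double integral of \<open>g (T x + y)\<close> over all
\<open>x\<close> and over \<open>y\<close> in the unit ball, translations remove first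
\<open>y\<close> and then, after exchanging the integrals, \<open>T x\<close>. As the ball is
invariant under \<open>T\<close> and has finite positive measure, it cancels. An involution is its
own inverse, which spares any discussion of inverses and determinants.\<close>

lemma isometric_involution_distr_lborel:
  fixes T :: "'a::euclidean_space \<Rightarrow> 'a"
  assumes T: "linear T" "\<And>x. norm (T x) = norm x" "\<And>x. T (T x) = x"
  shows "distr lborel borel T = lborel" "T \<in> borel_measurable borel"
proof -
  show Tm: "T \<in> borel_measurable borel"
    by (intro borel_measurable_continuous_onI linear_continuous_on) (simp add: T linear_linear linear_conv_bounded_linear[symmetric])
  note [measurable] = Tm
  interpret T: linear T by fact
  define B where "B = ball (0::'a) 1"
  have [measurable]: "B \<in> sets borel" by (simp add: B_def)
  have Binf: "emeasure lborel B \<noteq> \<infinity>"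
    using emeasure_lborel_ball_finite[of "0::'a" 1] by (simp add: B_def)
  have B0: "emeasure lborel B \<noteq> 0"
  proof
    assume "emeasure lborel B = 0"
    then have "B \<in> null_sets lebesgue" by (intro null_sets_completionI) (auto simp: null_sets_def)
    then have "negligible B" by (simp add: negligible_iff_null_sets)
    then show False using open_not_negligible[of B] by (simp add: B_def)
  qed
  have inv: "(\<integral>\<^sup>+x. g (T x) \<partial>lborel) * emeasure lborel B = (\<integral>\<^sup>+x. g x \<partial>lborel) * emeasure lborel B"
    if g[measurable]: "g \<in> borel_measurable borel" for g :: "'a \<Rightarrow> ennreal"
  proof -
    have sh: "(\<integral>\<^sup>+x. f (x + a) \<partial>lborel) = (\<integral>\<^sup>+x. f x \<partial>lborel)" if "f \<in> borel_measurable borel" for f :: "'a \<Rightarrow> ennreal" and a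
    proof -
      note [measurable] = that
      have "(\<integral>\<^sup>+x. f x \<partial>lborel) = (\<integral>\<^sup>+x. f x \<partial>distr lborel borel ((+) a))" by (simp add: lborel_distr_plus)
      also have "\<dots> = (\<integral>\<^sup>+x. f (a + x) \<partial>lborel)" by (rule nn_integral_distr) measurable
      finally show ?thesis by (simp add: add.commute)
    qed
    have "(\<integral>\<^sup>+x. g (T x) \<partial>lborel) * emeasure lborel B = (\<integral>\<^sup>+y. (\<integral>\<^sup>+x. g (T x) \<partial>lborel) * indicator B y \<partial>lborel)"
      by (simp add: nn_integral_cmult)
    also have "\<dots> = (\<integral>\<^sup>+y. (\<integral>\<^sup>+x. g (T x + y) \<partial>lborel) * indicator B y \<partial>lborel)"
    proof (rule nn_integral_cong)
      fix y
      have "(\<integral>\<^sup>+x. g (T (x + T y)) \<partial>lborel) = (\<integral>\<^sup>+x. g (T x) \<partial>lborel)" by (rule sh) measurable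
      then show "(\<integral>\<^sup>+x. g (T x) \<partial>lborel) * indicator B y = (\<integral>\<^sup>+x. g (T x + y) \<partial>lborel) * indicator B y"
        by (simp add: T.add T(3))
    qed
    also have "\<dots> = (\<integral>\<^sup>+y. (\<integral>\<^sup>+x. g (T x + y) * indicator B y \<partial>lborel) \<partial>lborel)"
    proof (rule nn_integral_cong)
      fix y
      show "(\<integral>\<^sup>+x. g (T x + y) \<partial>lborel) * indicator B y = (\<integral>\<^sup>+x. g (T x + y) * indicator B y \<partial>lborel)"
        by (rule nn_integral_multc[symmetric]) measurable
    qed
    also have "\<dots> = (\<integral>\<^sup>+x. (\<integral>\<^sup>+y. g (T x + y) * indicator B y \<partial>lborel) \<partial>lborel)"
      by (rule lborel_pair.Fubini') measurable
    also have "\<dots> = (\<integral>\<^sup>+x. (\<integral>\<^sup>+y. g y * indicator B (y - T x) \<partial>lborel) \<partial>lborel)"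
    proof (rule nn_integral_cong)
      fix x
      have "(\<integral>\<^sup>+y. (\<lambda>y. g y * indicator B (y - T x)) (y + T x) \<partial>lborel) = (\<integral>\<^sup>+y. g y * indicator B (y - T x) \<partial>lborel)"
        by (rule sh) measurable
      then show "(\<integral>\<^sup>+y. g (T x + y) * indicator B y \<partial>lborel) = (\<integral>\<^sup>+y. g y * indicator B (y - T x) \<partial>lborel)"
        by (simp add: add.commute)
    qed
    also have "\<dots> = (\<integral>\<^sup>+y. (\<integral>\<^sup>+x. g y * indicator B (y - T x) \<partial>lborel) \<partial>lborel)"
      by (rule lborel_pair.Fubini') measurable
    also have "\<dots> = (\<integral>\<^sup>+y. g y * emeasure lborel B \<partial>lborel)"
    proof (rule nn_integral_cong)
      fix y
      (* Invariance of the ball under \<open>T\<close> and under \<open>x \<mapsto> - x\<close>. *)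
      have e: "indicator B (y - T x) = (indicator B (x + - T y) :: ennreal)" for x
      proof -
        have "norm (y - T x) = norm (T (y - T x))" by (simp add: T)
        also have "\<dots> = norm (x - T y)" by (simp add: T.diff T(3) norm_minus_commute)
        finally show ?thesis by (simp add: B_def indicator_def)
      qed
      have "(\<integral>\<^sup>+x. g y * indicator B (y - T x) \<partial>lborel) = g y * (\<integral>\<^sup>+x. indicator B (x + - T y) \<partial>lborel)"
        unfolding e by (rule nn_integral_cmult) measurable
      also have "(\<integral>\<^sup>+x. indicator B (x + - T y) \<partial>lborel) = (\<integral>\<^sup>+x. indicator B x \<partial>lborel)"
        by (rule sh) measurable
      finally show "(\<integral>\<^sup>+x. g y * indicator B (y - T x) \<partial>lborel) = g y * emeasure lborel B" by simp
    qed
    also have "\<dots> = (\<integral>\<^sup>+x. g x \<partial>lborel) * emeasure lborel B" by (rule nn_integral_multc) measurable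
    finally show ?thesis .
  qed
  show "distr lborel borel T = lborel"
  proof (rule measure_eqI)
    fix A :: "'a set" assume "A \<in> sets (distr lborel borel T)"
    then have [measurable]: "A \<in> sets borel" by simp
    have "emeasure (distr lborel borel T) A = (\<integral>\<^sup>+x. indicator A x \<partial>distr lborel borel T)" by simp
    also have "\<dots> = (\<integral>\<^sup>+x. indicator A (T x) \<partial>lborel)" by (rule nn_integral_distr) measurable
    finally have e: "emeasure (distr lborel borel T) A = (\<integral>\<^sup>+x. indicator A (T x) \<partial>lborel)" .
    have "emeasure (distr lborel borel T) A * emeasure lborel B = emeasure lborel A * emeasure lborel B"
      unfolding e using inv[of "indicator A"] by simp
    then show "emeasure (distr lborel borel T) A = emeasure lborel A"
      using B0 Binf ennreal_mult_cancel_left[of "emeasure lborel B"] by (simp add: mult.commute[of _ "emeasure lborel B"])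
  qed simp
qed

text \<open>Radial symmetry is assumed almost everywhere only, because a Borel version of a radial function need
not be radial at every point.  Linear isometric involutions are the only symmetries required: sign changes,
transpositions of coordinates and the reflection \<open>rot\<close> determine all moments of order four.\<close>

locale radial_density =
  fixes \<rho> :: "real^'n::finite \<Rightarrow> real"
  assumes borel [measurable]: "\<rho> \<in> borel_measurable borel"
    and int: "integrable lborel \<rho>" and mass: "(LINT h|lborel. \<rho> h) = 1"
    and radial: "\<And>T. linear T \<Longrightarrow> (\<And>x. norm (T x) = norm x) \<Longrightarrow> (\<And>x. T (T x) = x) \<Longrightarrow> AE h in lborel. \<rho> (T h) = \<rho> h"
begin

lemma integral_invariant:
  assumes T: "linear T" "\<And>x. norm (T x) = norm x" "\<And>x. T (T x) = x"
    and f[measurable]: "f \<in> borel_measurable borel"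
  shows "(LINT h|lborel. f (T h) * \<rho> h) = (LINT h|lborel. f h * \<rho> h)"
proof -
  note [measurable] = isometric_involution_distr_lborel(2)[OF T]
  have "(LINT h|lborel. f h * \<rho> h) = (LINT h|distr lborel borel T. f h * \<rho> h)"
    by (simp add: isometric_involution_distr_lborel(1)[OF T])
  also have "\<dots> = (LINT h|lborel. f (T h) * \<rho> (T h))" by (rule integral_distr) measurable
  also have "\<dots> = (LINT h|lborel. f (T h) * \<rho> h)"
  proof (rule integral_cong_AE)
    show "AE h in lborel. f (T h) * \<rho> (T h) = f (T h) * \<rho> h" using radial[OF T] by eventually_elim simp
  qed measurable
  finally show ?thesis ..
qed

text \<open>The fourth moments of the direction \<open>h / \<bar>h\<bar>\<close> under the density
\<open>\<rho>\<close>, hence those of the uniform distribution on the sphere.\<close>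

definition m4 :: "'n \<Rightarrow> 'n \<Rightarrow> 'n \<Rightarrow> 'n \<Rightarrow> real" where
  "m4 k l i j = (LINT h|lborel. (h $ k * h $ l * h $ i * h $ j / norm h ^ 4) * \<rho> h)"

lemma m4_integrable: "integrable lborel (\<lambda>h. (h $ k * h $ l * h $ i * h $ j / norm h ^ 4) * \<rho> h)"
proof (rule Bochner_Integration.integrable_bound[OF int])
  show "AE h in lborel. norm ((h $ k * h $ l * h $ i * h $ j / norm h ^ 4) * \<rho> h) \<le> norm (\<rho> h)"
  proof (rule AE_I2)
    fix h :: "real^'n"
    have "\<bar>h $ k\<bar> * \<bar>h $ l\<bar> * \<bar>h $ i\<bar> * \<bar>h $ j\<bar> \<le> norm h * norm h * norm h * norm h"
      using component_le_norm_cart[of h] by (intro mult_mono) auto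
    then have "\<bar>h $ k * h $ l * h $ i * h $ j / norm h ^ 4\<bar> \<le> 1"
      by (simp add: abs_mult divide_le_eq power4_eq_xxxx zero_less_mult_iff)
    then have "\<bar>h $ k * h $ l * h $ i * h $ j / norm h ^ 4\<bar> * \<bar>\<rho> h\<bar> \<le> 1 * \<bar>\<rho> h\<bar>" by (intro mult_right_mono) auto
    then show "norm ((h $ k * h $ l * h $ i * h $ j / norm h ^ 4) * \<rho> h) \<le> norm (\<rho> h)" by (simp only: real_norm_def abs_mult mult_1)
  qed
qed measurable

lemma norm_sq_cart: "(norm h)\<^sup>2 = (\<Sum>k\<in>UNIV. h $ k * h $ k)" for h :: "real^'n"
  by (simp add: power2_norm_eq_inner inner_vec_def)

definition flip :: "'n \<Rightarrow> real^'n \<Rightarrow> real^'n" where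
  "flip m h = (\<chi> k. if k = m then - (h $ k) else h $ k)"

lemma flip: "linear (flip m)" "norm (flip m h) = norm h" "flip m (flip m h) = h"
proof -
  show "linear (flip m)" by (rule linearI) (auto simp: flip_def vec_eq_iff)
  have "(norm (flip m h))\<^sup>2 = (norm h)\<^sup>2" unfolding norm_sq_cart by (intro sum.cong) (auto simp: flip_def)
  then show "norm (flip m h) = norm h" by simp
  show "flip m (flip m h) = h" by (auto simp: flip_def vec_eq_iff)
qed

lemma sum_UNIV_split2: "i \<noteq> j \<Longrightarrow> (\<Sum>k\<in>UNIV. f k) = f i + f j + (\<Sum>k\<in>UNIV - {i, j}. f k)"
  for f :: "'n \<Rightarrow> real"
  using sum.subset_diff[of "{i, j}" UNIV f] by simp

definition swap :: "'n \<Rightarrow> 'n \<Rightarrow> real^'n \<Rightarrow> real^'n" where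
  "swap i j h = (\<chi> k. if k = i then h $ j else if k = j then h $ i else h $ k)"

lemma swap:
  assumes ij: "i \<noteq> j"
  shows "linear (swap i j)" "norm (swap i j h) = norm h" "swap i j (swap i j h) = h"
proof -
  show "linear (swap i j)" by (rule linearI) (auto simp: swap_def vec_eq_iff)
  have "(norm (swap i j h))\<^sup>2 = (norm h)\<^sup>2"
    unfolding norm_sq_cart sum_UNIV_split2[OF ij] using ij by (simp add: swap_def)
  then show "norm (swap i j h) = norm h" by simp
  show "swap i j (swap i j h) = h" by (auto simp: swap_def vec_eq_iff)
qed

text \<open>The reflection in the plane of the coordinates \<open>i\<close> and \<open>j\<close> that sends them to
\<open>(h\<^sub>i + h\<^sub>j) / \<surd>2\<close> and \<open>(h\<^sub>i - h\<^sub>j) / \<surd>2\<close>.\<close>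

definition rot :: "'n \<Rightarrow> 'n \<Rightarrow> real^'n \<Rightarrow> real^'n" where
  "rot i j h = (\<chi> k. if k = i then (h $ i + h $ j) / sqrt 2 else if k = j then (h $ i - h $ j) / sqrt 2 else h $ k)"

lemma rot:
  assumes ij: "i \<noteq> j"
  shows "linear (rot i j)" "norm (rot i j h) = norm h" "rot i j (rot i j h) = h"
proof -
  show "linear (rot i j)" by (rule linearI) (auto simp: rot_def vec_eq_iff add_divide_distrib diff_divide_distrib algebra_simps)
  note split = sum_UNIV_split2[OF ij]
  have "(norm (rot i j h))\<^sup>2 = ((h $ i + h $ j) / sqrt 2)\<^sup>2 + ((h $ i - h $ j) / sqrt 2)\<^sup>2 + (\<Sum>k\<in>UNIV - {i, j}. h $ k * h $ k)"
    unfolding norm_sq_cart split using ij by (simp add: rot_def power2_eq_square)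
  also have "\<dots> = (norm h)\<^sup>2" unfolding norm_sq_cart split
    by (simp add: power_divide power2_eq_square field_simps)
  finally show "norm (rot i j h) = norm h" by simp
  show "rot i j (rot i j h) = h" using ij
    by (auto simp: rot_def vec_eq_iff add_divide_distrib[symmetric] diff_divide_distrib[symmetric])
qed

text \<open>A sign change of one coordinate kills every moment in which this coordinate occurs to an odd power.\<close>

lemma m4_odd:
  assumes "\<And>h. flip m h $ k * flip m h $ l * flip m h $ i * flip m h $ j = - (h $ k * h $ l * h $ i * h $ j)"
  shows "m4 k l i j = 0"
proof -
  have "(LINT h|lborel. (\<lambda>h. h $ k * h $ l * h $ i * h $ j / norm h ^ 4) (flip m h) * \<rho> h) = m4 k l i j"
    unfolding m4_def by (rule integral_invariant[OF flip]) measurable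
  moreover have "(LINT h|lborel. (\<lambda>h. h $ k * h $ l * h $ i * h $ j / norm h ^ 4) (flip m h) * \<rho> h) = - m4 k l i j"
    by (simp add: assms flip m4_def)
  ultimately show ?thesis by simp
qed

lemma m4_offdiag: "k \<noteq> l \<Longrightarrow> m4 k l i i = 0"
  by (rule m4_odd[of k]) (auto simp: flip_def)

lemma m4_offpair:
  assumes "i \<noteq> j" "\<not> (k = i \<and> l = j)" "\<not> (k = j \<and> l = i)"
  shows "m4 k l i j = 0"
proof (cases "(k = i) = (l = i)")
  case True
  then show ?thesis using assms by (intro m4_odd[of i]) (auto simp: flip_def)
next
  case False
  then show ?thesis using assms by (intro m4_odd[of j]) (auto simp: flip_def)
qed

lemma m4_perm: "m4 i j i j = m4 i i j j" "m4 j i i j = m4 i i j j"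
  by (simp_all add: m4_def mult_ac)

lemma m4_swap: "m4 i i i i = m4 j j j j"
proof (cases "i = j")
  case False
  have "(LINT h|lborel. (\<lambda>h. h $ i * h $ i * h $ i * h $ i / norm h ^ 4) (swap i j h) * \<rho> h) = m4 i i i i"
    unfolding m4_def by (rule integral_invariant[OF swap[OF False]]) measurable
  moreover have "swap i j h $ i = h $ j" for h by (simp add: swap_def)
  ultimately show ?thesis by (simp add: swap[OF False] m4_def[of j])
qed simp

text \<open>Under the reflection, \<open>h\<^sub>i\<^sup>2 h\<^sub>j\<^sup>2\<close> becomes
\<open>(h\<^sub>i\<^sup>2 - h\<^sub>j\<^sup>2)\<^sup>2 / 4\<close>. This is the only relation
between the two kinds of nonzero moments, and the reason why one is three times the other.\<close>

lemma m4_rot: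
  assumes "i \<noteq> j"
  shows "6 * m4 i i j j = m4 i i i i + m4 j j j j"
proof -
  have "m4 i i j j = (LINT h|lborel. (\<lambda>h. h $ i * h $ i * h $ j * h $ j / norm h ^ 4) (rot i j h) * \<rho> h)"
    unfolding m4_def by (rule integral_invariant[OF rot[OF assms], symmetric]) measurable
  also have "\<dots> = (LINT h|lborel. ((h $ i * h $ i * h $ i * h $ i / norm h ^ 4) * \<rho> h + (h $ j * h $ j * h $ j * h $ j / norm h ^ 4) * \<rho> h
      - 2 * ((h $ i * h $ i * h $ j * h $ j / norm h ^ 4) * \<rho> h)) / 4)"
  proof (intro Bochner_Integration.integral_cong refl)
    fix h :: "real^'n"
    have alg: "((a + b - 2 * c) / 4) / n * r = (a / n * r + b / n * r - 2 * (c / n * r)) / 4" for a b c n r :: real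
      by (cases "n = 0") (auto simp: field_simps)
    have "rot i j h $ i * rot i j h $ i * rot i j h $ j * rot i j h $ j
      = (h $ i * h $ i * h $ i * h $ i + h $ j * h $ j * h $ j * h $ j - 2 * (h $ i * h $ i * h $ j * h $ j)) / 4"
      using assms by (simp add: rot_def) (simp add: field_simps)
    then show "(\<lambda>h. h $ i * h $ i * h $ j * h $ j / norm h ^ 4) (rot i j h) * \<rho> h = ((h $ i * h $ i * h $ i * h $ i / norm h ^ 4) * \<rho> h + (h $ j * h $ j * h $ j * h $ j / norm h ^ 4) * \<rho> h
      - 2 * ((h $ i * h $ i * h $ j * h $ j / norm h ^ 4) * \<rho> h)) / 4"
      by (simp only: rot(2)[OF assms] alg)
  qed
  also have "\<dots> = (m4 i i i i + m4 j j j j - 2 * m4 i i j j) / 4"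
  proof -
    have "(LINT h|lborel. (f h + g h - 2 * k h) / 4) = ((LINT h|lborel. f h) + (LINT h|lborel. g h) - 2 * (LINT h|lborel. k h)) / 4"
      if "integrable lborel f" "integrable lborel g" "integrable lborel k" for f g k :: "real^'n \<Rightarrow> real"
      using that by simp
    then show ?thesis unfolding m4_def by (blast intro: m4_integrable)
  qed
  finally show ?thesis by simp
qed

lemma m4_sum: "(\<Sum>m\<in>UNIV. m4 k l m m) = (LINT h|lborel. (h $ k * h $ l / (norm h)\<^sup>2) * \<rho> h)"
proof -
  have "(\<Sum>m\<in>UNIV. m4 k l m m) = (LINT h|lborel. (\<Sum>m\<in>UNIV. (h $ k * h $ l * h $ m * h $ m / norm h ^ 4) * \<rho> h))"
    unfolding m4_def by (rule Bochner_Integration.integral_sum[symmetric]) (rule m4_integrable)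
  also have "\<dots> = (LINT h|lborel. (h $ k * h $ l / (norm h)\<^sup>2) * \<rho> h)"
  proof (intro Bochner_Integration.integral_cong refl)
    fix h :: "real^'n"
    have "(\<Sum>m\<in>UNIV. (h $ k * h $ l * h $ m * h $ m / norm h ^ 4) * \<rho> h) = (h $ k * h $ l * (norm h)\<^sup>2 / norm h ^ 4) * \<rho> h"
      unfolding norm_sq_cart by (simp add: sum_distrib_left sum_distrib_right sum_divide_distrib mult.assoc)
    then show "(\<Sum>m\<in>UNIV. (h $ k * h $ l * h $ m * h $ m / norm h ^ 4) * \<rho> h) = (h $ k * h $ l / (norm h)\<^sup>2) * \<rho> h"
      by (simp add: power4_eq_xxxx power2_eq_square)
  qed
  finally show ?thesis .
qed

lemma m2_integrable: "integrable lborel (\<lambda>h. (h $ k * h $ l / (norm h)\<^sup>2) * \<rho> h)"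
proof (rule Bochner_Integration.integrable_bound[OF int])
  show "AE h in lborel. norm ((h $ k * h $ l / (norm h)\<^sup>2) * \<rho> h) \<le> norm (\<rho> h)"
  proof (rule AE_I2)
    fix h :: "real^'n"
    have "\<bar>h $ k\<bar> * \<bar>h $ l\<bar> \<le> norm h * norm h"
      using component_le_norm_cart[of h] by (intro mult_mono) auto
    then have "\<bar>h $ k * h $ l / (norm h)\<^sup>2\<bar> \<le> 1" by (simp add: abs_mult divide_le_eq power2_eq_square zero_less_mult_iff)
    then have "\<bar>h $ k * h $ l / (norm h)\<^sup>2\<bar> * \<bar>\<rho> h\<bar> \<le> 1 * \<bar>\<rho> h\<bar>" by (intro mult_right_mono) auto
    then show "norm ((h $ k * h $ l / (norm h)\<^sup>2) * \<rho> h) \<le> norm (\<rho> h)" by (simp only: real_norm_def abs_mult mult_1)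
  qed
qed measurable

lemma m2_sum: "(\<Sum>k\<in>UNIV. LINT h|lborel. (h $ k * h $ k / (norm h)\<^sup>2) * \<rho> h) = 1"
proof -
  have "(\<Sum>k\<in>UNIV. LINT h|lborel. (h $ k * h $ k / (norm h)\<^sup>2) * \<rho> h) = (LINT h|lborel. (\<Sum>k\<in>UNIV. (h $ k * h $ k / (norm h)\<^sup>2) * \<rho> h))"
    by (rule Bochner_Integration.integral_sum[symmetric]) (rule m2_integrable)
  also have "\<dots> = (LINT h|lborel. \<rho> h)"
  proof (rule integral_cong_AE)
    show "AE h in lborel. (\<Sum>k\<in>UNIV. (h $ k * h $ k / (norm h)\<^sup>2) * \<rho> h) = \<rho> h"
      using AE_lborel_singleton[of 0]
    proof eventually_elim
      case (elim h)
      have "(\<Sum>k\<in>UNIV. (h $ k * h $ k / (norm h)\<^sup>2) * \<rho> h) = ((\<Sum>k\<in>UNIV. h $ k * h $ k) / (norm h)\<^sup>2) * \<rho> h"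
        by (simp only: sum_distrib_right sum_divide_distrib)
      then show ?case unfolding norm_sq_cart[symmetric] using elim by simp
    qed
  qed measurable
  finally show ?thesis using mass by simp
qed

definition sphere_moment :: real where "sphere_moment = 1 / (real CARD('n) * (real CARD('n) + 2))"

text \<open>By symmetry there are a single diagonal value \<open>A\<close> and, by \<open>m4_rot\<close>, the
off-diagonal value \<open>A / 3\<close>.  The sum over all pairs is 1, because
\<open>(\<Sum>i. h\<^sub>i\<^sup>2)\<^sup>2 = \<bar>h\<bar>\<^sup>4\<close>.\<close>

lemma m4_values: "m4 i i i i = 3 * sphere_moment" "i \<noteq> j \<Longrightarrow> m4 i i j j = sphere_moment"
proof -
  fix i0 :: 'n
  define A where "A = m4 i0 i0 i0 i0"
  have d: "m4 i i i i = A" for i unfolding A_def by (rule m4_swap)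
  have o: "m4 i i j j = A / 3" if "i \<noteq> j" for i j using m4_rot[OF that] d by simp
  have row: "(\<Sum>m\<in>UNIV. m4 k k m m) = (real CARD('n) + 2) * A / 3" for k
  proof -
    have "(\<Sum>m\<in>UNIV. m4 k k m m) = m4 k k k k + (\<Sum>m\<in>UNIV - {k}. m4 k k m m)" by (rule sum.remove) auto
    also have "(\<Sum>m\<in>UNIV - {k}. m4 k k m m) = (\<Sum>m\<in>UNIV - {k}. A / 3)" by (intro sum.cong refl o) auto
    also have "\<dots> = (real CARD('n) - 1) * (A / 3)" by (simp add: card_Diff_singleton of_nat_diff Suc_leI)
    finally show ?thesis by (simp add: d field_simps)
  qed
  have "1 = (\<Sum>k\<in>(UNIV::'n set). (real CARD('n) + 2) * A / 3)"
    using m2_sum unfolding m4_sum[symmetric] row by simp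
  then have "real CARD('n) * (real CARD('n) + 2) * A = 3" by simp
  then have A3: "A * (real CARD('n) * (real CARD('n) + 2)) = 3" by (simp only: mult_ac)
  have "real CARD('n) * (real CARD('n) + 2) \<noteq> 0" by (simp add: add_nonneg_eq_0_iff)
  then have "A = 3 / (real CARD('n) * (real CARD('n) + 2))"
    using A3 by (rule nonzero_eq_divide_eq[THEN iffD2])
  then have "A = 3 * sphere_moment" by (simp add: sphere_moment_def)
  then show "m4 i i i i = 3 * sphere_moment" "i \<noteq> j \<Longrightarrow> m4 i i j j = sphere_moment" using d o by auto
qed

text \<open>The algebraic reason for the constants in the non-local Hessian: averaged against a radial density,
the kernel recovers each entry of a symmetric matrix from the quadratic form of that matrix.  The fourth
moments alone would yield \<open>2 b i j\<close> plus the trace on the diagonal, up to a common factor,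
and the multiple of the identity in the kernel removes the trace.\<close>

lemma quadratic_form_kernel:
  assumes b: "\<And>k l. b k l = b l k"
  shows "(real CARD('n) * (real CARD('n) + 2) / 2) *
     (LINT h|lborel. (hess_kernel i j h * \<rho> h) * (\<Sum>k\<in>UNIV. \<Sum>l\<in>UNIV. h $ k * h $ l / (norm h)\<^sup>2 * b k l)) = b i j"
proof -
  (* The entry of the identity matrix that is subtracted in the kernel. *)
  define s where "s = (if i = j then 1 / (real CARD('n) + 2) else 0)"
  define m2 where "m2 k l = (LINT h|lborel. (h $ k * h $ l / (norm h)\<^sup>2) * \<rho> h)" for k l
  (* Second moments are sums of fourth moments, as \<open>\<bar>h\<bar>\<^sup>2\<close> is the sum of the squares of the coordinates. *)
  have m2v: "m2 k l = (if k = l then (real CARD('n) + 2) * sphere_moment else 0)" for k l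
  proof (cases "k = l")
    case True
    have "m2 k k = (\<Sum>m\<in>UNIV. m4 k k m m)" unfolding m2_def m4_sum ..
    also have "\<dots> = m4 k k k k + (\<Sum>m\<in>UNIV - {k}. m4 k k m m)" by (rule sum.remove) auto
    also have "(\<Sum>m\<in>UNIV - {k}. m4 k k m m) = (\<Sum>m\<in>UNIV - {k}. sphere_moment)" by (intro sum.cong refl m4_values(2)) auto
    also have "\<dots> = (real CARD('n) - 1) * sphere_moment" by (simp add: card_Diff_singleton of_nat_diff Suc_leI)
    finally show ?thesis using True by (simp add: m4_values field_simps)
  next
    case False
    have "m2 k l = (\<Sum>m\<in>UNIV. m4 k l m m)" unfolding m2_def m4_sum ..
    then show ?thesis using False by (simp add: m4_offdiag)
  qed
  have I: "integrable lborel (\<lambda>h. b k l * ((h $ k * h $ l * h $ i * h $ j / norm h ^ 4) * \<rho> h - s * ((h $ k * h $ l / (norm h)\<^sup>2) * \<rho> h)))" for k l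
    by (intro integrable_mult_right Bochner_Integration.integrable_diff m4_integrable m2_integrable)
  have "(LINT h|lborel. (hess_kernel i j h * \<rho> h) * (\<Sum>k\<in>UNIV. \<Sum>l\<in>UNIV. h $ k * h $ l / (norm h)\<^sup>2 * b k l))
    = (LINT h|lborel. (\<Sum>k\<in>UNIV. \<Sum>l\<in>UNIV. b k l * ((h $ k * h $ l * h $ i * h $ j / norm h ^ 4) * \<rho> h - s * ((h $ k * h $ l / (norm h)\<^sup>2) * \<rho> h))))"
  proof (intro Bochner_Integration.integral_cong refl)
    fix h :: "real^'n"
    have "(hess_kernel i j h * \<rho> h) * (h $ k * h $ l / (norm h)\<^sup>2 * b k l)
      = b k l * ((h $ k * h $ l * h $ i * h $ j / norm h ^ 4) * \<rho> h - s * ((h $ k * h $ l / (norm h)\<^sup>2) * \<rho> h))" for k l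
    proof (cases "h = 0")
      case False
      have "hess_kernel i j h = h $ i * h $ j / (norm h)\<^sup>2 - s"
        using False by (simp add: hess_kernel_def s_def diff_divide_distrib)
      then show ?thesis by (simp only:) (simp add: power4_eq_xxxx power2_eq_square divide_inverse algebra_simps)
    qed simp
    then show "(hess_kernel i j h * \<rho> h) * (\<Sum>k\<in>UNIV. \<Sum>l\<in>UNIV. h $ k * h $ l / (norm h)\<^sup>2 * b k l)
      = (\<Sum>k\<in>UNIV. \<Sum>l\<in>UNIV. b k l * ((h $ k * h $ l * h $ i * h $ j / norm h ^ 4) * \<rho> h - s * ((h $ k * h $ l / (norm h)\<^sup>2) * \<rho> h)))"
      by (simp only: sum_distrib_left)
  qed
  also have "\<dots> = (\<Sum>k\<in>UNIV. LINT h|lborel. (\<Sum>l\<in>UNIV. b k l * ((h $ k * h $ l * h $ i * h $ j / norm h ^ 4) * \<rho> h - s * ((h $ k * h $ l / (norm h)\<^sup>2) * \<rho> h))))"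
    by (rule Bochner_Integration.integral_sum) (intro Bochner_Integration.integrable_sum I)
  also have "\<dots> = (\<Sum>k\<in>UNIV. \<Sum>l\<in>UNIV. LINT h|lborel. b k l * ((h $ k * h $ l * h $ i * h $ j / norm h ^ 4) * \<rho> h - s * ((h $ k * h $ l / (norm h)\<^sup>2) * \<rho> h)))"
    by (intro sum.cong refl Bochner_Integration.integral_sum I)
  also have "\<dots> = (\<Sum>k\<in>UNIV. \<Sum>l\<in>UNIV. b k l * (m4 k l i j - s * m2 k l))"
  proof -
    have "(LINT h|lborel. b * (f h - s * g h)) = b * ((LINT h|lborel. f h) - s * (LINT h|lborel. g h))"
      if "integrable lborel f" "integrable lborel g" for f g :: "real^'n \<Rightarrow> real" and b
      using that by simp
    then show ?thesis unfolding m4_def m2_def by (intro sum.cong refl) (blast intro: m4_integrable m2_integrable)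
  qed
  also have "\<dots> = 2 * sphere_moment * b i j"
  proof (cases "i = j")
    case True
    have "b k l * (m4 k l i j - s * m2 k l) = (if l = k then (if k = i then 2 * sphere_moment * b i j else 0) else 0)" for k l
    proof -
      have "s * ((real CARD('n) + 2) * sphere_moment) = sphere_moment" using True by (simp add: s_def add_nonneg_eq_0_iff)
      then show ?thesis using True m4_values[of k] m4_values(2)[of k i]
        by (auto simp: m2v m4_offdiag)
    qed
    then show ?thesis by simp
  next
    case False
    have "b k l * (m4 k l i j - s * m2 k l) = (if l = j then (if k = i then sphere_moment * b i j else 0) else 0) + (if l = i then (if k = j then sphere_moment * b i j else 0) else 0)" for k l
    proof -
      have "s = 0" using False by (simp add: s_def)
      then show ?thesis using False m4_offpair[of i j k l] m4_perm(1)[of i j] m4_perm(2)[where i = i and j = j] m4_values(2)[of i j] b[of i j] by auto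
    qed
    then show ?thesis by (simp add: sum.distrib)
  qed
  finally show ?thesis by (simp add: sphere_moment_def add_nonneg_eq_0_iff)
qed

end

section \<open>Convergence and boundedness of non-local Hessians\<close>

lemma radial_density_version:
  fixes \<rho> :: "real^'n::finite \<Rightarrow> real"
  assumes radial: "\<And>x y. norm x = norm y \<Longrightarrow> \<rho> x = \<rho> y" and mass: "has_bochner_integral lebesgue \<rho> 1"
  obtains \<rho>' where "radial_density \<rho>'" "AE x in lborel. \<rho> x = \<rho>' x"
proof -
  have i: "integrable lebesgue \<rho>" "integral\<^sup>L lebesgue \<rho> = 1" using mass by (auto simp: has_bochner_integral_iff)
  then have m: "\<rho> \<in> borel_measurable lebesgue" by auto
  obtain \<rho>' where \<rho>': "\<rho>' \<in> borel_measurable borel" "AE x in lborel. \<rho> x = \<rho>' x"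
    using Lp_borel_version[OF m] by metis
  have "radial_density \<rho>'"
  proof
    show "\<rho>' \<in> borel_measurable borel" by (rule \<rho>')
    show "integrable lborel \<rho>'" "integral\<^sup>L lborel \<rho>' = 1"
      using lebesgue_lborel_integral[OF m \<rho>'] i by auto
    fix T :: "real^'n \<Rightarrow> real^'n" assume T: "linear T" "\<And>x. norm (T x) = norm x" "\<And>x. T (T x) = x"
    have "AE h in distr lborel borel T. \<rho> h = \<rho>' h" using \<rho>'(2) by (simp only: isometric_involution_distr_lborel(1)[OF T])
    then have "AE h in lborel. \<rho> (T h) = \<rho>' (T h)"
      by (rule AE_distrD[rotated]) (use isometric_involution_distr_lborel(2)[OF T] in simp)
    with \<rho>'(2) show "AE h in lborel. \<rho>' (T h) = \<rho>' h"
      by eventually_elim (metis radial T(2))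
  qed
  then show ?thesis using that \<rho>'(2) by blast
qed

lemma quadratic_form_kernel_lebesgue:
  fixes \<rho> :: "real^'n::finite \<Rightarrow> real"
  assumes radial: "\<And>x y. norm x = norm y \<Longrightarrow> \<rho> x = \<rho> y" and mass: "has_bochner_integral lebesgue \<rho> 1"
    and b: "\<And>k l. b k l = b l k"
  shows "(real CARD('n) * (real CARD('n) + 2) / 2) *
     (LINT h|lebesgue. (hess_kernel i j h * \<rho> h) * (\<Sum>k\<in>UNIV. \<Sum>l\<in>UNIV. h $ k * h $ l / (norm h)\<^sup>2 * b k l)) = b i j"
proof -
  obtain \<rho>' where \<rho>': "radial_density \<rho>'" "AE x in lborel. \<rho> x = \<rho>' x"
    using radial_density_version[OF radial mass] by metis
  have m: "\<rho> \<in> borel_measurable lebesgue" using mass by (auto simp: has_bochner_integral_iff)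
  have hk: "hess_kernel i j \<in> borel_measurable lebesgue" by (rule borel_measurable_lebesgueI) measurable
  have Qm: "(\<lambda>h. \<Sum>k\<in>UNIV. \<Sum>l\<in>UNIV. h $ k * h $ l / (norm h)\<^sup>2 * b k l) \<in> borel_measurable borel" by measurable
  have "(LINT h|lebesgue. (hess_kernel i j h * \<rho> h) * (\<Sum>k\<in>UNIV. \<Sum>l\<in>UNIV. h $ k * h $ l / (norm h)\<^sup>2 * b k l))
     = (LINT h|lborel. (hess_kernel i j h * \<rho>' h) * (\<Sum>k\<in>UNIV. \<Sum>l\<in>UNIV. h $ k * h $ l / (norm h)\<^sup>2 * b k l))"
  proof (rule lebesgue_lborel_integral(1))
    show "AE h in lborel. (hess_kernel i j h * \<rho> h) * (\<Sum>k\<in>UNIV. \<Sum>l\<in>UNIV. h $ k * h $ l / (norm h)\<^sup>2 * b k l)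
      = (hess_kernel i j h * \<rho>' h) * (\<Sum>k\<in>UNIV. \<Sum>l\<in>UNIV. h $ k * h $ l / (norm h)\<^sup>2 * b k l)"
      using \<rho>'(2) by eventually_elim simp
    have "\<rho>' \<in> borel_measurable borel" using \<rho>'(1) by (rule radial_density.borel)
    then show "(\<lambda>h. (hess_kernel i j h * \<rho>' h) * (\<Sum>k\<in>UNIV. \<Sum>l\<in>UNIV. h $ k * h $ l / (norm h)\<^sup>2 * b k l)) \<in> borel_measurable borel"
      by measurable
    show "(\<lambda>h. (hess_kernel i j h * \<rho> h) * (\<Sum>k\<in>UNIV. \<Sum>l\<in>UNIV. h $ k * h $ l / (norm h)\<^sup>2 * b k l)) \<in> borel_measurable lebesgue"
      by (intro borel_measurable_times m hk borel_measurable_lebesgueI[OF Qm])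
  qed
  then show ?thesis using radial_density.quadratic_form_kernel[OF \<rho>'(1) b] by simp
qed

text \<open>As \<open>h\<close> tends to 0, the pairings are asymptotic to the quadratic form of the matrix of
distributional second derivatives tested with \<open>\<phi>\<close>.  They have no limit, only a limiting form
that depends on the direction of \<open>h\<close>.\<close>

lemma second_diff_pairing_limit:
  fixes u :: "real^'n::finite \<Rightarrow> real"
  assumes p: "p \<ge> 1" "u \<in> Lp p" and \<phi>: "\<phi> \<in> Cc_inf" and e: "e > 0"
  defines "b \<equiv> \<lambda>k l. LINT x|lebesgue. u x * partial_deriv k (partial_deriv l \<phi>) x"
  obtains d where "d > 0" "\<And>h. norm h \<le> d \<Longrightarrow>
    \<bar>second_diff_pairing u \<phi> h - (\<Sum>k\<in>UNIV. \<Sum>l\<in>UNIV. h $ k * h $ l / (norm h)\<^sup>2 * b k l)\<bar> \<le> e"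
proof -
  have \<phi>2: "\<phi> \<in> Cc_k 2" by (rule Cc_inf_Cc_k[OF \<phi>])
  obtain R where R: "R > 0" "\<And>x. norm x > R \<Longrightarrow> \<phi> x = 0" using Cc_k_support[OF \<phi>2] by metis
  have pd: "partial_deriv k (partial_deriv l \<phi>) \<in> Cc_k 0" for k l
    by (intro Cc_inf_Cc_k partial_deriv_Cc_inf \<phi>)
  define U where "U = (LINT x|lebesgue. \<bar>u x * indicator (cball 0 (R + 1)) x\<bar>)"
  have iU: "integrable lebesgue (\<lambda>x. \<bar>u x * indicator (cball 0 (R + 1)) x\<bar>)"
    using Lp_locally_integrable[OF p, of "R + 1"] by auto
  have U: "U \<ge> 0" unfolding U_def by (intro integral_nonneg_AE) auto
  define e' where "e' = e / (U + 1)"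
  have e': "e' > 0" using e U by (simp add: e'_def)
  have e'U: "e' * U \<le> e"
  proof -
    have "e' * U \<le> e' * (U + 1)" using e' by (intro mult_left_mono) auto
    also have "\<dots> = e" using U by (simp add: e'_def)
    finally show ?thesis .
  qed
  obtain d where d: "d > 0" "\<And>h x. norm h \<le> d \<Longrightarrow> \<bar>second_diff h \<phi> x - hess_form \<phi> h x\<bar> \<le> e' * (norm h)\<^sup>2"
    using second_diff_consistent[OF \<phi>2 e'] by metis
  have "\<bar>second_diff_pairing u \<phi> h - (\<Sum>k\<in>UNIV. \<Sum>l\<in>UNIV. h $ k * h $ l / (norm h)\<^sup>2 * b k l)\<bar> \<le> e" if h: "norm h \<le> min d 1" for h
  proof (cases "h = 0")
    case True
    then show ?thesis using e by (simp add: second_diff_pairing_def)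
  next
    case False
    have i1: "integrable lebesgue (\<lambda>x. u x * (second_diff h \<phi> x / (norm h)\<^sup>2))"
      using integrable_Lp_second_diff_test[OF p \<phi>2, of h] by (simp add: times_divide_eq_right)
    have eq: "u x * (hess_form \<phi> h x / (norm h)\<^sup>2) = (\<Sum>k\<in>UNIV. \<Sum>l\<in>UNIV. h $ k * h $ l / (norm h)\<^sup>2 * (u x * partial_deriv k (partial_deriv l \<phi>) x))" for x
      by (simp add: hess_form_def sum_distrib_left sum_divide_distrib mult_ac)
    have it: "integrable lebesgue (\<lambda>x. u x * partial_deriv k (partial_deriv l \<phi>) x)" for k l
      by (rule Lp_Cc_k_integrable[OF p pd])
    have i2: "integrable lebesgue (\<lambda>x. u x * (hess_form \<phi> h x / (norm h)\<^sup>2))"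
      unfolding eq by (intro Bochner_Integration.integrable_sum integrable_mult_right it)
    have Q: "(LINT x|lebesgue. u x * (hess_form \<phi> h x / (norm h)\<^sup>2)) = (\<Sum>k\<in>UNIV. \<Sum>l\<in>UNIV. h $ k * h $ l / (norm h)\<^sup>2 * b k l)"
    proof -
      have "(LINT x|lebesgue. u x * (hess_form \<phi> h x / (norm h)\<^sup>2)) = (\<Sum>k\<in>UNIV. LINT x|lebesgue. (\<Sum>l\<in>UNIV. h $ k * h $ l / (norm h)\<^sup>2 * (u x * partial_deriv k (partial_deriv l \<phi>) x)))"
        unfolding eq by (rule Bochner_Integration.integral_sum) (intro Bochner_Integration.integrable_sum integrable_mult_right it)
      also have "\<dots> = (\<Sum>k\<in>UNIV. \<Sum>l\<in>UNIV. LINT x|lebesgue. h $ k * h $ l / (norm h)\<^sup>2 * (u x * partial_deriv k (partial_deriv l \<phi>) x))"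
        by (intro sum.cong refl Bochner_Integration.integral_sum integrable_mult_right it)
      also have "\<dots> = (\<Sum>k\<in>UNIV. \<Sum>l\<in>UNIV. h $ k * h $ l / (norm h)\<^sup>2 * b k l)"
        unfolding b_def by (intro sum.cong refl integral_mult_right_zero)
      finally show ?thesis .
    qed
    have "\<bar>second_diff_pairing u \<phi> h - (\<Sum>k\<in>UNIV. \<Sum>l\<in>UNIV. h $ k * h $ l / (norm h)\<^sup>2 * b k l)\<bar>
      = \<bar>LINT x|lebesgue. u x * (second_diff h \<phi> x / (norm h)\<^sup>2) - u x * (hess_form \<phi> h x / (norm h)\<^sup>2)\<bar>"
      using i1 i2 by (simp only: Q[symmetric] second_diff_pairing_def Bochner_Integration.integral_diff)
    also have "\<dots> \<le> (LINT x|lebesgue. \<bar>u x * (second_diff h \<phi> x / (norm h)\<^sup>2) - u x * (hess_form \<phi> h x / (norm h)\<^sup>2)\<bar>)"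
      by (rule integral_abs_bound)
    also have "\<dots> \<le> (LINT x|lebesgue. e' * \<bar>u x * indicator (cball 0 (R + 1)) x\<bar>)"
    proof (rule integral_mono)
      show "integrable lebesgue (\<lambda>x. \<bar>u x * (second_diff h \<phi> x / (norm h)\<^sup>2) - u x * (hess_form \<phi> h x / (norm h)\<^sup>2)\<bar>)"
        by (intro integrable_abs Bochner_Integration.integrable_diff i1 i2)
      show "integrable lebesgue (\<lambda>x. e' * \<bar>u x * indicator (cball 0 (R + 1)) x\<bar>)" using iU by auto
      fix x
      have "\<bar>second_diff h \<phi> x - hess_form \<phi> h x\<bar> / (norm h)\<^sup>2 \<le> e' * indicator (cball 0 (R + 1)) x"
      proof (cases "norm x \<le> R + 1")
        case True
        then show ?thesis using d(2)[of h x] h False by (simp add: divide_le_eq)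
      next
        case nF: False
        have "norm x \<le> norm (x + h) + norm h" "norm x \<le> norm (x - h) + norm h"
          using norm_triangle_ineq4[of "x + h" h] norm_triangle_ineq[of "x - h" h] by simp_all
        then have "norm x > R" "norm (x + h) > R" "norm (x - h) > R" using nF h by auto
        then have "second_diff h \<phi> x = 0" "hess_form \<phi> h x = 0"
          using R hess_form_outside[OF R(2)] by (auto simp: second_diff_def)
        then show ?thesis using e' by (simp add: indicator_def)
      qed
      then have "\<bar>u x\<bar> * (\<bar>second_diff h \<phi> x - hess_form \<phi> h x\<bar> / (norm h)\<^sup>2) \<le> \<bar>u x\<bar> * (e' * indicator (cball 0 (R + 1)) x)"
        by (intro mult_left_mono) auto
      moreover have "u x * (second_diff h \<phi> x / (norm h)\<^sup>2) - u x * (hess_form \<phi> h x / (norm h)\<^sup>2) = u x * ((second_diff h \<phi> x - hess_form \<phi> h x) / (norm h)\<^sup>2)"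
        by (simp only: right_diff_distrib diff_divide_distrib)
      ultimately show "\<bar>u x * (second_diff h \<phi> x / (norm h)\<^sup>2) - u x * (hess_form \<phi> h x / (norm h)\<^sup>2)\<bar> \<le> e' * \<bar>u x * indicator (cball 0 (R + 1)) x\<bar>"
        by (simp add: abs_mult mult_ac)
    qed
    also have "\<dots> = e' * U" by (simp add: U_def)
    also note e'U
    finally show ?thesis .
  qed
  then show ?thesis using that[of "min d 1"] d(1) by simp
qed

text \<open>Near \<open>h = 0\<close> the pairings may be replaced by the limiting quadratic form, which the kernel
integrates exactly to the wanted entry.  Away from 0 both are bounded and the density has
asymptotically no mass.\<close>

lemma dist_nonlocal_hessian_tendsto:
  fixes u :: "real^'n::finite \<Rightarrow> real" and \<rho> :: "nat \<Rightarrow> real^'n \<Rightarrow> real"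
  assumes nonneg: "\<And>n x. \<rho> n x \<ge> 0"
    and radial: "\<And>n x y. norm x = norm y \<Longrightarrow> \<rho> n x = \<rho> n y"
    and mass: "\<And>n. has_bochner_integral lebesgue (\<rho> n) 1"
    and conc: "\<And>\<gamma>. \<gamma> > 0 \<Longrightarrow> (\<lambda>n. LINT x:{x. norm x > \<gamma>}|lebesgue. \<rho> n x) \<longlonglongrightarrow> 0"
    and p: "p \<ge> 1" "u \<in> Lp p" and \<phi>: "\<phi> \<in> Cc_inf"
  shows "(\<lambda>n. dist_nonlocal_hessian (\<rho> n) u i j \<phi>) \<longlonglongrightarrow> \<langle>u, partial_deriv i (partial_deriv j \<phi>)\<rangle>"
proof (rule LIMSEQ_I)
  fix \<epsilon> :: real assume \<epsilon>: "\<epsilon> > 0"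
  define b where "b k l = \<langle>u, partial_deriv k (partial_deriv l \<phi>)\<rangle>" for k l
  define c where "c = real CARD('n) * (real CARD('n) + 2) / 2"
  have c: "c > 0" by (simp add: c_def)
  have \<phi>2: "\<phi> \<in> Cc_k 2" by (rule Cc_inf_Cc_k[OF \<phi>])
  have sym: "b k l = b l k" for k l
  proof -
    have "C_k 2 \<phi>" using \<phi>2 by (simp only: Cc_k_def) simp
    from partial_deriv_symmetric[OF this] show ?thesis unfolding b_def by simp
  qed
  define G where "G = second_diff_pairing u \<phi>"
  define Q where "Q h = (\<Sum>k\<in>UNIV. \<Sum>l\<in>UNIV. h $ k * h $ l / (norm h)\<^sup>2 * b k l)" for h :: "real^'n"
  have Gm: "G \<in> borel_measurable borel" unfolding G_def
    by (rule dist_nonlocal_hessian_eq(2)[OF p \<phi>2, of "\<rho> 0"]) (use mass in \<open>auto simp: has_bochner_integral_iff\<close>)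
  have Qm: "Q \<in> borel_measurable borel" unfolding Q_def[abs_def] by measurable
  obtain B where B: "B \<ge> 0" "\<And>h. (LINT x|lebesgue. \<bar>u x * (second_diff h \<phi> x / (norm h)\<^sup>2)\<bar>) \<le> B"
    using second_diff_pairing_bound[OF p \<phi>2] by metis
  have GB: "\<bar>G h\<bar> \<le> B" for h
    unfolding G_def second_diff_pairing_def by (rule order_trans[OF integral_abs_bound B(2)])
  define B2 where "B2 = (real CARD('n))\<^sup>2 * (\<Sum>k\<in>UNIV. \<Sum>l\<in>UNIV. \<bar>b k l\<bar>)"
  have bB: "\<bar>b k l\<bar> \<le> (\<Sum>k\<in>UNIV. \<Sum>l\<in>UNIV. \<bar>b k l\<bar>)" for k l
    by (rule member_le_double_sum[of "\<lambda>k l. \<bar>b k l\<bar>"]) simp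
  have QB: "\<bar>Q h\<bar> \<le> B2" for h
  proof (cases "h = 0")
    case True then show ?thesis by (simp add: Q_def B2_def sum_nonneg)
  next
    case False
    have "Q h = (\<Sum>k\<in>UNIV. \<Sum>l\<in>UNIV. h $ k * h $ l * b k l) / (norm h)\<^sup>2"
      unfolding Q_def by (simp add: sum_divide_distrib)
    then have "\<bar>Q h\<bar> = \<bar>\<Sum>k\<in>UNIV. \<Sum>l\<in>UNIV. h $ k * h $ l * b k l\<bar> / (norm h)\<^sup>2" by simp
    also have "\<dots> \<le> ((real CARD('n))\<^sup>2 * (norm h)\<^sup>2 * (\<Sum>k\<in>UNIV. \<Sum>l\<in>UNIV. \<bar>b k l\<bar>)) / (norm h)\<^sup>2"
      by (intro divide_right_mono quadratic_form_bound bB) auto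
    also have "\<dots> = B2" using False by (simp add: B2_def)
    finally show ?thesis .
  qed
  (* The error is at most \<open>2 c e\<close> plus a term that vanishes with the tail of the density; this choice leaves room for the strict inequality. *)
  define e where "e = \<epsilon> / (8 * c)"
  have e: "e > 0" using \<epsilon> c by (simp add: e_def)
  obtain d where d: "d > 0" "\<And>h. norm h \<le> d \<Longrightarrow> \<bar>G h - Q h\<bar> \<le> e"
    unfolding G_def Q_def b_def by (rule second_diff_pairing_limit[OF p \<phi> e]) blast
  define t where "t n = (LINT x:{x. norm x > d}|lebesgue. \<rho> n x)" for n
  have bnd: "\<bar>dist_nonlocal_hessian (\<rho> n) u i j \<phi> - b i j\<bar> \<le> c * (2 * (e + (B + B2) * t n))" for n
  proof -
    have i\<rho>: "integrable lebesgue (\<rho> n)" "integral\<^sup>L lebesgue (\<rho> n) = 1" using mass[of n] by (auto simp: has_bochner_integral_iff)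
    have \<rho>m[measurable]: "\<rho> n \<in> borel_measurable lebesgue" using i\<rho> by auto
    have hk[measurable]: "hess_kernel i j \<in> borel_measurable lebesgue" by (rule borel_measurable_lebesgueI) measurable
    have [measurable]: "G \<in> borel_measurable lebesgue" "Q \<in> borel_measurable lebesgue" using Gm Qm by (auto intro: borel_measurable_lebesgueI)
    have ib: "integrable lebesgue (\<lambda>h. (hess_kernel i j h * \<rho> n h) * f h)"
      if "f \<in> borel_measurable lebesgue" "\<And>h. \<bar>f h\<bar> \<le> A" for f A
    proof (rule Bochner_Integration.integrable_bound)
      show "integrable lebesgue (\<lambda>h. (2 * A) * \<rho> n h)" using i\<rho> by auto
      show "AE h in lebesgue. norm ((hess_kernel i j h * \<rho> n h) * f h) \<le> norm ((2 * A) * \<rho> n h)"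
      proof (rule AE_I2)
        fix h
        have "\<bar>hess_kernel i j h\<bar> * \<bar>f h\<bar> * \<rho> n h \<le> 2 * A * \<rho> n h"
          using hess_kernel_bound[of i j h] that(2)[of h] nonneg by (intro mult_right_mono mult_mono) auto
        then have "\<bar>hess_kernel i j h\<bar> * \<rho> n h * \<bar>f h\<bar> \<le> 2 * A * \<rho> n h" by (simp add: mult_ac)
        moreover have "A \<ge> 0" using that(2)[of h] by linarith
        ultimately show "norm ((hess_kernel i j h * \<rho> n h) * f h) \<le> norm ((2 * A) * \<rho> n h)"
          using nonneg[of n h] by (simp add: abs_mult)
      qed
    qed (use that in measurable)
    have iG: "integrable lebesgue (\<lambda>h. (hess_kernel i j h * \<rho> n h) * G h)" by (rule ib[OF _ GB]) measurable
    have iQ: "integrable lebesgue (\<lambda>h. (hess_kernel i j h * \<rho> n h) * Q h)" by (rule ib[OF _ QB]) measurable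
    have iT: "integrable lebesgue (\<lambda>h. indicator {x. norm x > d} h * \<rho> n h)"
      using integrable_mult_indicator[of "{x. norm x > d}" lebesgue "\<rho> n"] i\<rho> by (simp add: lebesgue_openin)
    have "b i j = c * (LINT h|lebesgue. (hess_kernel i j h * \<rho> n h) * Q h)"
      unfolding c_def Q_def by (rule quadratic_form_kernel_lebesgue[OF radial mass sym, symmetric])
    then have "dist_nonlocal_hessian (\<rho> n) u i j \<phi> - b i j = c * ((LINT h|lebesgue. (hess_kernel i j h * \<rho> n h) * G h) - (LINT h|lebesgue. (hess_kernel i j h * \<rho> n h) * Q h))"
      unfolding dist_nonlocal_hessian_eq(1)[OF p \<phi>2 i\<rho>(1)] c_def G_def by (simp only: right_diff_distrib)
    also have "\<dots> = c * (LINT h|lebesgue. (hess_kernel i j h * \<rho> n h) * G h - (hess_kernel i j h * \<rho> n h) * Q h)"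
      using iG iQ by simp
    finally have "\<bar>dist_nonlocal_hessian (\<rho> n) u i j \<phi> - b i j\<bar> = c * \<bar>LINT h|lebesgue. (hess_kernel i j h * \<rho> n h) * G h - (hess_kernel i j h * \<rho> n h) * Q h\<bar>"
      using c by (simp add: abs_mult)
    also have "\<dots> \<le> c * (LINT h|lebesgue. \<bar>(hess_kernel i j h * \<rho> n h) * G h - (hess_kernel i j h * \<rho> n h) * Q h\<bar>)"
      using c by (intro mult_left_mono integral_abs_bound) auto
    also have "\<dots> \<le> c * (LINT h|lebesgue. 2 * (e * \<rho> n h + (B + B2) * (indicator {x. norm x > d} h * \<rho> n h)))"
    proof (intro mult_left_mono integral_mono)
      show "integrable lebesgue (\<lambda>h. \<bar>(hess_kernel i j h * \<rho> n h) * G h - (hess_kernel i j h * \<rho> n h) * Q h\<bar>)"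
        by (intro integrable_abs Bochner_Integration.integrable_diff iG iQ)
      show "integrable lebesgue (\<lambda>h. 2 * (e * \<rho> n h + (B + B2) * (indicator {x. norm x > d} h * \<rho> n h)))"
        by (intro integrable_mult_right Bochner_Integration.integrable_add i\<rho> iT)
      fix h
      have GQ: "\<bar>G h - Q h\<bar> \<le> e + (B + B2) * indicator {x. norm x > d} h"
        using d(2)[of h] GB[of h] QB[of h] e by (cases "norm h \<le> d") (auto simp: indicator_def)
      have "\<bar>(hess_kernel i j h * \<rho> n h) * G h - (hess_kernel i j h * \<rho> n h) * Q h\<bar> = \<bar>hess_kernel i j h\<bar> * (\<rho> n h * \<bar>G h - Q h\<bar>)"
      proof -
        have "(hess_kernel i j h * \<rho> n h) * G h - (hess_kernel i j h * \<rho> n h) * Q h = hess_kernel i j h * (\<rho> n h * (G h - Q h))"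
          by (simp only: right_diff_distrib mult.assoc)
        then show ?thesis using nonneg[of n h] by (simp add: abs_mult)
      qed
      also have "\<dots> \<le> 2 * (\<rho> n h * (e + (B + B2) * indicator {x. norm x > d} h))"
        using nonneg[of n h] GQ by (intro mult_mono hess_kernel_bound mult_left_mono) auto
      finally show "\<bar>(hess_kernel i j h * \<rho> n h) * G h - (hess_kernel i j h * \<rho> n h) * Q h\<bar> \<le> 2 * (e * \<rho> n h + (B + B2) * (indicator {x. norm x > d} h * \<rho> n h))"
        by (simp add: algebra_simps)
    qed (use c in auto)
    also have "(LINT h|lebesgue. 2 * (e * \<rho> n h + (B + B2) * (indicator {x. norm x > d} h * \<rho> n h))) = 2 * (e + (B + B2) * t n)"
      using i\<rho> iT by (simp add: t_def set_lebesgue_integral_def)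
    finally show ?thesis .
  qed
  have "(\<lambda>n. c * (2 * (e + (B + B2) * t n))) \<longlonglongrightarrow> c * (2 * (e + (B + B2) * 0))"
    unfolding t_def by (intro tendsto_intros conc d)
  moreover have "c * (2 * (e + (B + B2) * 0)) < \<epsilon>" using c \<epsilon> by (simp add: e_def)
  ultimately have "\<forall>\<^sub>F n in sequentially. c * (2 * (e + (B + B2) * t n)) < \<epsilon>" by (rule order_tendstoD)
  then obtain N where N: "\<And>n. n \<ge> N \<Longrightarrow> c * (2 * (e + (B + B2) * t n)) < \<epsilon>" unfolding eventually_sequentially by blast
  then show "\<exists>N. \<forall>n\<ge>N. norm (dist_nonlocal_hessian (\<rho> n) u i j \<phi> - \<langle>u, partial_deriv i (partial_deriv j \<phi>)\<rangle>) < \<epsilon>"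
    using bnd unfolding b_def by (intro exI[of _ N]) (auto intro: le_less_trans)
qed

lemma liminf_finite_imp_bounded_subsequence:
  fixes f :: "nat \<Rightarrow> ennreal"
  assumes "liminf f < \<infinity>"
  obtains M r where "M \<ge> 0" "\<And>N. r N \<ge> N" "\<And>N. f (r N) \<le> ennreal M"
proof -
  obtain M where M: "M \<ge> 0" "liminf f = ennreal M"
    using assms by (cases "liminf f") auto
  have "\<exists>n\<ge>N. f n \<le> ennreal (M + 1)" for N
  proof (rule ccontr)
    assume "\<not> (\<exists>n\<ge>N. f n \<le> ennreal (M + 1))"
    then have "ennreal (M + 1) \<le> f n" if "n \<ge> N" for n using that le_cases by blast
    then have "\<forall>\<^sub>F n in sequentially. ennreal (M + 1) \<le> f n"
      unfolding eventually_sequentially by blast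
    then have "ennreal (M + 1) \<le> ennreal M" using Liminf_bounded M(2) by metis
    then show False using M(1) by simp
  qed
  then obtain r where "\<And>N. r N \<ge> N" "\<And>N. f (r N) \<le> ennreal (M + 1)" by metis
  then show ?thesis using that[of "M + 1" r] M(1) by simp
qed

lemma matrix_entry_le_norm: "\<bar>A $ i $ j\<bar> \<le> norm A" for A :: "real^'n::finite^'m::finite"
  using component_le_norm_cart[of "A $ i" j] Finite_Cartesian_Product.norm_nth_le[of A i] by linarith

lemma matrix_norm_powr_le:
  fixes A :: "real^'n::finite^'m::finite"
  assumes p: "p \<ge> 1"
  shows "norm A powr p \<le> (real CARD('m) * real CARD('n)) powr p * (\<Sum>i\<in>UNIV. \<Sum>j\<in>UNIV. \<bar>A $ i $ j\<bar> powr p)"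
proof -
  define S where "S = (\<Sum>i\<in>UNIV. \<Sum>j\<in>UNIV. \<bar>A $ i $ j\<bar> powr p)"
  have S: "S \<ge> 0" unfolding S_def by (intro sum_nonneg) auto
  have ent: "\<bar>A $ i $ j\<bar> \<le> S powr (1/p)" for i j
  proof -
    have "\<bar>A $ i $ j\<bar> powr p \<le> S" unfolding S_def
      by (rule member_le_double_sum[of "\<lambda>i j. \<bar>A $ i $ j\<bar> powr p"]) simp
    then have "(\<bar>A $ i $ j\<bar> powr p) powr (1/p) \<le> S powr (1/p)" using p by (intro powr_mono2) auto
    then show ?thesis using p by (simp add: powr_powr)
  qed
  have "norm A \<le> (\<Sum>i\<in>UNIV. norm (A $ i))" unfolding norm_vec_def by (rule L2_set_le_sum) simp
  also have "\<dots> \<le> (\<Sum>i\<in>(UNIV::'m set). \<Sum>j\<in>(UNIV::'n set). \<bar>A $ i $ j\<bar>)"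
    by (intro sum_mono norm_le_l1_cart)
  also have "\<dots> \<le> (\<Sum>i\<in>(UNIV::'m set). \<Sum>j\<in>(UNIV::'n set). S powr (1/p))"
    by (intro sum_mono ent)
  finally have "norm A \<le> real CARD('m) * real CARD('n) * S powr (1/p)" by (simp add: mult.assoc)
  then have "norm A powr p \<le> (real CARD('m) * real CARD('n) * S powr (1/p)) powr p" using p by (intro powr_mono2) auto
  also have "\<dots> = (real CARD('m) * real CARD('n)) powr p * (S powr (1/p)) powr p" by (rule powr_mult)
  also have "(S powr (1/p)) powr p = S" using p S by (simp add: powr_powr)
  finally show ?thesis by (simp add: S_def)
qed

lemma Lp_entry:
  fixes V :: "real^'n::finite \<Rightarrow> real^'n^'n"
  assumes p: "p \<ge> 1" and V: "V \<in> Lp p"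
  shows "(\<lambda>x. V x $ i $ j) \<in> Lp p" "(\<integral>\<^sup>+x. ennreal (norm (V x) powr p) \<partial>lebesgue) \<le> ennreal M \<Longrightarrow> M \<ge> 0 \<Longrightarrow>
    (LINT x|lebesgue. \<bar>V x $ i $ j\<bar> powr p) \<le> M"
proof -
  have Vm: "V \<in> borel_measurable lebesgue" and Vi: "integrable lebesgue (\<lambda>x. norm (V x) powr p)"
    using V by (auto simp: Lp_def)
  have "(\<lambda>A::real^'n^'n. A $ i $ j) \<in> borel_measurable borel"
    by (intro borel_measurable_continuous_onI continuous_intros)
  from measurable_compose[OF Vm this] have m: "(\<lambda>x. V x $ i $ j) \<in> borel_measurable lebesgue" by simp
  have le: "\<bar>V x $ i $ j\<bar> powr p \<le> norm (V x) powr p" for x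
    using p by (intro powr_mono2 matrix_entry_le_norm) auto
  have i: "integrable lebesgue (\<lambda>x. \<bar>V x $ i $ j\<bar> powr p)"
    by (rule Bochner_Integration.integrable_bound[OF Vi]) (use m le in auto)
  then show "(\<lambda>x. V x $ i $ j) \<in> Lp p" using m by (simp add: Lp_real)
  assume M: "(\<integral>\<^sup>+x. ennreal (norm (V x) powr p) \<partial>lebesgue) \<le> ennreal M" "M \<ge> 0"
  have "(LINT x|lebesgue. \<bar>V x $ i $ j\<bar> powr p) \<le> (LINT x|lebesgue. norm (V x) powr p)"
    by (intro integral_mono i Vi le)
  also have "\<dots> \<le> M" using M nn_integral_eq_integral[OF Vi] by simp
  finally show "(LINT x|lebesgue. \<bar>V x $ i $ j\<bar> powr p) \<le> M" .
qed

text \<open>The value of \<open>dnh_integral\<close> refers to an arbitrarily chosen representative; a finite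
bound guarantees that there is one.\<close>

lemma finite_dnh_integral:
  assumes "dnh_integral p \<rho> u \<le> ennreal M"
  obtains V where "V \<in> Lp p" "represents_dnh \<rho> u V" "(\<integral>\<^sup>+x. ennreal (norm (V x) powr p) \<partial>lebesgue) \<le> ennreal M"
proof -
  have ex: "\<exists>V. V \<in> Lp p \<and> represents_dnh \<rho> u V"
    using assms unfolding dnh_integral_def by (auto split: if_splits simp: top_unique)
  define V where "V = (SOME V. V \<in> Lp p \<and> represents_dnh \<rho> u V)"
  have "V \<in> Lp p \<and> represents_dnh \<rho> u V" unfolding V_def by (rule someI_ex[OF ex])
  moreover have "(\<integral>\<^sup>+x. ennreal (norm (V x) powr p) \<partial>lebesgue) \<le> ennreal M"
    using assms ex unfolding dnh_integral_def V_def by (auto split: if_splits)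
  ultimately show ?thesis using that by blast
qed

text \<open>Along indices that tend to infinity, the functionals \<open>dist_nonlocal_hessian\<close> obey one
dual bound. It survives in the pointwise limit, which consists of the distributional second
derivatives.\<close>

lemma liminf_finite_imp_quadratic:
  fixes u :: "real^'n::finite \<Rightarrow> real" and \<rho> :: "nat \<Rightarrow> real^'n \<Rightarrow> real"
  assumes nonneg: "\<And>n x. \<rho> n x \<ge> 0"
    and radial: "\<And>n x y. norm x = norm y \<Longrightarrow> \<rho> n x = \<rho> n y"
    and mass: "\<And>n. has_bochner_integral lebesgue (\<rho> n) 1"
    and conc: "\<And>\<gamma>. \<gamma> > 0 \<Longrightarrow> (\<lambda>n. LINT x:{x. norm x > \<gamma>}|lebesgue. \<rho> n x) \<longlonglongrightarrow> 0"
    and p: "p \<ge> 1" "u \<in> Lp p" and fin: "liminf (\<lambda>n. dnh_integral p (\<rho> n) u) < \<infinity>"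
  shows "\<exists>C\<ge>0. quadratic_diff_bounded p C u"
proof -
  obtain M r where M: "M \<ge> 0" and r: "\<And>N. r N \<ge> N" "\<And>N. dnh_integral p (\<rho> (r N)) u \<le> ennreal M"
    by (rule liminf_finite_imp_bounded_subsequence[OF fin]) blast
  have lim_r: "filterlim r at_top sequentially"
    by (rule filterlim_at_top_mono[OF filterlim_ident]) (use r in auto)
  have "dual_bounded p M (\<lambda>\<phi>. \<langle>u, partial_deriv i (partial_deriv j \<phi>)\<rangle>)" for i j
  proof (rule dual_boundedI)
    fix \<phi> :: "real^'n \<Rightarrow> real" assume \<phi>: "\<phi> \<in> Cc_inf" "admissible p \<phi>"
    have "dist_nonlocal_hessian (\<rho> (r N)) u i j \<phi> \<le> M + dual_gauge p \<phi>" for N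
    proof -
      obtain V where V: "V \<in> Lp p" "represents_dnh (\<rho> (r N)) u V" "(\<integral>\<^sup>+x. ennreal (norm (V x) powr p) \<partial>lebesgue) \<le> ennreal M"
        by (rule finite_dnh_integral[OF r(2)]) blast
      have "dual_bounded p M (\<lambda>\<phi>. LINT x|lebesgue. V x $ i $ j * \<phi> x)"
        by (rule Lp_dual_bounded[OF p(1) Lp_entry(1)[OF p(1) V(1)] Lp_entry(2)[OF p(1) V(1,3) M]])
      from dual_boundedD[OF this \<phi>] show ?thesis using V(2) \<phi>(1) by (simp add: represents_dnh_def)
    qed
    moreover have "(\<lambda>N. dist_nonlocal_hessian (\<rho> (r N)) u i j \<phi>) \<longlonglongrightarrow> \<langle>u, partial_deriv i (partial_deriv j \<phi>)\<rangle>"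
      by (rule filterlim_compose[OF dist_nonlocal_hessian_tendsto[where \<rho> = \<rho>, OF nonneg radial mass conc p \<phi>(1)] lim_r])
    ultimately show "\<langle>u, partial_deriv i (partial_deriv j \<phi>)\<rangle> \<le> M + dual_gauge p \<phi>"
      by (intro LIMSEQ_le_const2) auto
  qed
  from dual_bounded_hessian_imp_quadratic[OF p M this] show ?thesis .
qed

text \<open>Each pairing is bounded, uniformly in \<open>h\<close>, by Young's inequality for the second
difference quotient of \<open>u\<close>; the average against \<open>\<rho>\<close> obeys the same
bound, with the kernel bounded by 2.\<close>

lemma dist_nonlocal_hessian_le:
  fixes u :: "real^'n::finite \<Rightarrow> real"
  assumes p: "p \<ge> 1" "u \<in> Lp p" and C: "C \<ge> 0" and q: "quadratic_diff_bounded p C u"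
    and nonneg: "\<And>x. \<rho> x \<ge> 0" and mass: "has_bochner_integral lebesgue \<rho> 1"
    and \<phi>: "\<phi> \<in> Cc_inf" "admissible p \<phi>"
  shows "dist_nonlocal_hessian \<rho> u i j \<phi> \<le> real CARD('n) * (real CARD('n) + 2) * (C + dual_gauge p \<phi>)"
proof -
  have i\<rho>: "integrable lebesgue \<rho>" "integral\<^sup>L lebesgue \<rho> = 1" using mass by (auto simp: has_bochner_integral_iff)
  have \<phi>2: "\<phi> \<in> Cc_k 2" by (rule Cc_inf_Cc_k[OF \<phi>(1)])
  define D where "D = C + dual_gauge p \<phi>"
  have D: "D \<ge> 0" using C dual_gauge_nonneg[of p \<phi>] by (simp add: D_def)
  have G: "\<bar>second_diff_pairing u \<phi> h\<bar> \<le> D" for h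
  proof -
    note db = Lp_dual_bounded[OF p(1) scaled_second_diff_Lp[OF p C q, of h]]
    have "\<bar>LINT x|lebesgue. (1 / (norm h)\<^sup>2 * second_diff h u x) * \<phi> x\<bar> \<le> C + dual_gauge p \<phi>"
      by (rule dual_bounded_abs[OF db \<phi>]) simp
    then show ?thesis unfolding second_diff_pairing_by_parts[OF p \<phi>2] D_def .
  qed
  have Gm: "second_diff_pairing u \<phi> \<in> borel_measurable lebesgue"
    by (rule borel_measurable_lebesgueI[OF dist_nonlocal_hessian_eq(2)[OF p \<phi>2 i\<rho>(1)]])
  have hk: "hess_kernel i j \<in> borel_measurable lebesgue" by (rule borel_measurable_lebesgueI) measurable
  have bd: "\<bar>(hess_kernel i j h * \<rho> h) * second_diff_pairing u \<phi> h\<bar> \<le> 2 * D * \<rho> h" for h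
  proof -
    have "\<bar>hess_kernel i j h\<bar> * \<bar>second_diff_pairing u \<phi> h\<bar> * \<rho> h \<le> 2 * D * \<rho> h"
      using hess_kernel_bound[of i j h] G[of h] nonneg D by (intro mult_right_mono mult_mono) auto
    then show ?thesis using nonneg[of h] by (simp add: abs_mult mult_ac)
  qed
  have i2: "integrable lebesgue (\<lambda>h. 2 * D * \<rho> h)" using i\<rho> by auto
  have "(LINT h|lebesgue. (hess_kernel i j h * \<rho> h) * second_diff_pairing u \<phi> h) \<le> (LINT h|lebesgue. 2 * D * \<rho> h)"
  proof (rule integral_mono)
    show "integrable lebesgue (\<lambda>h. (hess_kernel i j h * \<rho> h) * second_diff_pairing u \<phi> h)"
      by (rule Bochner_Integration.integrable_bound[OF i2])
        (use hk i\<rho> Gm in measurable, auto intro!: AE_I2 order_trans[OF bd] simp: nonneg D)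
  qed (use i2 bd abs_le_D1 in auto)
  also have "\<dots> = 2 * D" using i\<rho> by simp
  finally have "(real CARD('n) * (real CARD('n) + 2) / 2) * (LINT h|lebesgue. (hess_kernel i j h * \<rho> h) * second_diff_pairing u \<phi> h)
    \<le> (real CARD('n) * (real CARD('n) + 2) / 2) * (2 * D)" by (intro mult_left_mono) auto
  then show ?thesis unfolding dist_nonlocal_hessian_eq(1)[OF p \<phi>2 i\<rho>(1)] D_def by simp
qed

text \<open>The bound holds for every representative.  This matters because the integral in the theorem is taken for an
unspecified one, and spares a proof that representatives are unique.\<close>

lemma representative_bound:
  fixes u v :: "real^'n::finite \<Rightarrow> real"
  assumes p: "p \<ge> 1" "u \<in> Lp p" and C: "C \<ge> 0" and q: "quadratic_diff_bounded p C u"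
    and nonneg: "\<And>x. \<rho> x \<ge> 0" and mass: "has_bochner_integral lebesgue \<rho> 1"
    and v: "v \<in> borel_measurable lebesgue" "\<And>\<phi>. \<phi> \<in> Cc_inf \<Longrightarrow> integrable lebesgue (\<lambda>x. v x * \<phi> x)"
    and rep: "\<And>\<phi>. \<phi> \<in> Cc_inf \<Longrightarrow> dist_nonlocal_hessian \<rho> u i j \<phi> = \<langle>v, \<phi>\<rangle>"
  shows "(\<integral>\<^sup>+x. ennreal (\<bar>v x\<bar> powr p) \<partial>lebesgue) \<le> ennreal ((real CARD('n) * (real CARD('n) + 2)) powr p * (2 powr p * C))"
proof -
  define K where "K = real CARD('n) * (real CARD('n) + 2)"
  have K: "K > 0" by (simp add: K_def add_pos_pos)
  define w where "w x = 1 / K * v x" for x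
  have wm: "w \<in> borel_measurable lebesgue" unfolding w_def using v(1) by measurable
  have wi: "integrable lebesgue (\<lambda>x. w x * \<phi> x)" if "\<phi> \<in> Cc_inf" for \<phi>
    unfolding w_def mult.assoc by (intro integrable_mult_right v(2) that)
  have "dual_bounded p C (\<lambda>\<phi>. \<langle>w, \<phi>\<rangle>)"
  proof (rule dual_boundedI)
    fix \<phi> :: "real^'n \<Rightarrow> real" assume \<phi>: "\<phi> \<in> Cc_inf" "admissible p \<phi>"
    have "\<langle>w, \<phi>\<rangle> = 1 / K * dist_nonlocal_hessian \<rho> u i j \<phi>"
      unfolding w_def mult.assoc rep[OF \<phi>(1)] by (rule integral_mult_right_zero)
    also have "\<dots> \<le> 1 / K * (K * (C + dual_gauge p \<phi>))"
      using K dist_nonlocal_hessian_le[OF p C q nonneg mass \<phi>] by (intro mult_left_mono) (auto simp: K_def)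
    also have "\<dots> = C + dual_gauge p \<phi>" using K by simp
    finally show "\<langle>w, \<phi>\<rangle> \<le> C + dual_gauge p \<phi>" .
  qed
  from dual_bounded_imp_nn_integral[OF p(1) wm wi C this]
  have b: "(\<integral>\<^sup>+x. ennreal (\<bar>w x\<bar> powr p) \<partial>lebesgue) \<le> ennreal (2 powr p * C)" .
  have "\<bar>v x\<bar> powr p = K powr p * \<bar>w x\<bar> powr p" for x
    using K by (simp add: w_def powr_mult[symmetric] abs_mult)
  then have "(\<integral>\<^sup>+x. ennreal (\<bar>v x\<bar> powr p) \<partial>lebesgue) = ennreal (K powr p) * (\<integral>\<^sup>+x. ennreal (\<bar>w x\<bar> powr p) \<partial>lebesgue)"
    using wm by (subst nn_integral_cmult[symmetric]) (auto simp: ennreal_mult)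
  also have "\<dots> \<le> ennreal (K powr p) * ennreal (2 powr p * C)" by (intro mult_left_mono b) auto
  also have "\<dots> = ennreal (K powr p * (2 powr p * C))" using C by (simp add: ennreal_mult)
  finally show ?thesis by (simp add: K_def)
qed

text \<open>The representative is the formula of the non-local Hessian with \<open>u\<close> in place of the test
function.  Fubini's theorem shows at the same time that the inner integral exists almost everywhere
and that the result is locally integrable; that it lies in \<open>L\<^sup>p\<close> then follows by duality from
\<open>representative_bound\<close>, without Jensen's inequality.\<close>

lemma representative_exists:
  fixes u :: "real^'n::finite \<Rightarrow> real"
  assumes p: "p \<ge> 1" "u \<in> Lp p" and C: "C \<ge> 0" and q: "quadratic_diff_bounded p C u"
    and mass: "has_bochner_integral lebesgue \<rho> 1"
  obtains v where "v \<in> borel_measurable lebesgue" "\<And>\<phi>. \<phi> \<in> Cc_inf \<Longrightarrow> integrable lebesgue (\<lambda>x. v x * \<phi> x)"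
    "\<And>\<phi>. \<phi> \<in> Cc_inf \<Longrightarrow> dist_nonlocal_hessian \<rho> u i j \<phi> = \<langle>v, \<phi>\<rangle>"
proof -
  define c where "c = real CARD('n) * (real CARD('n) + 2) / 2"
  have i\<rho>: "integrable lebesgue \<rho>" using mass by (auto simp: has_bochner_integral_iff)
  have um: "u \<in> borel_measurable lebesgue" using p by (simp add: Lp_real)
  obtain u' where u'[measurable]: "u' \<in> borel_measurable borel" and uu: "AE x in lborel. u x = u' x"
    using Lp_borel_version[OF um] by metis
  have \<rho>m: "\<rho> \<in> borel_measurable lebesgue" using i\<rho> by auto
  obtain \<rho>' where \<rho>'[measurable]: "\<rho>' \<in> borel_measurable borel" and \<rho>\<rho>: "AE x in lborel. \<rho> x = \<rho>' x"
    using Lp_borel_version[OF \<rho>m] by metis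
  have i\<rho>': "integrable lborel \<rho>'" using lebesgue_lborel_integral(2)[OF \<rho>m \<rho>' \<rho>\<rho>] i\<rho> by blast
  have hk: "hess_kernel i j \<in> borel_measurable lebesgue" by (rule borel_measurable_lebesgueI) measurable
  define \<kappa> where "\<kappa> h = hess_kernel i j h * \<rho>' h" for h
  have \<kappa>m[measurable]: "\<kappa> \<in> borel_measurable borel" unfolding \<kappa>_def[abs_def] by measurable
  have i\<kappa>: "integrable lborel \<kappa>"
  proof (rule Bochner_Integration.integrable_bound)
    show "integrable lborel (\<lambda>h. 2 * \<rho>' h)" using i\<rho>' by auto
    show "AE h in lborel. norm (\<kappa> h) \<le> norm (2 * \<rho>' h)"
      unfolding \<kappa>_def using hess_kernel_bound[of i j] by (intro AE_I2) (auto simp: abs_mult intro!: mult_right_mono)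
  qed (use \<kappa>m in simp)
  define v where "v x = c * (LINT h|lborel. \<kappa> h * (second_diff h u' x / (norm h)\<^sup>2))" for x
  have vb: "v \<in> borel_measurable borel" unfolding v_def[abs_def] second_diff_def by measurable
  have main: "integrable lebesgue (\<lambda>x. v x * \<phi> x) \<and> dist_nonlocal_hessian \<rho> u i j \<phi> = \<langle>v, \<phi>\<rangle>" if \<phi>: "\<phi> \<in> Cc_inf" for \<phi>
  proof -
    have \<phi>2: "\<phi> \<in> Cc_k 2" by (rule Cc_inf_Cc_k[OF \<phi>])
    have \<phi>b[measurable]: "\<phi> \<in> borel_measurable borel" by (rule Cc_k_borel[OF \<phi>2])
    have \<phi>i: "integrable lebesgue \<phi>" by (rule Cc_k_integrable[OF \<phi>2])
    obtain A where A: "A \<ge> 0" "\<And>x. \<bar>\<phi> x\<bar> \<le> A" using Cc_k_bounded[OF \<phi>2] by metis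
    define B where "B = (LINT x|lebesgue. \<bar>\<phi> x\<bar>) + A * C"
    have B: "B \<ge> 0" unfolding B_def using A C by (intro add_nonneg_nonneg integral_nonneg_AE) auto
    define f where "f h x = 1 / (norm h)\<^sup>2 * second_diff h u x" for h x
    have fL: "f h \<in> Lp p" and fC: "Lp_mass p (f h) \<le> C" for h
      unfolding f_def using scaled_second_diff_Lp[OF p C q] by blast+
    have fi: "integrable lebesgue (\<lambda>x. f h x * \<phi> x)" for h by (rule Lp_mult_integrable(1)[OF p(1) fL \<phi>i A(2)])
    have fB: "(LINT x|lebesgue. \<bar>f h x * \<phi> x\<bar>) \<le> B" for h
    proof -
      have "(LINT x|lebesgue. \<bar>f h x * \<phi> x\<bar>) \<le> (LINT x|lebesgue. \<bar>\<phi> x\<bar>) + A * Lp_mass p (f h)"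
        by (rule Lp_mult_integrable(2)[OF p(1) fL \<phi>i A(2)])
      also have "\<dots> \<le> B" unfolding B_def using A fC by (intro add_left_mono mult_left_mono) auto
      finally show ?thesis .
    qed
    define W where "W h x = second_diff h u' x / (norm h)\<^sup>2 * \<phi> x" for h x
    have Wm: "(\<lambda>(h, x). W h x) \<in> borel_measurable (borel \<Otimes>\<^sub>M borel)"
      unfolding W_def second_diff_def by measurable
    have Whm: "W h \<in> borel_measurable borel" for h unfolding W_def[abs_def] second_diff_def by measurable
    (* The Borel version must agree with \<open>u\<close> at the translated points too, for each fixed step. *)
    have shAE: "AE x in lborel. u (x + a) = u' (x + a)" for a
    proof -
      have "AE x in distr lborel borel ((+) a). u x = u' x" using uu by (simp only: lborel_distr_plus)
      then have "AE x in lborel. u (a + x) = u' (a + x)" by (rule AE_distrD[rotated]) simp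
      then show ?thesis by (simp add: add.commute)
    qed
    have aeW: "AE x in lborel. f h x * \<phi> x = W h x" for h
      using uu shAE[of h] shAE[of "- h"] by eventually_elim (simp add: W_def f_def second_diff_def)
    have m1: "(\<lambda>x. f h x * \<phi> x) \<in> borel_measurable lebesgue" for h using fi by auto
    have Wi: "integrable lborel (W h)" for h
      using lebesgue_lborel_integral(2)[OF m1 Whm aeW] fi by blast
    have Wb: "(LINT x|lborel. \<bar>W h x\<bar>) \<le> B" for h
    proof -
      have "(LINT x|lebesgue. \<bar>f h x * \<phi> x\<bar>) = (LINT x|lborel. \<bar>W h x\<bar>)"
      proof (rule lebesgue_lborel_integral(1))
        show "AE x in lborel. \<bar>f h x * \<phi> x\<bar> = \<bar>W h x\<bar>" using aeW[of h] by eventually_elim simp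
      qed (use m1[of h] Whm[of h] in measurable)
      then show ?thesis using fB by metis
    qed
    note F = kernel_Fubini[OF Wm i\<kappa> Wi Wb]
    have pair: "(LINT x|lborel. W h x) = second_diff_pairing u \<phi> h" for h
    proof -
      have "(LINT x|lborel. W h x) = \<langle>f h, \<phi>\<rangle>" by (rule lebesgue_lborel_integral(1)[OF m1 Whm aeW, symmetric])
      also have "\<dots> = second_diff_pairing u \<phi> h" unfolding f_def by (rule second_diff_pairing_by_parts[OF p \<phi>2])
      finally show ?thesis .
    qed
    have v\<phi>: "v x * \<phi> x = c * (LINT h|lborel. \<kappa> h * W h x)" for x
    proof -
      have "v x * \<phi> x = c * ((LINT h|lborel. \<kappa> h * (second_diff h u' x / (norm h)\<^sup>2)) * \<phi> x)" by (simp add: v_def)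
      also have "(LINT h|lborel. \<kappa> h * (second_diff h u' x / (norm h)\<^sup>2)) * \<phi> x = (LINT h|lborel. \<kappa> h * (second_diff h u' x / (norm h)\<^sup>2) * \<phi> x)"
        by (rule integral_mult_left_zero[symmetric])
      finally show ?thesis by (simp only: W_def mult.assoc)
    qed
    have vi: "integrable lborel (\<lambda>x. v x * \<phi> x)" unfolding v\<phi> by (intro integrable_mult_right F(1))
    have vm: "(\<lambda>x. v x * \<phi> x) \<in> borel_measurable borel" using vb by measurable
    have "\<langle>v, \<phi>\<rangle> = (LINT x|lborel. v x * \<phi> x)"
      by (rule lebesgue_lborel_integral(1)[OF borel_measurable_lebesgueI[OF vm] vm]) simp
    also have "\<dots> = c * (LINT x|lborel. LINT h|lborel. \<kappa> h * W h x)" unfolding v\<phi> by (rule integral_mult_right_zero)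
    also have "\<dots> = c * (LINT h|lborel. \<kappa> h * second_diff_pairing u \<phi> h)" unfolding F(2) pair ..
    also have "(LINT h|lborel. \<kappa> h * second_diff_pairing u \<phi> h) = (LINT h|lebesgue. (hess_kernel i j h * \<rho> h) * second_diff_pairing u \<phi> h)"
    proof (rule lebesgue_lborel_integral(1)[symmetric])
      have pm: "second_diff_pairing u \<phi> \<in> borel_measurable borel" by (rule dist_nonlocal_hessian_eq(2)[OF p \<phi>2 i\<rho>])
      show "AE h in lborel. (hess_kernel i j h * \<rho> h) * second_diff_pairing u \<phi> h = \<kappa> h * second_diff_pairing u \<phi> h"
        using \<rho>\<rho> by eventually_elim (simp add: \<kappa>_def)
      show "(\<lambda>h. (hess_kernel i j h * \<rho> h) * second_diff_pairing u \<phi> h) \<in> borel_measurable lebesgue"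
        using hk \<rho>m borel_measurable_lebesgueI[OF pm] by measurable
      show "(\<lambda>h. \<kappa> h * second_diff_pairing u \<phi> h) \<in> borel_measurable borel" using \<kappa>m pm by measurable
    qed
    also have "c * \<dots> = dist_nonlocal_hessian \<rho> u i j \<phi>"
      unfolding dist_nonlocal_hessian_eq(1)[OF p \<phi>2 i\<rho>] c_def ..
    finally have "dist_nonlocal_hessian \<rho> u i j \<phi> = \<langle>v, \<phi>\<rangle>" ..
    moreover have "integrable lebesgue (\<lambda>x. v x * \<phi> x)"
      using lebesgue_lborel_integral(2)[OF borel_measurable_lebesgueI[OF vm] vm] vi by simp
    ultimately show ?thesis by blast
  qed
  show ?thesis by (rule that[OF borel_measurable_lebesgueI[OF vb]]) (use main in auto)
qed

text \<open>Assembling the entries gives a representative in \<open>L\<^sup>p\<close>, so the integral is not infinite by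
default; the representative that it refers to is another one, to which the bound applies again.\<close>

lemma quadratic_imp_dnh_integral_bounded:
  fixes u :: "real^'n::finite \<Rightarrow> real"
  assumes p: "p \<ge> 1" "u \<in> Lp p" and C: "C \<ge> 0" and q: "quadratic_diff_bounded p C u"
    and nonneg: "\<And>x. \<rho> x \<ge> 0" and mass: "has_bochner_integral lebesgue \<rho> 1"
  defines "N \<equiv> real CARD('n)"
  shows "dnh_integral p \<rho> u \<le> ennreal ((N * N) powr p * (N * (N * ((N * (N + 2)) powr p * (2 powr p * C)))))"
proof -
  define K where "K = (N * (N + 2)) powr p * (2 powr p * C)"
  have K: "K \<ge> 0" using C by (simp add: K_def)
  have norm_bound: "(\<integral>\<^sup>+x. ennreal (norm (V x) powr p) \<partial>lebesgue) \<le> ennreal ((N * N) powr p * (N * (N * K)))"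
    if m: "\<And>i j. (\<lambda>x. V x $ i $ j) \<in> borel_measurable lebesgue"
      and b: "\<And>i j. (\<integral>\<^sup>+x. ennreal (\<bar>V x $ i $ j\<bar> powr p) \<partial>lebesgue) \<le> ennreal K" for V :: "real^'n \<Rightarrow> real^'n^'n"
  proof -
    have m': "(\<lambda>x. ennreal (\<bar>V x $ i $ j\<bar> powr p)) \<in> borel_measurable lebesgue" for i j using m[of i j] by measurable
    have "(\<integral>\<^sup>+x. ennreal (norm (V x) powr p) \<partial>lebesgue) \<le> (\<integral>\<^sup>+x. ennreal ((N * N) powr p) * (\<Sum>i\<in>UNIV. \<Sum>j\<in>UNIV. ennreal (\<bar>V x $ i $ j\<bar> powr p)) \<partial>lebesgue)"
    proof (rule nn_integral_mono)
      fix x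
      have "ennreal (norm (V x) powr p) \<le> ennreal ((N * N) powr p * (\<Sum>i\<in>UNIV. \<Sum>j\<in>UNIV. \<bar>V x $ i $ j\<bar> powr p))"
        using matrix_norm_powr_le[OF p(1), of "V x"] by (intro ennreal_leI) (simp add: N_def)
      then show "ennreal (norm (V x) powr p) \<le> ennreal ((N * N) powr p) * (\<Sum>i\<in>UNIV. \<Sum>j\<in>UNIV. ennreal (\<bar>V x $ i $ j\<bar> powr p))"
        by (simp add: ennreal_mult sum_nonneg)
    qed
    also have "\<dots> = ennreal ((N * N) powr p) * (\<integral>\<^sup>+x. (\<Sum>i\<in>UNIV. \<Sum>j\<in>UNIV. ennreal (\<bar>V x $ i $ j\<bar> powr p)) \<partial>lebesgue)"
      by (rule nn_integral_cmult) (use m' in measurable)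
    also have "(\<integral>\<^sup>+x. (\<Sum>i\<in>UNIV. \<Sum>j\<in>UNIV. ennreal (\<bar>V x $ i $ j\<bar> powr p)) \<partial>lebesgue)
      = (\<Sum>i\<in>UNIV. \<Sum>j\<in>UNIV. \<integral>\<^sup>+x. ennreal (\<bar>V x $ i $ j\<bar> powr p) \<partial>lebesgue)"
    proof -
      have "(\<integral>\<^sup>+x. (\<Sum>i\<in>UNIV. \<Sum>j\<in>UNIV. ennreal (\<bar>V x $ i $ j\<bar> powr p)) \<partial>lebesgue)
        = (\<Sum>i\<in>UNIV. \<integral>\<^sup>+x. (\<Sum>j\<in>UNIV. ennreal (\<bar>V x $ i $ j\<bar> powr p)) \<partial>lebesgue)"
        by (rule nn_integral_sum) (use m' in measurable)
      also have "\<dots> = (\<Sum>i\<in>UNIV. \<Sum>j\<in>UNIV. \<integral>\<^sup>+x. ennreal (\<bar>V x $ i $ j\<bar> powr p) \<partial>lebesgue)"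
        by (intro sum.cong refl nn_integral_sum m')
      finally show ?thesis .
    qed
    also have "\<dots> \<le> (\<Sum>i\<in>(UNIV::'n set). \<Sum>j\<in>(UNIV::'n set). ennreal K)"
      by (intro sum_mono b)
    also have "\<dots> = ennreal (N * (N * K))"
      using K by (simp add: N_def ennreal_mult ennreal_of_nat_eq_real_of_nat)
    finally have "(\<integral>\<^sup>+x. ennreal (norm (V x) powr p) \<partial>lebesgue) \<le> ennreal ((N * N) powr p) * ennreal (N * (N * K))"
      by (simp add: mult_left_mono)
    then show ?thesis using K by (simp add: ennreal_mult N_def)
  qed
  define R where "R i j v \<longleftrightarrow> v \<in> borel_measurable lebesgue \<and> (\<forall>\<phi>\<in>Cc_inf. integrable lebesgue (\<lambda>x. v x * \<phi> x)) \<and>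
      (\<forall>\<phi>\<in>Cc_inf. dist_nonlocal_hessian \<rho> u i j \<phi> = \<langle>v, \<phi>\<rangle>)" for i j v
  have "\<exists>v. R i j v" for i j
    unfolding R_def by (rule representative_exists[OF p C q mass, where i = i and j = j]) blast
  then obtain v where "\<And>i j. R i j (v i j)" by metis
  then have v: "\<And>i j. v i j \<in> borel_measurable lebesgue" "\<And>i j \<phi>. \<phi> \<in> Cc_inf \<Longrightarrow> integrable lebesgue (\<lambda>x. v i j x * \<phi> x)"
    "\<And>i j \<phi>. \<phi> \<in> Cc_inf \<Longrightarrow> dist_nonlocal_hessian \<rho> u i j \<phi> = \<langle>v i j, \<phi>\<rangle>"
    unfolding R_def by blast+
  have vK: "(\<integral>\<^sup>+x. ennreal (\<bar>v i j x\<bar> powr p) \<partial>lebesgue) \<le> ennreal K" for i j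
    unfolding K_def N_def by (rule representative_bound[OF p C q nonneg mass v])
  define V :: "real^'n \<Rightarrow> real^'n^'n" where "V x = (\<Sum>i\<in>UNIV. \<Sum>j\<in>UNIV. v i j x *\<^sub>R axis i (axis j 1))" for x
  have Vv: "V x $ i $ j = v i j x" for x i j
  proof -
    have "V x $ i $ j = (\<Sum>k\<in>UNIV. \<Sum>l\<in>UNIV. if l = j then (if k = i then v k l x else 0) else 0)"
      unfolding V_def sum_component by (intro sum.cong refl) (auto simp: axis_def)
    then show ?thesis by simp
  qed
  have Vm: "V \<in> borel_measurable lebesgue" unfolding V_def[abs_def] using v(1) by measurable
  have Vb: "(\<integral>\<^sup>+x. ennreal (norm (V x) powr p) \<partial>lebesgue) \<le> ennreal ((N * N) powr p * (N * (N * K)))"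
    by (rule norm_bound) (simp_all add: Vv v(1) vK)
  have "integrable lebesgue (\<lambda>x. norm (V x) powr p)"
    by (rule integrableI_nonneg) (use Vm Vb in \<open>auto intro: le_less_trans\<close>)
  then have VL: "V \<in> Lp p" using Vm by (simp add: Lp_def)
  have "represents_dnh \<rho> u V" unfolding represents_dnh_def Vv using v(3) by blast
  with VL have ex: "\<exists>V. V \<in> Lp p \<and> represents_dnh \<rho> u V" by blast
  (* The representative selected in the definition of \<open>dnh_integral\<close>. *)
  define V' where "V' = (SOME V. V \<in> Lp p \<and> represents_dnh \<rho> u V)"
  have V': "V' \<in> Lp p" "represents_dnh \<rho> u V'" unfolding V'_def using someI_ex[OF ex] by auto
  have L: "(\<lambda>x. V' x $ i $ j) \<in> Lp p" for i j by (rule Lp_entry(1)[OF p(1) V'(1)])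
  have "(\<integral>\<^sup>+x. ennreal (norm (V' x) powr p) \<partial>lebesgue) \<le> ennreal ((N * N) powr p * (N * (N * K)))"
  proof (rule norm_bound)
    show m: "(\<lambda>x. V' x $ i $ j) \<in> borel_measurable lebesgue" for i j using L by (simp add: Lp_real)
    show "(\<integral>\<^sup>+x. ennreal (\<bar>V' x $ i $ j\<bar> powr p) \<partial>lebesgue) \<le> ennreal K" for i j
      unfolding K_def N_def
    proof (rule representative_bound[OF p C q nonneg mass m, where i = i and j = j])
      fix \<phi> :: "real^'n \<Rightarrow> real" assume \<phi>: "\<phi> \<in> Cc_inf"
      show "integrable lebesgue (\<lambda>x. V' x $ i $ j * \<phi> x)" by (rule Lp_Cc_k_integrable[OF p(1) L Cc_inf_Cc_k[OF \<phi>]])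
      show "dist_nonlocal_hessian \<rho> u i j \<phi> = (LINT x|lebesgue. V' x $ i $ j * \<phi> x)" using V'(2) \<phi> by (simp add: represents_dnh_def)
    qed
  qed
  then show ?thesis using ex unfolding dnh_integral_def V'_def K_def by auto
qed

lemma liminf_finite_iff_quadratic:
  fixes u :: "real^'n::finite \<Rightarrow> real" and \<rho> :: "nat \<Rightarrow> real^'n \<Rightarrow> real"
  assumes nonneg: "\<And>n x. \<rho> n x \<ge> 0"
    and radial: "\<And>n x y. norm x = norm y \<Longrightarrow> \<rho> n x = \<rho> n y"
    and mass: "\<And>n. has_bochner_integral lebesgue (\<rho> n) 1"
    and conc: "\<And>\<gamma>. \<gamma> > 0 \<Longrightarrow> (\<lambda>n. LINT x:{x. norm x > \<gamma>}|lebesgue. \<rho> n x) \<longlonglongrightarrow> 0"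
    and p: "p \<ge> 1" "u \<in> Lp p"
  shows "liminf (\<lambda>n. dnh_integral p (\<rho> n) u) < \<infinity> \<longleftrightarrow> (\<exists>C\<ge>0. quadratic_diff_bounded p C u)"
proof
  assume "liminf (\<lambda>n. dnh_integral p (\<rho> n) u) < \<infinity>"
  then show "\<exists>C\<ge>0. quadratic_diff_bounded p C u"
    by (rule liminf_finite_imp_quadratic[where \<rho> = \<rho>, rotated -1])
      (rule nonneg | erule radial | rule mass | erule conc | rule p)+
next
  assume "\<exists>C\<ge>0. quadratic_diff_bounded p C u"
  then obtain C where C: "C \<ge> 0" "quadratic_diff_bounded p C u" by blast
  obtain B where B: "\<And>n. dnh_integral p (\<rho> n) u \<le> ennreal B"
    using quadratic_imp_dnh_integral_bounded[OF p C nonneg mass] by blast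
  have "liminf (\<lambda>n. dnh_integral p (\<rho> n) u) \<le> ennreal B"
    by (rule Liminf_le) (use B in auto)
  then show "liminf (\<lambda>n. dnh_integral p (\<rho> n) u) < \<infinity>" by (rule le_less_trans) simp
qed

theorem theorem1p7:
  fixes \<rho> :: "nat \<Rightarrow> real^'n::finite \<Rightarrow> real"
  assumes nonneg: "\<And>n x. \<rho> n x \<ge> 0"
    and radial: "\<And>n x y. norm x = norm y \<Longrightarrow> \<rho> n x = \<rho> n y"
    and mass: "\<And>n. has_bochner_integral lebesgue (\<rho> n) 1"
    and conc: "\<And>\<gamma>. \<gamma> > 0 \<Longrightarrow>
      (\<lambda>n. LINT x:{x. norm x > \<gamma>}|lebesgue. \<rho> n x) \<longlonglongrightarrow> 0"
  shows "(\<forall>p>1. \<forall>u \<in> Lp p.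
            u \<in> Sobolev 2 p \<longleftrightarrow> liminf (\<lambda>n. dnh_integral p (\<rho> n) u) < \<infinity>)
       \<and> (\<forall>u \<in> Lp 1.
            u \<in> BV2 \<longleftrightarrow> liminf (\<lambda>n. dnh_integral 1 (\<rho> n) u) < \<infinity>)"
proof (intro conjI allI impI ballI)
  have iff: "liminf (\<lambda>n. dnh_integral p (\<rho> n) u) < \<infinity> \<longleftrightarrow> (\<exists>C\<ge>0. quadratic_diff_bounded p C u)"
    if "p \<ge> 1" "u \<in> Lp p" for p u
    by (rule liminf_finite_iff_quadratic)
      (rule nonneg | erule radial | rule mass | erule conc | rule that)+
  show "u \<in> Sobolev 2 p \<longleftrightarrow> liminf (\<lambda>n. dnh_integral p (\<rho> n) u) < \<infinity>" if "p > 1" "u \<in> Lp p" for p u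
    using Sobolev_iff_quadratic[OF that] iff[of p u] that by simp
  show "u \<in> BV2 \<longleftrightarrow> liminf (\<lambda>n. dnh_integral 1 (\<rho> n) u) < \<infinity>" if "u \<in> Lp 1" for u
    using BV2_iff_quadratic[OF that] iff[of 1 u] that by simp
qed

end
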